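(* Let $t_1,t_2$ be terms of the source language $\lambda^\tau$ and $\tau$ a source type with $\emptyset\vdash t_1:\tau$ and $\emptyset\vdash t_2:\tau$. Then $$\emptyset\vdash t_1\simeq_{ctx}t_2:\tau\quad\Longleftrightarrow\quad \emptyset\vdash[\![t_1]\!]\simeq_{ctx}[\![t_2]\!],$$ where the left-hand side is contextual equivalence in $\lambda^\tau$, the right-hand side is contextual equivalence in the target language $\lambda^u$, and $[\![\cdot]\!]$ is the compiler $[\![t]\!]=\mathsf{protect}_\tau\,(\mathrm{erase}(t))$ (for $t$ of type $\tau$).
   Context: Source objects are written $t,v,E,C$; target objects $\mathsf t,\mathsf v,\mathsf E,\mathsf C$. **Source language $\lambda^\tau$.** Types: $\tau::=\mathtt{Unit}\mid\mathtt{Bool}\mid\tau\to\tau\mid\tau\times\tau\mid\tau\uplus\tau$. Terms: $t::=\mathtt{unit}\mid\mathtt{true}\mid\mathtt{false}\mid\lambda x{:}\tau.t\mid x\mid t\,t\mid t.1\mid t.2\mid\langle t,t\rangle\mid\mathrm{inl}\,t\mid\mathrm{inr}\,t\mid(\mathrm{case}\,t\,\mathrm{of}\,\mathrm{inl}\,x_1\mapsto t\mid\mathrm{inr}\,x_2\mapsto t)\mid t;t\mid\mathrm{if}\,t\,\mathrm{then}\,t\,\mathrm{else}\,t\mid\mathrm{fix}_{\tau\to\tau}\,t$. Values: $v::=\mathtt{unit}\mid\mathtt{true}\mid\mathtt{false}\mid\lambda x{:}\tau.t\mid\langle v,v\rangle\mid\mathrm{inl}\,v\mid\mathrm{inr}\,v$.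 Typing $\Gamma\vdash t:\tau$ is the standard simple typing; in particular $\Gamma\vdash t_1;t_2:\tau$ if $\Gamma\vdash t_1:\mathtt{Unit}$ and $\Gamma\vdash t_2:\tau$, and $\Gamma\vdash\mathrm{fix}_{\tau_1\to\tau_2}\,t:\tau_1\to\tau_2$ if $\Gamma\vdash t:(\tau_1\to\tau_2)\to(\tau_1\to\tau_2)$. Evaluation contexts (call-by-value, left-to-right): $E::=[\cdot]\mid E\,t\mid v\,E\mid E.1\mid E.2\mid\langle E,t\rangle\mid\langle v,E\rangle\mid\mathrm{inl}\,E\mid\mathrm{inr}\,E\mid(\mathrm{case}\,E\,\mathrm{of}\ldots)\mid E;t\mid\mathrm{if}\,E\,\mathrm{then}\,t\,\mathrm{else}\,t\mid\mathrm{fix}_{\tau\to\tau}\,E$. Reduction $\hookrightarrow$ is closed under evaluation contexts and generated by $(\lambda x{:}\tau.t)\,v\hookrightarrow t[v/x]$; $\langle v_1,v_2\rangle.i\hookrightarrow v_i$; $\mathrm{case}\,\mathrm{inl}\,v\,\mathrm{of}\,\mathrm{inl}\,x_1\mapsto t_1\mid\mathrm{inr}\,x_2\mapsto t_2\hookrightarrow t_1[v/x_1]$ and symmetrically $t_2[v/x_2]$ for $\mathrm{inr}\,v$; $\mathtt{unit};t\hookrightarrow t$; the usual rules for $\mathrm{if}$; and $\mathrm{fix}_{\tau_1\to\tau_2}(\lambda x{:}\tau_1\to\tau_2.t)\hookrightarrow t[(\lambda y{:}\tau_1.\,\mathrm{fix}_{\tau_1\to\tau_2}(\lambda x{:}\tau_1\to\tau_2.t)\,y)/x]$.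 $t\Downarrow$ means $t\hookrightarrow^*v$ for some value $v$. **Target language $\lambda^u$.** Terms: the same grammar without types and without $\mathrm{fix}$, i.e. $\mathtt{unit},\mathtt{true},\mathtt{false}$, $\lambda x.\mathsf t$, variables, application, projections, pairs, $\mathrm{inl}/\mathrm{inr}$, $\mathrm{case}$, $;$, $\mathrm{if}$, plus a non-value term $\mathsf{wrong}$. Values and evaluation contexts are as in the source (without types and $\mathrm{fix}$). Reduction uses the same rules (except $\mathrm{fix}$), plus: $\mathsf E[\mathsf{wrong}]\hookrightarrow\mathsf{wrong}$ for $\mathsf E\neq[\cdot]$, and every elimination of a value of the wrong shape reduces to $\mathsf{wrong}$ (applying a non-$\lambda$, projecting from a non-pair, case on a value not of the form $\mathrm{inl}/\mathrm{inr}$, $\mathrm{if}$ on a non-boolean, $\mathsf v;\mathsf t$ with $\mathsf v\ne\mathtt{unit}$). $\mathsf t\Downarrow$ means $\mathsf t\hookrightarrow^*\mathsf v$ for a value $\mathsf v$ (so not $\mathsf{wrong}$). Target contexts $\Gamma$ are lists of variables; $\Gamma\vdash\mathsf t$ means the free variables of $\mathsf t$ are in $\Gamma$. **Contextual equivalence.** A program context is a term with exactly one hole in place of a subterm (possibly under binders; plugging may capture variables). $\vdash C:\Gamma',\tau'\to\Gamma,\tau$ is the standard typing of source contexts, guaranteeing $\Gamma\vdash C[t]:\tau$ whenever $\Gamma'\vdash t:\tau'$; $\vdash\mathsf C:\Gamma'\to\Gamma$ is the analogous well-scopedness judgement for target contexts. $\Gamma\vdash t_1\simeq_{ctx}t_2:\tau$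 means: for all $\tau'$ and $C$ with $\vdash C:\Gamma,\tau\to\emptyset,\tau'$, $C[t_1]\Downarrow$ iff $C[t_2]\Downarrow$. $\Gamma\vdash\mathsf t_1\simeq_{ctx}\mathsf t_2$ means: for all $\mathsf C$ with $\vdash\mathsf C:\Gamma\to\emptyset$, $\mathsf C[\mathsf t_1]\Downarrow$ iff $\mathsf C[\mathsf t_2]\Downarrow$. **Compiler.** $\mathrm{erase}$ maps each source construct to the corresponding target construct, dropping type annotations, with $\mathrm{erase}(\mathrm{fix}_{\tau_1\to\tau_2}\,t)=\mathsf{fix}\;\mathrm{erase}(t)$, where $\mathsf{fix}=\lambda f.(\lambda x.f(\lambda y.x\,x\,y))(\lambda x.f(\lambda y.x\,x\,y))$. The target terms $\mathsf{protect}_\tau,\mathsf{confine}_\tau$ are defined by mutual recursion on $\tau$: - $\mathsf{protect}_{\mathtt{Unit}}=\mathsf{protect}_{\mathtt{Bool}}=\lambda x.x$; - $\mathsf{protect}_{\tau_1\times\tau_2}=\lambda y.\langle\mathsf{protect}_{\tau_1}(y.1),\mathsf{protect}_{\tau_2}(y.2)\rangle$; - $\mathsf{protect}_{\tau_1\uplus\tau_2}=\lambda y.\mathrm{case}\,y\,\mathrm{of}\,\mathrm{inl}\,x\mapsto\mathrm{inl}(\mathsf{protect}_{\tau_1}x)\mid\mathrm{inr}\,x\mapsto\mathrm{inr}(\mathsf{protect}_{\tau_2}x)$; - $\mathsf{protect}_{\tau_1\to\tau_2}=\lambda y.\lambda x.\mathsf{protect}_{\tau_2}(y(\mathsf{confine}_{\tau_1}x))$;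 - $\mathsf{confine}_{\mathtt{Unit}}=\lambda y.(y;\mathtt{unit})$; $\mathsf{confine}_{\mathtt{Bool}}=\lambda y.\mathrm{if}\,y\,\mathrm{then}\,\mathtt{true}\,\mathrm{else}\,\mathtt{false}$; - $\mathsf{confine}_{\tau_1\times\tau_2}$, $\mathsf{confine}_{\tau_1\uplus\tau_2}$: as for $\mathsf{protect}$, with $\mathsf{confine}_{\tau_i}$ in place of $\mathsf{protect}_{\tau_i}$; - $\mathsf{confine}_{\tau_1\to\tau_2}=\lambda y.\lambda x.\mathsf{confine}_{\tau_2}(y(\mathsf{protect}_{\tau_1}x))$. For $\Gamma\vdash t:\tau$, $[\![t]\!]:=\mathsf{protect}_\tau\,(\mathrm{erase}(t))$. *)

theory Defs
  imports Main
begin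

text \<open>
  Terms are in de Bruijn form, so syntax is taken up to alpha-equivalence: \<open>SLam \<tau> t\<close> and \<open>ULam t\<close>
  bind index \<open>0\<close> in \<open>t\<close>, and \<open>SCase t t1 t2\<close>, \<open>UCase t t1 t2\<close> bind index \<open>0\<close> in each of \<open>t1\<close> and \<open>t2\<close>.
  A source typing environment is the list of the types of the indices \<open>0, 1, \<dots>\<close>; a target
  environment, a list of variables in the named presentation, is the number of indices in scope.
\<close>

section \<open>The source language\<close>

datatype ty = TUnit | TBool | TFun ty ty | TProd ty ty | TSum ty ty

datatype strm =
    SUnit | STrue | SFalse
  | SLam ty strm
  | SVar nat
  | SApp strm strm
  | SFst strm | SSnd strm
  | SPair strm strm
  | SInl strm | SInr strm
  | SCase strm strm strm
  | SSeq strm strm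
  | SIf strm strm strm
  | SFix ty ty strm  \<comment> \<open>\<open>SFix \<tau>1 \<tau>2\<close> is fix with annotation \<open>\<tau>1 \<rightarrow> \<tau>2\<close>\<close>

inductive sval :: "strm \<Rightarrow> bool" where
  "sval SUnit"
| "sval STrue"
| "sval SFalse"
| "sval (SLam \<tau> t)"
| "sval v1 \<Longrightarrow> sval v2 \<Longrightarrow> sval (SPair v1 v2)"
| "sval v \<Longrightarrow> sval (SInl v)"
| "sval v \<Longrightarrow> sval (SInr v)"

inductive styping :: "ty list \<Rightarrow> strm \<Rightarrow> ty \<Rightarrow> bool" ("_ \<turnstile>\<^sub>s _ \<Colon> _" [51, 51, 51] 50) where
  "\<Gamma> \<turnstile>\<^sub>s SUnit \<Colon> TUnit"
| "\<Gamma> \<turnstile>\<^sub>s STrue \<Colon> TBool"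
| "\<Gamma> \<turnstile>\<^sub>s SFalse \<Colon> TBool"
| "\<tau>1 # \<Gamma> \<turnstile>\<^sub>s t \<Colon> \<tau>2 \<Longrightarrow> \<Gamma> \<turnstile>\<^sub>s SLam \<tau>1 t \<Colon> TFun \<tau>1 \<tau>2"
| "i < length \<Gamma> \<Longrightarrow> \<Gamma> ! i = \<tau> \<Longrightarrow> \<Gamma> \<turnstile>\<^sub>s SVar i \<Colon> \<tau>"
| "\<Gamma> \<turnstile>\<^sub>s t1 \<Colon> TFun \<tau>1 \<tau>2 \<Longrightarrow> \<Gamma> \<turnstile>\<^sub>s t2 \<Colon> \<tau>1 \<Longrightarrow> \<Gamma> \<turnstile>\<^sub>s SApp t1 t2 \<Colon> \<tau>2"
| "\<Gamma> \<turnstile>\<^sub>s t \<Colon> TProd \<tau>1 \<tau>2 \<Longrightarrow> \<Gamma> \<turnstile>\<^sub>s SFst t \<Colon> \<tau>1"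
| "\<Gamma> \<turnstile>\<^sub>s t \<Colon> TProd \<tau>1 \<tau>2 \<Longrightarrow> \<Gamma> \<turnstile>\<^sub>s SSnd t \<Colon> \<tau>2"
| "\<Gamma> \<turnstile>\<^sub>s t1 \<Colon> \<tau>1 \<Longrightarrow> \<Gamma> \<turnstile>\<^sub>s t2 \<Colon> \<tau>2 \<Longrightarrow> \<Gamma> \<turnstile>\<^sub>s SPair t1 t2 \<Colon> TProd \<tau>1 \<tau>2"
| "\<Gamma> \<turnstile>\<^sub>s t \<Colon> \<tau>1 \<Longrightarrow> \<Gamma> \<turnstile>\<^sub>s SInl t \<Colon> TSum \<tau>1 \<tau>2"
| "\<Gamma> \<turnstile>\<^sub>s t \<Colon> \<tau>2 \<Longrightarrow> \<Gamma> \<turnstile>\<^sub>s SInr t \<Colon> TSum \<tau>1 \<tau>2"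
| "\<Gamma> \<turnstile>\<^sub>s t \<Colon> TSum \<tau>1 \<tau>2 \<Longrightarrow> \<tau>1 # \<Gamma> \<turnstile>\<^sub>s t1 \<Colon> \<tau> \<Longrightarrow> \<tau>2 # \<Gamma> \<turnstile>\<^sub>s t2 \<Colon> \<tau> \<Longrightarrow> \<Gamma> \<turnstile>\<^sub>s SCase t t1 t2 \<Colon> \<tau>"
| "\<Gamma> \<turnstile>\<^sub>s t1 \<Colon> TUnit \<Longrightarrow> \<Gamma> \<turnstile>\<^sub>s t2 \<Colon> \<tau> \<Longrightarrow> \<Gamma> \<turnstile>\<^sub>s SSeq t1 t2 \<Colon> \<tau>"
| "\<Gamma> \<turnstile>\<^sub>s t \<Colon> TBool \<Longrightarrow> \<Gamma> \<turnstile>\<^sub>s t1 \<Colon> \<tau> \<Longrightarrow> \<Gamma> \<turnstile>\<^sub>s t2 \<Colon> \<tau> \<Longrightarrow> \<Gamma> \<turnstile>\<^sub>s SIf t t1 t2 \<Colon> \<tau>"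
| "\<Gamma> \<turnstile>\<^sub>s t \<Colon> TFun (TFun \<tau>1 \<tau>2) (TFun \<tau>1 \<tau>2) \<Longrightarrow> \<Gamma> \<turnstile>\<^sub>s SFix \<tau>1 \<tau>2 t \<Colon> TFun \<tau>1 \<tau>2"

text \<open>\<open>slift k t\<close> increments the indices \<open>\<ge> k\<close> of \<open>t\<close>.\<close>

primrec slift :: "nat \<Rightarrow> strm \<Rightarrow> strm" where
  "slift k SUnit = SUnit"
| "slift k STrue = STrue"
| "slift k SFalse = SFalse"
| "slift k (SLam \<tau> t) = SLam \<tau> (slift (Suc k) t)"
| "slift k (SVar i) = SVar (if i < k then i else Suc i)"
| "slift k (SApp t1 t2) = SApp (slift k t1) (slift k t2)"
| "slift k (SFst t) = SFst (slift k t)"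
| "slift k (SSnd t) = SSnd (slift k t)"
| "slift k (SPair t1 t2) = SPair (slift k t1) (slift k t2)"
| "slift k (SInl t) = SInl (slift k t)"
| "slift k (SInr t) = SInr (slift k t)"
| "slift k (SCase t t1 t2) = SCase (slift k t) (slift (Suc k) t1) (slift (Suc k) t2)"
| "slift k (SSeq t1 t2) = SSeq (slift k t1) (slift k t2)"
| "slift k (SIf t t1 t2) = SIf (slift k t) (slift k t1) (slift k t2)"
| "slift k (SFix \<tau>1 \<tau>2 t) = SFix \<tau>1 \<tau>2 (slift k t)"

text \<open>\<open>ssubst k s t\<close> replaces index \<open>k\<close> of \<open>t\<close> by \<open>s\<close> and removes \<open>k\<close> from the scope, decrementing
  the indices above it.\<close>

primrec ssubst :: "nat \<Rightarrow> strm \<Rightarrow> strm \<Rightarrow> strm" where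
  "ssubst k s SUnit = SUnit"
| "ssubst k s STrue = STrue"
| "ssubst k s SFalse = SFalse"
| "ssubst k s (SLam \<tau> t) = SLam \<tau> (ssubst (Suc k) (slift 0 s) t)"
| "ssubst k s (SVar i) = (if i < k then SVar i else if i = k then s else SVar (i - 1))"
| "ssubst k s (SApp t1 t2) = SApp (ssubst k s t1) (ssubst k s t2)"
| "ssubst k s (SFst t) = SFst (ssubst k s t)"
| "ssubst k s (SSnd t) = SSnd (ssubst k s t)"
| "ssubst k s (SPair t1 t2) = SPair (ssubst k s t1) (ssubst k s t2)"
| "ssubst k s (SInl t) = SInl (ssubst k s t)"
| "ssubst k s (SInr t) = SInr (ssubst k s t)"
| "ssubst k s (SCase t t1 t2) =
     SCase (ssubst k s t) (ssubst (Suc k) (slift 0 s) t1) (ssubst (Suc k) (slift 0 s) t2)"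
| "ssubst k s (SSeq t1 t2) = SSeq (ssubst k s t1) (ssubst k s t2)"
| "ssubst k s (SIf t t1 t2) = SIf (ssubst k s t) (ssubst k s t1) (ssubst k s t2)"
| "ssubst k s (SFix \<tau>1 \<tau>2 t) = SFix \<tau>1 \<tau>2 (ssubst k s t)"

text \<open>Program contexts: a numbered constructor has its hole in the argument with that number.\<close>

datatype sctx =
    SHole
  | SCLam ty sctx
  | SCApp1 sctx strm | SCApp2 strm sctx
  | SCFst sctx | SCSnd sctx
  | SCPair1 sctx strm | SCPair2 strm sctx
  | SCInl sctx | SCInr sctx
  | SCCase1 sctx strm strm | SCCase2 strm sctx strm | SCCase3 strm strm sctx
  | SCSeq1 sctx strm | SCSeq2 strm sctx
  | SCIf1 sctx strm strm | SCIf2 strm sctx strm | SCIf3 strm strm sctx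
  | SCFix ty ty sctx

text \<open>Plugging does not lift the plugged term, so its indices may be captured by the binders of the
  context.\<close>

primrec splug :: "sctx \<Rightarrow> strm \<Rightarrow> strm" where
  "splug SHole t = t"
| "splug (SCLam \<tau> C) t = SLam \<tau> (splug C t)"
| "splug (SCApp1 C t2) t = SApp (splug C t) t2"
| "splug (SCApp2 t1 C) t = SApp t1 (splug C t)"
| "splug (SCFst C) t = SFst (splug C t)"
| "splug (SCSnd C) t = SSnd (splug C t)"
| "splug (SCPair1 C t2) t = SPair (splug C t) t2"
| "splug (SCPair2 t1 C) t = SPair t1 (splug C t)"
| "splug (SCInl C) t = SInl (splug C t)"
| "splug (SCInr C) t = SInr (splug C t)"
| "splug (SCCase1 C t2 t3) t = SCase (splug C t) t2 t3"
| "splug (SCCase2 t1 C t3) t = SCase t1 (splug C t) t3"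
| "splug (SCCase3 t1 t2 C) t = SCase t1 t2 (splug C t)"
| "splug (SCSeq1 C t2) t = SSeq (splug C t) t2"
| "splug (SCSeq2 t1 C) t = SSeq t1 (splug C t)"
| "splug (SCIf1 C t2 t3) t = SIf (splug C t) t2 t3"
| "splug (SCIf2 t1 C t3) t = SIf t1 (splug C t) t3"
| "splug (SCIf3 t1 t2 C) t = SIf t1 t2 (splug C t)"
| "splug (SCFix \<tau>1 \<tau>2 C) t = SFix \<tau>1 \<tau>2 (splug C t)"

text \<open>The evaluation contexts, as a subset of the program contexts.\<close>

inductive sectx :: "sctx \<Rightarrow> bool" where
  "sectx SHole"
| "sectx E \<Longrightarrow> sectx (SCApp1 E t)"
| "sval v \<Longrightarrow> sectx E \<Longrightarrow> sectx (SCApp2 v E)"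
| "sectx E \<Longrightarrow> sectx (SCFst E)"
| "sectx E \<Longrightarrow> sectx (SCSnd E)"
| "sectx E \<Longrightarrow> sectx (SCPair1 E t)"
| "sval v \<Longrightarrow> sectx E \<Longrightarrow> sectx (SCPair2 v E)"
| "sectx E \<Longrightarrow> sectx (SCInl E)"
| "sectx E \<Longrightarrow> sectx (SCInr E)"
| "sectx E \<Longrightarrow> sectx (SCCase1 E t1 t2)"
| "sectx E \<Longrightarrow> sectx (SCSeq1 E t)"
| "sectx E \<Longrightarrow> sectx (SCIf1 E t1 t2)"
| "sectx E \<Longrightarrow> sectx (SCFix \<tau>1 \<tau>2 E)"

inductive sred :: "strm \<Rightarrow> strm \<Rightarrow> bool" where
  "sval v \<Longrightarrow> sred (SApp (SLam \<tau> t) v) (ssubst 0 v t)"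
| "sval v1 \<Longrightarrow> sval v2 \<Longrightarrow> sred (SFst (SPair v1 v2)) v1"
| "sval v1 \<Longrightarrow> sval v2 \<Longrightarrow> sred (SSnd (SPair v1 v2)) v2"
| "sval v \<Longrightarrow> sred (SCase (SInl v) t1 t2) (ssubst 0 v t1)"
| "sval v \<Longrightarrow> sred (SCase (SInr v) t1 t2) (ssubst 0 v t2)"
| "sred (SSeq SUnit t) t"
| "sred (SIf STrue t1 t2) t1"
| "sred (SIf SFalse t1 t2) t2"
| "sred (SFix \<tau>1 \<tau>2 (SLam (TFun \<tau>1 \<tau>2) t))
     (ssubst 0 (SLam \<tau>1 (SApp (slift 0 (SFix \<tau>1 \<tau>2 (SLam (TFun \<tau>1 \<tau>2) t))) (SVar 0))) t)"

inductive sstep :: "strm \<Rightarrow> strm \<Rightarrow> bool" where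
  "sectx E \<Longrightarrow> sred t t' \<Longrightarrow> sstep (splug E t) (splug E t')"

definition sconverges :: "strm \<Rightarrow> bool" ("_ \<Down>\<^sub>s" [100] 50) where
  "t \<Down>\<^sub>s \<longleftrightarrow> (\<exists>v. sstep\<^sup>*\<^sup>* t v \<and> sval v)"

text \<open>\<open>\<turnstile>\<^sub>s C : \<Gamma>', \<tau>' \<rightarrow> \<Gamma>, \<tau>\<close>\<close>

inductive sctx_typing :: "sctx \<Rightarrow> ty list \<Rightarrow> ty \<Rightarrow> ty list \<Rightarrow> ty \<Rightarrow> bool"
    ("\<turnstile>\<^sub>s _ : _, _ \<rightarrow> _, _" [51, 51, 51, 51, 51] 50) where
  "\<turnstile>\<^sub>s SHole : \<Gamma>', \<tau>' \<rightarrow> \<Gamma>', \<tau>'"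
| "\<turnstile>\<^sub>s C : \<Gamma>', \<tau>' \<rightarrow> \<tau>1 # \<Gamma>, \<tau>2 \<Longrightarrow> \<turnstile>\<^sub>s SCLam \<tau>1 C : \<Gamma>', \<tau>' \<rightarrow> \<Gamma>, TFun \<tau>1 \<tau>2"
| "\<turnstile>\<^sub>s C : \<Gamma>', \<tau>' \<rightarrow> \<Gamma>, TFun \<tau>1 \<tau>2 \<Longrightarrow> \<Gamma> \<turnstile>\<^sub>s t2 \<Colon> \<tau>1 \<Longrightarrow> \<turnstile>\<^sub>s SCApp1 C t2 : \<Gamma>', \<tau>' \<rightarrow> \<Gamma>, \<tau>2"
| "\<Gamma> \<turnstile>\<^sub>s t1 \<Colon> TFun \<tau>1 \<tau>2 \<Longrightarrow> \<turnstile>\<^sub>s C : \<Gamma>', \<tau>' \<rightarrow> \<Gamma>, \<tau>1 \<Longrightarrow> \<turnstile>\<^sub>s SCApp2 t1 C : \<Gamma>', \<tau>' \<rightarrow> \<Gamma>, \<tau>2"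
| "\<turnstile>\<^sub>s C : \<Gamma>', \<tau>' \<rightarrow> \<Gamma>, TProd \<tau>1 \<tau>2 \<Longrightarrow> \<turnstile>\<^sub>s SCFst C : \<Gamma>', \<tau>' \<rightarrow> \<Gamma>, \<tau>1"
| "\<turnstile>\<^sub>s C : \<Gamma>', \<tau>' \<rightarrow> \<Gamma>, TProd \<tau>1 \<tau>2 \<Longrightarrow> \<turnstile>\<^sub>s SCSnd C : \<Gamma>', \<tau>' \<rightarrow> \<Gamma>, \<tau>2"
| "\<turnstile>\<^sub>s C : \<Gamma>', \<tau>' \<rightarrow> \<Gamma>, \<tau>1 \<Longrightarrow> \<Gamma> \<turnstile>\<^sub>s t2 \<Colon> \<tau>2 \<Longrightarrow> \<turnstile>\<^sub>s SCPair1 C t2 : \<Gamma>', \<tau>' \<rightarrow> \<Gamma>, TProd \<tau>1 \<tau>2"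
| "\<Gamma> \<turnstile>\<^sub>s t1 \<Colon> \<tau>1 \<Longrightarrow> \<turnstile>\<^sub>s C : \<Gamma>', \<tau>' \<rightarrow> \<Gamma>, \<tau>2 \<Longrightarrow> \<turnstile>\<^sub>s SCPair2 t1 C : \<Gamma>', \<tau>' \<rightarrow> \<Gamma>, TProd \<tau>1 \<tau>2"
| "\<turnstile>\<^sub>s C : \<Gamma>', \<tau>' \<rightarrow> \<Gamma>, \<tau>1 \<Longrightarrow> \<turnstile>\<^sub>s SCInl C : \<Gamma>', \<tau>' \<rightarrow> \<Gamma>, TSum \<tau>1 \<tau>2"
| "\<turnstile>\<^sub>s C : \<Gamma>', \<tau>' \<rightarrow> \<Gamma>, \<tau>2 \<Longrightarrow> \<turnstile>\<^sub>s SCInr C : \<Gamma>', \<tau>' \<rightarrow> \<Gamma>, TSum \<tau>1 \<tau>2"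
| "\<turnstile>\<^sub>s C : \<Gamma>', \<tau>' \<rightarrow> \<Gamma>, TSum \<tau>1 \<tau>2 \<Longrightarrow> \<tau>1 # \<Gamma> \<turnstile>\<^sub>s t2 \<Colon> \<tau> \<Longrightarrow> \<tau>2 # \<Gamma> \<turnstile>\<^sub>s t3 \<Colon> \<tau> \<Longrightarrow>
     \<turnstile>\<^sub>s SCCase1 C t2 t3 : \<Gamma>', \<tau>' \<rightarrow> \<Gamma>, \<tau>"
| "\<Gamma> \<turnstile>\<^sub>s t1 \<Colon> TSum \<tau>1 \<tau>2 \<Longrightarrow> \<turnstile>\<^sub>s C : \<Gamma>', \<tau>' \<rightarrow> \<tau>1 # \<Gamma>, \<tau> \<Longrightarrow> \<tau>2 # \<Gamma> \<turnstile>\<^sub>s t3 \<Colon> \<tau> \<Longrightarrow>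
     \<turnstile>\<^sub>s SCCase2 t1 C t3 : \<Gamma>', \<tau>' \<rightarrow> \<Gamma>, \<tau>"
| "\<Gamma> \<turnstile>\<^sub>s t1 \<Colon> TSum \<tau>1 \<tau>2 \<Longrightarrow> \<tau>1 # \<Gamma> \<turnstile>\<^sub>s t2 \<Colon> \<tau> \<Longrightarrow> \<turnstile>\<^sub>s C : \<Gamma>', \<tau>' \<rightarrow> \<tau>2 # \<Gamma>, \<tau> \<Longrightarrow>
     \<turnstile>\<^sub>s SCCase3 t1 t2 C : \<Gamma>', \<tau>' \<rightarrow> \<Gamma>, \<tau>"
| "\<turnstile>\<^sub>s C : \<Gamma>', \<tau>' \<rightarrow> \<Gamma>, TUnit \<Longrightarrow> \<Gamma> \<turnstile>\<^sub>s t2 \<Colon> \<tau> \<Longrightarrow> \<turnstile>\<^sub>s SCSeq1 C t2 : \<Gamma>', \<tau>' \<rightarrow> \<Gamma>, \<tau>"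
| "\<Gamma> \<turnstile>\<^sub>s t1 \<Colon> TUnit \<Longrightarrow> \<turnstile>\<^sub>s C : \<Gamma>', \<tau>' \<rightarrow> \<Gamma>, \<tau> \<Longrightarrow> \<turnstile>\<^sub>s SCSeq2 t1 C : \<Gamma>', \<tau>' \<rightarrow> \<Gamma>, \<tau>"
| "\<turnstile>\<^sub>s C : \<Gamma>', \<tau>' \<rightarrow> \<Gamma>, TBool \<Longrightarrow> \<Gamma> \<turnstile>\<^sub>s t2 \<Colon> \<tau> \<Longrightarrow> \<Gamma> \<turnstile>\<^sub>s t3 \<Colon> \<tau> \<Longrightarrow>
     \<turnstile>\<^sub>s SCIf1 C t2 t3 : \<Gamma>', \<tau>' \<rightarrow> \<Gamma>, \<tau>"
| "\<Gamma> \<turnstile>\<^sub>s t1 \<Colon> TBool \<Longrightarrow> \<turnstile>\<^sub>s C : \<Gamma>', \<tau>' \<rightarrow> \<Gamma>, \<tau> \<Longrightarrow> \<Gamma> \<turnstile>\<^sub>s t3 \<Colon> \<tau> \<Longrightarrow>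
     \<turnstile>\<^sub>s SCIf2 t1 C t3 : \<Gamma>', \<tau>' \<rightarrow> \<Gamma>, \<tau>"
| "\<Gamma> \<turnstile>\<^sub>s t1 \<Colon> TBool \<Longrightarrow> \<Gamma> \<turnstile>\<^sub>s t2 \<Colon> \<tau> \<Longrightarrow> \<turnstile>\<^sub>s C : \<Gamma>', \<tau>' \<rightarrow> \<Gamma>, \<tau> \<Longrightarrow>
     \<turnstile>\<^sub>s SCIf3 t1 t2 C : \<Gamma>', \<tau>' \<rightarrow> \<Gamma>, \<tau>"
| "\<turnstile>\<^sub>s C : \<Gamma>', \<tau>' \<rightarrow> \<Gamma>, TFun (TFun \<tau>1 \<tau>2) (TFun \<tau>1 \<tau>2) \<Longrightarrow>
     \<turnstile>\<^sub>s SCFix \<tau>1 \<tau>2 C : \<Gamma>', \<tau>' \<rightarrow> \<Gamma>, TFun \<tau>1 \<tau>2"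

lemma styping_splug:
  assumes "\<turnstile>\<^sub>s C : \<Gamma>', \<tau>' \<rightarrow> \<Gamma>, \<tau>" and "\<Gamma>' \<turnstile>\<^sub>s t \<Colon> \<tau>'"
  shows "\<Gamma> \<turnstile>\<^sub>s splug C t \<Colon> \<tau>"
  using assms by induction (auto intro: styping.intros)

definition sctx_equiv :: "ty list \<Rightarrow> strm \<Rightarrow> strm \<Rightarrow> ty \<Rightarrow> bool"
    ("_ \<turnstile>\<^sub>s _ \<simeq>\<^sub>c\<^sub>t\<^sub>x _ \<Colon> _" [51, 51, 51, 51] 50) where
  "(\<Gamma> \<turnstile>\<^sub>s t1 \<simeq>\<^sub>c\<^sub>t\<^sub>x t2 \<Colon> \<tau>) \<longleftrightarrow>
     (\<forall>\<tau>' C. (\<turnstile>\<^sub>s C : \<Gamma>, \<tau> \<rightarrow> [], \<tau>') \<longrightarrow> ((splug C t1) \<Down>\<^sub>s \<longleftrightarrow> (splug C t2) \<Down>\<^sub>s))"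


section \<open>The target language\<close>

datatype utrm =
    UUnit | UTrue | UFalse
  | ULam utrm
  | UVar nat
  | UApp utrm utrm
  | UFst utrm | USnd utrm
  | UPair utrm utrm
  | UInl utrm | UInr utrm
  | UCase utrm utrm utrm
  | USeq utrm utrm
  | UIf utrm utrm utrm
  | UWrong

inductive uval :: "utrm \<Rightarrow> bool" where
  "uval UUnit"
| "uval UTrue"
| "uval UFalse"
| "uval (ULam t)"
| "uval v1 \<Longrightarrow> uval v2 \<Longrightarrow> uval (UPair v1 v2)"
| "uval v \<Longrightarrow> uval (UInl v)"
| "uval v \<Longrightarrow> uval (UInr v)"

primrec uscoped :: "nat \<Rightarrow> utrm \<Rightarrow> bool" ("_ \<turnstile>\<^sub>u _" [51, 51] 50) where
  "n \<turnstile>\<^sub>u UUnit \<longleftrightarrow> True"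
| "n \<turnstile>\<^sub>u UTrue \<longleftrightarrow> True"
| "n \<turnstile>\<^sub>u UFalse \<longleftrightarrow> True"
| "n \<turnstile>\<^sub>u ULam t \<longleftrightarrow> (Suc n \<turnstile>\<^sub>u t)"
| "n \<turnstile>\<^sub>u UVar i \<longleftrightarrow> i < n"
| "n \<turnstile>\<^sub>u UApp t1 t2 \<longleftrightarrow> (n \<turnstile>\<^sub>u t1) \<and> (n \<turnstile>\<^sub>u t2)"
| "n \<turnstile>\<^sub>u UFst t \<longleftrightarrow> (n \<turnstile>\<^sub>u t)"
| "n \<turnstile>\<^sub>u USnd t \<longleftrightarrow> (n \<turnstile>\<^sub>u t)"
| "n \<turnstile>\<^sub>u UPair t1 t2 \<longleftrightarrow> (n \<turnstile>\<^sub>u t1) \<and> (n \<turnstile>\<^sub>u t2)"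
| "n \<turnstile>\<^sub>u UInl t \<longleftrightarrow> (n \<turnstile>\<^sub>u t)"
| "n \<turnstile>\<^sub>u UInr t \<longleftrightarrow> (n \<turnstile>\<^sub>u t)"
| "n \<turnstile>\<^sub>u UCase t t1 t2 \<longleftrightarrow> (n \<turnstile>\<^sub>u t) \<and> (Suc n \<turnstile>\<^sub>u t1) \<and> (Suc n \<turnstile>\<^sub>u t2)"
| "n \<turnstile>\<^sub>u USeq t1 t2 \<longleftrightarrow> (n \<turnstile>\<^sub>u t1) \<and> (n \<turnstile>\<^sub>u t2)"
| "n \<turnstile>\<^sub>u UIf t t1 t2 \<longleftrightarrow> (n \<turnstile>\<^sub>u t) \<and> (n \<turnstile>\<^sub>u t1) \<and> (n \<turnstile>\<^sub>u t2)"
| "n \<turnstile>\<^sub>u UWrong \<longleftrightarrow> True"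

primrec ulift :: "nat \<Rightarrow> utrm \<Rightarrow> utrm" where
  "ulift k UUnit = UUnit"
| "ulift k UTrue = UTrue"
| "ulift k UFalse = UFalse"
| "ulift k (ULam t) = ULam (ulift (Suc k) t)"
| "ulift k (UVar i) = UVar (if i < k then i else Suc i)"
| "ulift k (UApp t1 t2) = UApp (ulift k t1) (ulift k t2)"
| "ulift k (UFst t) = UFst (ulift k t)"
| "ulift k (USnd t) = USnd (ulift k t)"
| "ulift k (UPair t1 t2) = UPair (ulift k t1) (ulift k t2)"
| "ulift k (UInl t) = UInl (ulift k t)"
| "ulift k (UInr t) = UInr (ulift k t)"
| "ulift k (UCase t t1 t2) = UCase (ulift k t) (ulift (Suc k) t1) (ulift (Suc k) t2)"
| "ulift k (USeq t1 t2) = USeq (ulift k t1) (ulift k t2)"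
| "ulift k (UIf t t1 t2) = UIf (ulift k t) (ulift k t1) (ulift k t2)"
| "ulift k UWrong = UWrong"

primrec usubst :: "nat \<Rightarrow> utrm \<Rightarrow> utrm \<Rightarrow> utrm" where
  "usubst k s UUnit = UUnit"
| "usubst k s UTrue = UTrue"
| "usubst k s UFalse = UFalse"
| "usubst k s (ULam t) = ULam (usubst (Suc k) (ulift 0 s) t)"
| "usubst k s (UVar i) = (if i < k then UVar i else if i = k then s else UVar (i - 1))"
| "usubst k s (UApp t1 t2) = UApp (usubst k s t1) (usubst k s t2)"
| "usubst k s (UFst t) = UFst (usubst k s t)"
| "usubst k s (USnd t) = USnd (usubst k s t)"
| "usubst k s (UPair t1 t2) = UPair (usubst k s t1) (usubst k s t2)"
| "usubst k s (UInl t) = UInl (usubst k s t)"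
| "usubst k s (UInr t) = UInr (usubst k s t)"
| "usubst k s (UCase t t1 t2) =
     UCase (usubst k s t) (usubst (Suc k) (ulift 0 s) t1) (usubst (Suc k) (ulift 0 s) t2)"
| "usubst k s (USeq t1 t2) = USeq (usubst k s t1) (usubst k s t2)"
| "usubst k s (UIf t t1 t2) = UIf (usubst k s t) (usubst k s t1) (usubst k s t2)"
| "usubst k s UWrong = UWrong"

datatype uctx =
    UHole
  | UCLam uctx
  | UCApp1 uctx utrm | UCApp2 utrm uctx
  | UCFst uctx | UCSnd uctx
  | UCPair1 uctx utrm | UCPair2 utrm uctx
  | UCInl uctx | UCInr uctx
  | UCCase1 uctx utrm utrm | UCCase2 utrm uctx utrm | UCCase3 utrm utrm uctx
  | UCSeq1 uctx utrm | UCSeq2 utrm uctx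
  | UCIf1 uctx utrm utrm | UCIf2 utrm uctx utrm | UCIf3 utrm utrm uctx

primrec uplug :: "uctx \<Rightarrow> utrm \<Rightarrow> utrm" where
  "uplug UHole t = t"
| "uplug (UCLam C) t = ULam (uplug C t)"
| "uplug (UCApp1 C t2) t = UApp (uplug C t) t2"
| "uplug (UCApp2 t1 C) t = UApp t1 (uplug C t)"
| "uplug (UCFst C) t = UFst (uplug C t)"
| "uplug (UCSnd C) t = USnd (uplug C t)"
| "uplug (UCPair1 C t2) t = UPair (uplug C t) t2"
| "uplug (UCPair2 t1 C) t = UPair t1 (uplug C t)"
| "uplug (UCInl C) t = UInl (uplug C t)"
| "uplug (UCInr C) t = UInr (uplug C t)"
| "uplug (UCCase1 C t2 t3) t = UCase (uplug C t) t2 t3"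
| "uplug (UCCase2 t1 C t3) t = UCase t1 (uplug C t) t3"
| "uplug (UCCase3 t1 t2 C) t = UCase t1 t2 (uplug C t)"
| "uplug (UCSeq1 C t2) t = USeq (uplug C t) t2"
| "uplug (UCSeq2 t1 C) t = USeq t1 (uplug C t)"
| "uplug (UCIf1 C t2 t3) t = UIf (uplug C t) t2 t3"
| "uplug (UCIf2 t1 C t3) t = UIf t1 (uplug C t) t3"
| "uplug (UCIf3 t1 t2 C) t = UIf t1 t2 (uplug C t)"

inductive uectx :: "uctx \<Rightarrow> bool" where
  "uectx UHole"
| "uectx E \<Longrightarrow> uectx (UCApp1 E t)"
| "uval v \<Longrightarrow> uectx E \<Longrightarrow> uectx (UCApp2 v E)"
| "uectx E \<Longrightarrow> uectx (UCFst E)"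
| "uectx E \<Longrightarrow> uectx (UCSnd E)"
| "uectx E \<Longrightarrow> uectx (UCPair1 E t)"
| "uval v \<Longrightarrow> uectx E \<Longrightarrow> uectx (UCPair2 v E)"
| "uectx E \<Longrightarrow> uectx (UCInl E)"
| "uectx E \<Longrightarrow> uectx (UCInr E)"
| "uectx E \<Longrightarrow> uectx (UCCase1 E t1 t2)"
| "uectx E \<Longrightarrow> uectx (UCSeq1 E t)"
| "uectx E \<Longrightarrow> uectx (UCIf1 E t1 t2)"

inductive ured :: "utrm \<Rightarrow> utrm \<Rightarrow> bool" where
  "uval v \<Longrightarrow> ured (UApp (ULam t) v) (usubst 0 v t)"
| "uval v1 \<Longrightarrow> uval v2 \<Longrightarrow> ured (UFst (UPair v1 v2)) v1"
| "uval v1 \<Longrightarrow> uval v2 \<Longrightarrow> ured (USnd (UPair v1 v2)) v2"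
| "uval v \<Longrightarrow> ured (UCase (UInl v) t1 t2) (usubst 0 v t1)"
| "uval v \<Longrightarrow> ured (UCase (UInr v) t1 t2) (usubst 0 v t2)"
| "ured (USeq UUnit t) t"
| "ured (UIf UTrue t1 t2) t1"
| "ured (UIf UFalse t1 t2) t2"
| "uectx E \<Longrightarrow> E \<noteq> UHole \<Longrightarrow> ured (uplug E UWrong) UWrong"
| "uval v1 \<Longrightarrow> uval v2 \<Longrightarrow> \<forall>t. v1 \<noteq> ULam t \<Longrightarrow> ured (UApp v1 v2) UWrong"
| "uval v \<Longrightarrow> \<forall>v1 v2. v \<noteq> UPair v1 v2 \<Longrightarrow> ured (UFst v) UWrong"
| "uval v \<Longrightarrow> \<forall>v1 v2. v \<noteq> UPair v1 v2 \<Longrightarrow> ured (USnd v) UWrong"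
| "uval v \<Longrightarrow> \<forall>v'. v \<noteq> UInl v' \<Longrightarrow> \<forall>v'. v \<noteq> UInr v' \<Longrightarrow> ured (UCase v t1 t2) UWrong"
| "uval v \<Longrightarrow> v \<noteq> UUnit \<Longrightarrow> ured (USeq v t) UWrong"
| "uval v \<Longrightarrow> v \<noteq> UTrue \<Longrightarrow> v \<noteq> UFalse \<Longrightarrow> ured (UIf v t1 t2) UWrong"

inductive ustep :: "utrm \<Rightarrow> utrm \<Rightarrow> bool" where
  "uectx E \<Longrightarrow> ured t t' \<Longrightarrow> ustep (uplug E t) (uplug E t')"

definition uconverges :: "utrm \<Rightarrow> bool" ("_ \<Down>\<^sub>u" [100] 50) where
  "t \<Down>\<^sub>u \<longleftrightarrow> (\<exists>v. ustep\<^sup>*\<^sup>* t v \<and> uval v)"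

text \<open>\<open>\<turnstile>\<^sub>u C : n' \<rightarrow> n\<close>\<close>

inductive uctx_scoped :: "uctx \<Rightarrow> nat \<Rightarrow> nat \<Rightarrow> bool" ("\<turnstile>\<^sub>u _ : _ \<rightarrow> _" [51, 51, 51] 50) where
  "\<turnstile>\<^sub>u UHole : n' \<rightarrow> n'"
| "\<turnstile>\<^sub>u C : n' \<rightarrow> Suc n \<Longrightarrow> \<turnstile>\<^sub>u UCLam C : n' \<rightarrow> n"
| "\<turnstile>\<^sub>u C : n' \<rightarrow> n \<Longrightarrow> n \<turnstile>\<^sub>u t2 \<Longrightarrow> \<turnstile>\<^sub>u UCApp1 C t2 : n' \<rightarrow> n"
| "n \<turnstile>\<^sub>u t1 \<Longrightarrow> \<turnstile>\<^sub>u C : n' \<rightarrow> n \<Longrightarrow> \<turnstile>\<^sub>u UCApp2 t1 C : n' \<rightarrow> n"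
| "\<turnstile>\<^sub>u C : n' \<rightarrow> n \<Longrightarrow> \<turnstile>\<^sub>u UCFst C : n' \<rightarrow> n"
| "\<turnstile>\<^sub>u C : n' \<rightarrow> n \<Longrightarrow> \<turnstile>\<^sub>u UCSnd C : n' \<rightarrow> n"
| "\<turnstile>\<^sub>u C : n' \<rightarrow> n \<Longrightarrow> n \<turnstile>\<^sub>u t2 \<Longrightarrow> \<turnstile>\<^sub>u UCPair1 C t2 : n' \<rightarrow> n"
| "n \<turnstile>\<^sub>u t1 \<Longrightarrow> \<turnstile>\<^sub>u C : n' \<rightarrow> n \<Longrightarrow> \<turnstile>\<^sub>u UCPair2 t1 C : n' \<rightarrow> n"
| "\<turnstile>\<^sub>u C : n' \<rightarrow> n \<Longrightarrow> \<turnstile>\<^sub>u UCInl C : n' \<rightarrow> n"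
| "\<turnstile>\<^sub>u C : n' \<rightarrow> n \<Longrightarrow> \<turnstile>\<^sub>u UCInr C : n' \<rightarrow> n"
| "\<turnstile>\<^sub>u C : n' \<rightarrow> n \<Longrightarrow> Suc n \<turnstile>\<^sub>u t2 \<Longrightarrow> Suc n \<turnstile>\<^sub>u t3 \<Longrightarrow> \<turnstile>\<^sub>u UCCase1 C t2 t3 : n' \<rightarrow> n"
| "n \<turnstile>\<^sub>u t1 \<Longrightarrow> \<turnstile>\<^sub>u C : n' \<rightarrow> Suc n \<Longrightarrow> Suc n \<turnstile>\<^sub>u t3 \<Longrightarrow> \<turnstile>\<^sub>u UCCase2 t1 C t3 : n' \<rightarrow> n"
| "n \<turnstile>\<^sub>u t1 \<Longrightarrow> Suc n \<turnstile>\<^sub>u t2 \<Longrightarrow> \<turnstile>\<^sub>u C : n' \<rightarrow> Suc n \<Longrightarrow> \<turnstile>\<^sub>u UCCase3 t1 t2 C : n' \<rightarrow> n"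
| "\<turnstile>\<^sub>u C : n' \<rightarrow> n \<Longrightarrow> n \<turnstile>\<^sub>u t2 \<Longrightarrow> \<turnstile>\<^sub>u UCSeq1 C t2 : n' \<rightarrow> n"
| "n \<turnstile>\<^sub>u t1 \<Longrightarrow> \<turnstile>\<^sub>u C : n' \<rightarrow> n \<Longrightarrow> \<turnstile>\<^sub>u UCSeq2 t1 C : n' \<rightarrow> n"
| "\<turnstile>\<^sub>u C : n' \<rightarrow> n \<Longrightarrow> n \<turnstile>\<^sub>u t2 \<Longrightarrow> n \<turnstile>\<^sub>u t3 \<Longrightarrow> \<turnstile>\<^sub>u UCIf1 C t2 t3 : n' \<rightarrow> n"
| "n \<turnstile>\<^sub>u t1 \<Longrightarrow> \<turnstile>\<^sub>u C : n' \<rightarrow> n \<Longrightarrow> n \<turnstile>\<^sub>u t3 \<Longrightarrow> \<turnstile>\<^sub>u UCIf2 t1 C t3 : n' \<rightarrow> n"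
| "n \<turnstile>\<^sub>u t1 \<Longrightarrow> n \<turnstile>\<^sub>u t2 \<Longrightarrow> \<turnstile>\<^sub>u C : n' \<rightarrow> n \<Longrightarrow> \<turnstile>\<^sub>u UCIf3 t1 t2 C : n' \<rightarrow> n"

lemma uscoped_uplug:
  assumes "\<turnstile>\<^sub>u C : n' \<rightarrow> n" and "n' \<turnstile>\<^sub>u t"
  shows "n \<turnstile>\<^sub>u uplug C t"
  using assms by induction auto

definition uctx_equiv :: "nat \<Rightarrow> utrm \<Rightarrow> utrm \<Rightarrow> bool"
    ("_ \<turnstile>\<^sub>u _ \<simeq>\<^sub>c\<^sub>t\<^sub>x _" [51, 51, 51] 50) where
  "(n \<turnstile>\<^sub>u t1 \<simeq>\<^sub>c\<^sub>t\<^sub>x t2) \<longleftrightarrow>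
     (\<forall>C. (\<turnstile>\<^sub>u C : n \<rightarrow> 0) \<longrightarrow> ((uplug C t1) \<Down>\<^sub>u \<longleftrightarrow> (uplug C t2) \<Down>\<^sub>u))"


section \<open>The compiler\<close>

text \<open>\<open>\<lambda>f. (\<lambda>x. f (\<lambda>y. x x y)) (\<lambda>x. f (\<lambda>y. x x y))\<close>\<close>

definition ufix :: utrm where
  "ufix = ULam (UApp
     (ULam (UApp (UVar 1) (ULam (UApp (UApp (UVar 1) (UVar 1)) (UVar 0)))))
     (ULam (UApp (UVar 1) (ULam (UApp (UApp (UVar 1) (UVar 1)) (UVar 0))))))"

primrec erase :: "strm \<Rightarrow> utrm" where
  "erase SUnit = UUnit"
| "erase STrue = UTrue"
| "erase SFalse = UFalse"
| "erase (SLam \<tau> t) = ULam (erase t)"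
| "erase (SVar i) = UVar i"
| "erase (SApp t1 t2) = UApp (erase t1) (erase t2)"
| "erase (SFst t) = UFst (erase t)"
| "erase (SSnd t) = USnd (erase t)"
| "erase (SPair t1 t2) = UPair (erase t1) (erase t2)"
| "erase (SInl t) = UInl (erase t)"
| "erase (SInr t) = UInr (erase t)"
| "erase (SCase t t1 t2) = UCase (erase t) (erase t1) (erase t2)"
| "erase (SSeq t1 t2) = USeq (erase t1) (erase t2)"
| "erase (SIf t t1 t2) = UIf (erase t) (erase t1) (erase t2)"
| "erase (SFix \<tau>1 \<tau>2 t) = UApp ufix (erase t)"

text \<open>The terms below are closed, so their recursive occurrences under binders need no lifting.\<close>

fun protect :: "ty \<Rightarrow> utrm" and confine :: "ty \<Rightarrow> utrm" where
  "protect TUnit = ULam (UVar 0)"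
| "protect TBool = ULam (UVar 0)"
| "protect (TProd \<tau>1 \<tau>2) =
     ULam (UPair (UApp (protect \<tau>1) (UFst (UVar 0))) (UApp (protect \<tau>2) (USnd (UVar 0))))"
| "protect (TSum \<tau>1 \<tau>2) =
     ULam (UCase (UVar 0)
       (UInl (UApp (protect \<tau>1) (UVar 0)))
       (UInr (UApp (protect \<tau>2) (UVar 0))))"
| "protect (TFun \<tau>1 \<tau>2) =
     ULam (ULam (UApp (protect \<tau>2) (UApp (UVar 1) (UApp (confine \<tau>1) (UVar 0)))))"
| "confine TUnit = ULam (USeq (UVar 0) UUnit)"
| "confine TBool = ULam (UIf (UVar 0) UTrue UFalse)"
| "confine (TProd \<tau>1 \<tau>2) =
     ULam (UPair (UApp (confine \<tau>1) (UFst (UVar 0))) (UApp (confine \<tau>2) (USnd (UVar 0))))"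
| "confine (TSum \<tau>1 \<tau>2) =
     ULam (UCase (UVar 0)
       (UInl (UApp (confine \<tau>1) (UVar 0)))
       (UInr (UApp (confine \<tau>2) (UVar 0))))"
| "confine (TFun \<tau>1 \<tau>2) =
     ULam (ULam (UApp (confine \<tau>2) (UApp (UVar 1) (UApp (protect \<tau>1) (UVar 0)))))"

text \<open>Source terms do not determine their types (injections are unannotated), so the type at which
  a term is compiled is an argument.\<close>

definition compile :: "ty \<Rightarrow> strm \<Rightarrow> utrm" where
  "compile \<tau> t = UApp (protect \<tau>) (erase t)"

end

theory Submission
  imports Defs
begin

text \<open>
  A step-indexed logical relation between source and target terms, with one direction for each
  implication between convergences, relates a source term to its erasure. Wrapping a related target
  term in \<open>protect\<close> or \<open>confine\<close> changes nothing, so a source context and its erasure observe the same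
  about \<open>t\<close> and its compilation; this gives reflection.

  For preservation, a target context converging within \<open>n\<close> steps is translated back to a source context
  over the \<open>n\<close>-th approximation \<open>uvalty n\<close> of the recursive type \<open>U = 1 + Bool + U \<times> U + (U + U) + (U \<rightarrow> U)\<close>
  of untyped values, which has no exact counterpart among the simple types. Every level of \<open>uvalty n\<close>
  that is opened costs the target a step, so the back-translation converges whenever the target context
  does so within \<open>n\<close> steps; conversely, what is lost in the approximation only makes it diverge, so its
  convergence implies that of the target context for any number of steps. The asymmetry suffices: one
  passes from the target to the source with the first term and back with the second.
\<close>


section \<open>Closed terms and closing substitutions\<close>

text \<open>Fuel passing ties the step index to the operational semantics: the fuel left by a run is
  the index at which its results are related, so sequencing needs no arithmetic on step counts.
  Failure and divergence are not told apart, as only convergence to a value is observed; this lets a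
  diverging source projection answer a failing target check.

  A back-translated context puts arbitrary target values at the boundary of a typed term. Projecting
  a value of the wrong shape diverges in the source, whereas the bare target value has already
  converged. The check made by \<open>confine\<close> restores agreement, and \<open>protect\<close>
  applies it to whatever flows into a compiled function: hence \<open>inject\<close> is compared
  together with \<open>protect\<close>, and \<open>project\<close> together with
  \<open>confine\<close>.

  The level of approximation must not grow with the term being translated. So every subterm stays at
  \<open>uvalty n\<close>; \<open>upgrade\<close> and \<open>downgrade\<close> pass to the next
  level and back around each operation. They are steps of the source alone, and lose precision only
  beyond the budget that \<open>n\<close> allows.\<close>

primrec sscoped :: "nat \<Rightarrow> strm \<Rightarrow> bool" where
  "sscoped n SUnit \<longleftrightarrow> True"
| "sscoped n STrue \<longleftrightarrow> True"
| "sscoped n SFalse \<longleftrightarrow> True"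
| "sscoped n (SLam \<tau> t) \<longleftrightarrow> sscoped (Suc n) t"
| "sscoped n (SVar i) \<longleftrightarrow> i < n"
| "sscoped n (SApp t1 t2) \<longleftrightarrow> sscoped n t1 \<and> sscoped n t2"
| "sscoped n (SFst t) \<longleftrightarrow> sscoped n t"
| "sscoped n (SSnd t) \<longleftrightarrow> sscoped n t"
| "sscoped n (SPair t1 t2) \<longleftrightarrow> sscoped n t1 \<and> sscoped n t2"
| "sscoped n (SInl t) \<longleftrightarrow> sscoped n t"
| "sscoped n (SInr t) \<longleftrightarrow> sscoped n t"
| "sscoped n (SCase t t1 t2) \<longleftrightarrow> sscoped n t \<and> sscoped (Suc n) t1 \<and> sscoped (Suc n) t2"
| "sscoped n (SSeq t1 t2) \<longleftrightarrow> sscoped n t1 \<and> sscoped n t2"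
| "sscoped n (SIf t t1 t2) \<longleftrightarrow> sscoped n t \<and> sscoped n t1 \<and> sscoped n t2"
| "sscoped n (SFix \<tau>1 \<tau>2 t) \<longleftrightarrow> sscoped n t"

lemma styping_sscoped: "\<Gamma> \<turnstile>\<^sub>s t \<Colon> \<tau> \<Longrightarrow> sscoped (length \<Gamma>) t"
  by (induction rule: styping.induct) auto

lemma sscoped_Suc: "sscoped n t \<Longrightarrow> sscoped (Suc n) t"
  by (induction t arbitrary: n) auto

lemma uscoped_Suc: "n \<turnstile>\<^sub>u t \<Longrightarrow> Suc n \<turnstile>\<^sub>u t"
  by (induction t arbitrary: n) auto

lemma sscoped_closed [simp]: "sscoped 0 t \<Longrightarrow> sscoped n t"
  by (induction n) (auto intro: sscoped_Suc)

lemma uscoped_closed [simp]: "0 \<turnstile>\<^sub>u t \<Longrightarrow> n \<turnstile>\<^sub>u t"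
  by (induction n) (auto intro: uscoped_Suc)

lemma slift_sscoped: "sscoped k t \<Longrightarrow> slift k t = t"
  by (induction t arbitrary: k) auto

lemma ulift_uscoped: "k \<turnstile>\<^sub>u t \<Longrightarrow> ulift k t = t"
  by (induction t arbitrary: k) auto

lemma ssubst_sscoped: "sscoped k t \<Longrightarrow> ssubst k s t = t"
  by (induction t arbitrary: k s) auto

lemma usubst_uscoped: "k \<turnstile>\<^sub>u t \<Longrightarrow> usubst k s t = t"
  by (induction t arbitrary: k s) auto

lemma slift_closed [simp]: "sscoped 0 t \<Longrightarrow> slift k t = t"
  by (simp add: slift_sscoped)

lemma ulift_closed [simp]: "0 \<turnstile>\<^sub>u t \<Longrightarrow> ulift k t = t"
  by (simp add: ulift_uscoped)

lemma ssubst_closed [simp]: "sscoped 0 t \<Longrightarrow> ssubst k s t = t"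
  by (simp add: ssubst_sscoped)

lemma usubst_closed [simp]: "0 \<turnstile>\<^sub>u t \<Longrightarrow> usubst k s t = t"
  by (simp add: usubst_uscoped)

text \<open>\<open>sclose k \<sigma>\<close> replaces the indices \<open>k, k + 1, \<dots>\<close> by \<open>\<sigma> 0, \<sigma> 1, \<dots>\<close>; as it is only used for closed
  \<open>\<sigma> i\<close>, nothing is lifted under binders.\<close>

primrec sclose :: "nat \<Rightarrow> (nat \<Rightarrow> strm) \<Rightarrow> strm \<Rightarrow> strm" where
  "sclose k \<sigma> SUnit = SUnit"
| "sclose k \<sigma> STrue = STrue"
| "sclose k \<sigma> SFalse = SFalse"
| "sclose k \<sigma> (SLam \<tau> t) = SLam \<tau> (sclose (Suc k) \<sigma> t)"
| "sclose k \<sigma> (SVar i) = (if i < k then SVar i else \<sigma> (i - k))"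
| "sclose k \<sigma> (SApp t1 t2) = SApp (sclose k \<sigma> t1) (sclose k \<sigma> t2)"
| "sclose k \<sigma> (SFst t) = SFst (sclose k \<sigma> t)"
| "sclose k \<sigma> (SSnd t) = SSnd (sclose k \<sigma> t)"
| "sclose k \<sigma> (SPair t1 t2) = SPair (sclose k \<sigma> t1) (sclose k \<sigma> t2)"
| "sclose k \<sigma> (SInl t) = SInl (sclose k \<sigma> t)"
| "sclose k \<sigma> (SInr t) = SInr (sclose k \<sigma> t)"
| "sclose k \<sigma> (SCase t t1 t2) =
     SCase (sclose k \<sigma> t) (sclose (Suc k) \<sigma> t1) (sclose (Suc k) \<sigma> t2)"
| "sclose k \<sigma> (SSeq t1 t2) = SSeq (sclose k \<sigma> t1) (sclose k \<sigma> t2)"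
| "sclose k \<sigma> (SIf t t1 t2) = SIf (sclose k \<sigma> t) (sclose k \<sigma> t1) (sclose k \<sigma> t2)"
| "sclose k \<sigma> (SFix \<tau>1 \<tau>2 t) = SFix \<tau>1 \<tau>2 (sclose k \<sigma> t)"

primrec uclose :: "nat \<Rightarrow> (nat \<Rightarrow> utrm) \<Rightarrow> utrm \<Rightarrow> utrm" where
  "uclose k \<rho> UUnit = UUnit"
| "uclose k \<rho> UTrue = UTrue"
| "uclose k \<rho> UFalse = UFalse"
| "uclose k \<rho> (ULam t) = ULam (uclose (Suc k) \<rho> t)"
| "uclose k \<rho> (UVar i) = (if i < k then UVar i else \<rho> (i - k))"
| "uclose k \<rho> (UApp t1 t2) = UApp (uclose k \<rho> t1) (uclose k \<rho> t2)"
| "uclose k \<rho> (UFst t) = UFst (uclose k \<rho> t)"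
| "uclose k \<rho> (USnd t) = USnd (uclose k \<rho> t)"
| "uclose k \<rho> (UPair t1 t2) = UPair (uclose k \<rho> t1) (uclose k \<rho> t2)"
| "uclose k \<rho> (UInl t) = UInl (uclose k \<rho> t)"
| "uclose k \<rho> (UInr t) = UInr (uclose k \<rho> t)"
| "uclose k \<rho> (UCase t t1 t2) =
     UCase (uclose k \<rho> t) (uclose (Suc k) \<rho> t1) (uclose (Suc k) \<rho> t2)"
| "uclose k \<rho> (USeq t1 t2) = USeq (uclose k \<rho> t1) (uclose k \<rho> t2)"
| "uclose k \<rho> (UIf t t1 t2) = UIf (uclose k \<rho> t) (uclose k \<rho> t1) (uclose k \<rho> t2)"
| "uclose k \<rho> UWrong = UWrong"

lemma sclose_sscoped: "sscoped k t \<Longrightarrow> sclose k \<sigma> t = t"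
  by (induction t arbitrary: k) auto

lemma uclose_uscoped: "k \<turnstile>\<^sub>u t \<Longrightarrow> uclose k \<rho> t = t"
  by (induction t arbitrary: k) auto

lemma sclose_closed [simp]: "sscoped 0 t \<Longrightarrow> sclose k \<sigma> t = t"
  by (simp add: sclose_sscoped)

lemma uclose_closed [simp]: "0 \<turnstile>\<^sub>u t \<Longrightarrow> uclose k \<rho> t = t"
  by (simp add: uclose_uscoped)

lemma sscoped_sclose [simp]: "(\<And>i. sscoped 0 (\<sigma> i)) \<Longrightarrow> sscoped k (sclose k \<sigma> t)"
  by (induction t arbitrary: k) auto

lemma uscoped_uclose [simp]: "(\<And>i. 0 \<turnstile>\<^sub>u \<rho> i) \<Longrightarrow> k \<turnstile>\<^sub>u uclose k \<rho> t"
  by (induction t arbitrary: k) auto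

text \<open>As \<open>v\<close> and all \<open>\<sigma> i\<close> are closed, lifting them under
  binders is the identity, so a single substitution merely prepends \<open>v\<close> to the
  environment; \<open>case_nat v \<sigma>\<close> is that cons. This turns the body of a beta step
  into an instance of a hypothesis about all environments.\<close>

lemma ssubst_sclose:
  "(\<And>i. sscoped 0 (\<sigma> i)) \<Longrightarrow> sscoped 0 v \<Longrightarrow>
    ssubst k v (sclose (Suc k) \<sigma> t) = sclose k (case_nat v \<sigma>) t"
  by (induction t arbitrary: k) (auto simp: Nitpick.case_nat_unfold)

lemma usubst_uclose:
  "(\<And>i. 0 \<turnstile>\<^sub>u \<rho> i) \<Longrightarrow> 0 \<turnstile>\<^sub>u u \<Longrightarrow>
    usubst k u (uclose (Suc k) \<rho> t) = uclose k (case_nat u \<rho>) t"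
  by (induction t arbitrary: k) (auto simp: Nitpick.case_nat_unfold)


section \<open>Evaluation with fuel\<close>

text \<open>In \<open>sev t k k' v\<close> and \<open>uev t k k' v\<close>, \<open>k\<close> is the fuel before and \<open>k'\<close> the fuel left after evaluating
  \<open>t\<close> to \<open>v\<close>; every reduction step burns one unit.\<close>

inductive sev :: "strm \<Rightarrow> nat \<Rightarrow> nat \<Rightarrow> strm \<Rightarrow> bool" where
  "sev SUnit k k SUnit"
| "sev STrue k k STrue"
| "sev SFalse k k SFalse"
| "sev (SLam \<tau> t) k k (SLam \<tau> t)"
| "sev t1 k1 k2 (SLam \<tau> t) \<Longrightarrow> sev t2 k2 (Suc k3) v \<Longrightarrow> sev (ssubst 0 v t) k3 k4 r \<Longrightarrow>
     sev (SApp t1 t2) k1 k4 r"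
| "sev t k1 (Suc k2) (SPair v1 v2) \<Longrightarrow> sev (SFst t) k1 k2 v1"
| "sev t k1 (Suc k2) (SPair v1 v2) \<Longrightarrow> sev (SSnd t) k1 k2 v2"
| "sev t1 k1 k2 v1 \<Longrightarrow> sev t2 k2 k3 v2 \<Longrightarrow> sev (SPair t1 t2) k1 k3 (SPair v1 v2)"
| "sev t k1 k2 v \<Longrightarrow> sev (SInl t) k1 k2 (SInl v)"
| "sev t k1 k2 v \<Longrightarrow> sev (SInr t) k1 k2 (SInr v)"
| "sev t k1 (Suc k2) (SInl v) \<Longrightarrow> sev (ssubst 0 v t1) k2 k3 r \<Longrightarrow>
     sev (SCase t t1 t2) k1 k3 r"
| "sev t k1 (Suc k2) (SInr v) \<Longrightarrow> sev (ssubst 0 v t2) k2 k3 r \<Longrightarrow>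
     sev (SCase t t1 t2) k1 k3 r"
| "sev t1 k1 (Suc k2) SUnit \<Longrightarrow> sev t2 k2 k3 r \<Longrightarrow> sev (SSeq t1 t2) k1 k3 r"
| "sev t k1 (Suc k2) STrue \<Longrightarrow> sev t1 k2 k3 r \<Longrightarrow> sev (SIf t t1 t2) k1 k3 r"
| "sev t k1 (Suc k2) SFalse \<Longrightarrow> sev t2 k2 k3 r \<Longrightarrow> sev (SIf t t1 t2) k1 k3 r"
| "sev s k1 (Suc k2) (SLam (TFun \<tau>1 \<tau>2) t) \<Longrightarrow>
     sev (ssubst 0 (SLam \<tau>1 (SApp (slift 0 (SFix \<tau>1 \<tau>2 (SLam (TFun \<tau>1 \<tau>2) t))) (SVar 0))) t) k2 k3 r \<Longrightarrow>
     sev (SFix \<tau>1 \<tau>2 s) k1 k3 r"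

text \<open>Since only convergence to a value is observed, failing terms simply have no evaluation.\<close>

inductive uev :: "utrm \<Rightarrow> nat \<Rightarrow> nat \<Rightarrow> utrm \<Rightarrow> bool" where
  "uev UUnit k k UUnit"
| "uev UTrue k k UTrue"
| "uev UFalse k k UFalse"
| "uev (ULam t) k k (ULam t)"
| "uev t1 k1 k2 (ULam t) \<Longrightarrow> uev t2 k2 (Suc k3) v \<Longrightarrow> uev (usubst 0 v t) k3 k4 r \<Longrightarrow>
     uev (UApp t1 t2) k1 k4 r"
| "uev t k1 (Suc k2) (UPair v1 v2) \<Longrightarrow> uev (UFst t) k1 k2 v1"
| "uev t k1 (Suc k2) (UPair v1 v2) \<Longrightarrow> uev (USnd t) k1 k2 v2"
| "uev t1 k1 k2 v1 \<Longrightarrow> uev t2 k2 k3 v2 \<Longrightarrow> uev (UPair t1 t2) k1 k3 (UPair v1 v2)"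
| "uev t k1 k2 v \<Longrightarrow> uev (UInl t) k1 k2 (UInl v)"
| "uev t k1 k2 v \<Longrightarrow> uev (UInr t) k1 k2 (UInr v)"
| "uev t k1 (Suc k2) (UInl v) \<Longrightarrow> uev (usubst 0 v t1) k2 k3 r \<Longrightarrow>
     uev (UCase t t1 t2) k1 k3 r"
| "uev t k1 (Suc k2) (UInr v) \<Longrightarrow> uev (usubst 0 v t2) k2 k3 r \<Longrightarrow>
     uev (UCase t t1 t2) k1 k3 r"
| "uev t1 k1 (Suc k2) UUnit \<Longrightarrow> uev t2 k2 k3 r \<Longrightarrow> uev (USeq t1 t2) k1 k3 r"
| "uev t k1 (Suc k2) UTrue \<Longrightarrow> uev t1 k2 k3 r \<Longrightarrow> uev (UIf t t1 t2) k1 k3 r"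
| "uev t k1 (Suc k2) UFalse \<Longrightarrow> uev t2 k2 k3 r \<Longrightarrow> uev (UIf t t1 t2) k1 k3 r"

inductive_simps sev_simps [simp]:
  "sev SUnit k k' r" "sev STrue k k' r" "sev SFalse k k' r" "sev (SLam \<tau> t) k k' r"
  "sev (SVar i) k k' r" "sev (SApp t1 t2) k k' r" "sev (SFst t) k k' r" "sev (SSnd t) k k' r"
  "sev (SPair t1 t2) k k' r" "sev (SInl t) k k' r" "sev (SInr t) k k' r" "sev (SCase t t1 t2) k k'
      r" "sev (SSeq t1 t2) k k' r"
  "sev (SIf t t1 t2) k k' r" "sev (SFix \<tau>1 \<tau>2 t) k k' r"

inductive_simps uev_simps [simp]:
  "uev UUnit k k' r" "uev UTrue k k' r" "uev UFalse k k' r" "uev (ULam t) k k' r" "uev (UVar i) k k' r"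
  "uev (UApp t1 t2) k k' r" "uev (UFst t) k k' r" "uev (USnd t) k k' r" "uev (UPair t1 t2) k k' r"
  "uev (UInl t) k k' r" "uev (UInr t) k k' r" "uev (UCase t t1 t2) k k' r" "uev (USeq t1 t2) k k' r"
  "uev (UIf t t1 t2) k k' r" "uev UWrong k k' r"

declare sval.intros [simp, intro] uval.intros [simp, intro]

inductive_simps sval_simps [simp]: "sval (SPair v1 v2)" "sval (SInl v)" "sval (SInr v)"
inductive_simps uval_simps [simp]: "uval (UPair v1 v2)" "uval (UInl v)" "uval (UInr v)"

lemma sev_sval: "sev t k k' v \<Longrightarrow> sval v"
  by (induction rule: sev.induct) auto

lemma uev_uval: "uev t k k' v \<Longrightarrow> uval v"
  by (induction rule: uev.induct) auto

lemma sev_value [simp]: "sval v \<Longrightarrow> sev v k k' r \<longleftrightarrow> k' = k \<and> r = v"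
  by (induction v arbitrary: k k' r rule: sval.induct) auto

lemma uev_value [simp]: "uval v \<Longrightarrow> uev v k k' r \<longleftrightarrow> k' = k \<and> r = v"
  by (induction v arbitrary: k k' r rule: uval.induct) auto

text \<open>Fuel is only handed through a run, so a surplus reappears untouched at its end. This
  lets runs with unrelated budgets be concatenated.\<close>

lemma sev_shift: "sev t k k' v \<Longrightarrow> sev t (k + n) (k' + n) v"
  by (induction rule: sev.induct) (auto intro: sev.intros simp del: sev_simps)

lemma uev_shift: "uev t k k' v \<Longrightarrow> uev t (k + n) (k' + n) v"
  by (induction rule: uev.induct) (auto intro: uev.intros simp del: uev_simps)

section \<open>Evaluation contexts as frames\<close>

definition sevals :: "strm \<Rightarrow> strm \<Rightarrow> bool" where
  "sevals t v \<longleftrightarrow> (\<exists>k k'. sev t k k' v)"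

definition uevals :: "utrm \<Rightarrow> utrm \<Rightarrow> bool" where
  "uevals t v \<longleftrightarrow> (\<exists>k k'. uev t k k' v)"

text \<open>Semantic form of an evaluation context: every run of \<open>K t\<close> passes through a
  value of \<open>t\<close>, and the fuel left there starts the run of \<open>K v\<close>. Being
  functions, frames compose directly, for instance an elimination around an extractor.\<close>

definition sframe :: "(strm \<Rightarrow> strm) \<Rightarrow> bool" where
  "sframe K \<longleftrightarrow> (\<forall>t k k' r. sev (K t) k k' r \<longleftrightarrow> (\<exists>k1 v. sev t k k1 v \<and> sev (K v) k1 k' r))"

definition uframe :: "(utrm \<Rightarrow> utrm) \<Rightarrow> bool" where
  "uframe K \<longleftrightarrow> (\<forall>t k k' r. uev (K t) k k' r \<longleftrightarrow> (\<exists>k1 v. uev t k k1 v \<and> uev (K v) k1 k' r))"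

lemma sframeI:
  assumes "\<And>t k k' r. sev (K t) k k' r \<Longrightarrow> \<exists>k1 v. sev t k k1 v \<and> (sval v \<longrightarrow> sev (K v) k1 k' r)"
    and "\<And>t k k1 k' v r. sval v \<Longrightarrow> sev t k k1 v \<Longrightarrow> sev (K v) k1 k' r \<Longrightarrow> sev (K t) k k' r"
  shows "sframe K"
  unfolding sframe_def by (meson assms sev_sval)

lemma sframe_id: "sframe (\<lambda>x. x)"
  by (rule sframeI) auto

lemma sframe_comp: "sframe K \<Longrightarrow> sframe L \<Longrightarrow> sframe (\<lambda>x. K (L x))"
  unfolding sframe_def by meson

lemma sframe_intros:
  shows "sframe (\<lambda>x. SApp x t)"
  and "sval v \<Longrightarrow> sframe (\<lambda>x. SApp v x)"
  and "sframe (\<lambda>x. SFst x)"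
  and "sframe (\<lambda>x. SSnd x)"
  and "sframe (\<lambda>x. SPair x t)"
  and "sval v \<Longrightarrow> sframe (\<lambda>x. SPair v x)"
  and "sframe (\<lambda>x. SInl x)"
  and "sframe (\<lambda>x. SInr x)"
  and "sframe (\<lambda>x. SCase x t1 t2)"
  and "sframe (\<lambda>x. SSeq x t)"
  and "sframe (\<lambda>x. SIf x t1 t2)"
  and "sframe (\<lambda>x. SFix \<tau>1 \<tau>2 x)"
  by (rule sframeI; fastforce)+

lemma uframeI:
  assumes "\<And>t k k' r. uev (K t) k k' r \<Longrightarrow> \<exists>k1 v. uev t k k1 v \<and> (uval v \<longrightarrow> uev (K v) k1 k' r)"
    and "\<And>t k k1 k' v r. uval v \<Longrightarrow> uev t k k1 v \<Longrightarrow> uev (K v) k1 k' r \<Longrightarrow> uev (K t) k k' r"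
  shows "uframe K"
  unfolding uframe_def by (meson assms uev_uval)

lemma uframe_id: "uframe (\<lambda>x. x)"
  by (rule uframeI) auto

lemma uframe_comp: "uframe K \<Longrightarrow> uframe L \<Longrightarrow> uframe (\<lambda>x. K (L x))"
  unfolding uframe_def by meson

lemma uframe_intros:
  shows "uframe (\<lambda>x. UApp x t)"
  and "uval v \<Longrightarrow> uframe (\<lambda>x. UApp v x)"
  and "uframe (\<lambda>x. UFst x)"
  and "uframe (\<lambda>x. USnd x)"
  and "uframe (\<lambda>x. UPair x t)"
  and "uval v \<Longrightarrow> uframe (\<lambda>x. UPair v x)"
  and "uframe (\<lambda>x. UInl x)"
  and "uframe (\<lambda>x. UInr x)"
  and "uframe (\<lambda>x. UCase x t1 t2)"
  and "uframe (\<lambda>x. USeq x t)"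
  and "uframe (\<lambda>x. UIf x t1 t2)"
  by (rule uframeI; fastforce)+

section \<open>Agreement of fuel evaluation with source reduction\<close>

lemma sstep_cong:
  assumes "sstep t t'"
  shows
    "sstep (SApp t s) (SApp t' s)"
    "sval v \<Longrightarrow> sstep (SApp v t) (SApp v t')"
    "sstep (SFst t) (SFst t')"
    "sstep (SSnd t) (SSnd t')"
    "sstep (SPair t s) (SPair t' s)"
    "sval v \<Longrightarrow> sstep (SPair v t) (SPair v t')"
    "sstep (SInl t) (SInl t')"
    "sstep (SInr t) (SInr t')"
    "sstep (SCase t s s') (SCase t' s s')"
    "sstep (SSeq t s) (SSeq t' s)"
    "sstep (SIf t s s') (SIf t' s s')"
    "sstep (SFix \<tau>1 \<tau>2 t) (SFix \<tau>1 \<tau>2 t')"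
proof -
  obtain E r r' where E: "sectx E" and r: "sred r r'" and t: "t = splug E r" "t' = splug E r'"
    using assms by cases
  show "sstep (SApp t s) (SApp t' s)"
    using sstep.intros[OF sectx.intros(2)[OF E] r] by (simp add: t)
  show "sstep (SApp v t) (SApp v t')" if "sval v"
    using sstep.intros[OF sectx.intros(3)[OF that E] r] by (simp add: t)
  show "sstep (SFst t) (SFst t')"
    using sstep.intros[OF sectx.intros(4)[OF E] r] by (simp add: t)
  show "sstep (SSnd t) (SSnd t')"
    using sstep.intros[OF sectx.intros(5)[OF E] r] by (simp add: t)
  show "sstep (SPair t s) (SPair t' s)"
    using sstep.intros[OF sectx.intros(6)[OF E] r] by (simp add: t)
  show "sstep (SPair v t) (SPair v t')" if "sval v"
    using sstep.intros[OF sectx.intros(7)[OF that E] r] by (simp add: t)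
  show "sstep (SInl t) (SInl t')"
    using sstep.intros[OF sectx.intros(8)[OF E] r] by (simp add: t)
  show "sstep (SInr t) (SInr t')"
    using sstep.intros[OF sectx.intros(9)[OF E] r] by (simp add: t)
  show "sstep (SCase t s s') (SCase t' s s')"
    using sstep.intros[OF sectx.intros(10)[OF E] r] by (simp add: t)
  show "sstep (SSeq t s) (SSeq t' s)"
    using sstep.intros[OF sectx.intros(11)[OF E] r] by (simp add: t)
  show "sstep (SIf t s s') (SIf t' s s')"
    using sstep.intros[OF sectx.intros(12)[OF E] r] by (simp add: t)
  show "sstep (SFix \<tau>1 \<tau>2 t) (SFix \<tau>1 \<tau>2 t')"
    using sstep.intros[OF sectx.intros(13)[OF E] r] by (simp add: t)
qed

lemma sred_sstep: "sred t t' \<Longrightarrow> sstep t t'"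
  using sstep.intros[of SHole t t'] by (simp add: sectx.intros)

lemma ssteps_map:
  "sstep\<^sup>*\<^sup>* t t' \<Longrightarrow> (\<And>a b. sstep a b \<Longrightarrow> sstep (f a) (f b)) \<Longrightarrow> sstep\<^sup>*\<^sup>* (f t) (f t')"
  by (induction rule: rtranclp_induct) (auto intro: rtranclp.rtrancl_into_rtrancl)

lemma sev_ssteps: "sev t k k' v \<Longrightarrow> sstep\<^sup>*\<^sup>* t v"
proof (induction rule: sev.induct)
  case (5 t1 k1 k2 \<tau> t t2 k3 v k4 r)
  have "sstep\<^sup>*\<^sup>* (SApp t1 t2) (SApp (SLam \<tau> t) t2)"
    by (rule ssteps_map[OF 5(4) sstep_cong(1)])
  also have "sstep\<^sup>*\<^sup>* \<dots> (SApp (SLam \<tau> t) v)"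
    by (rule ssteps_map[OF 5(5) sstep_cong(2)]) auto
  also have "sstep \<dots> (ssubst 0 v t)"
    by (rule sred_sstep[OF sred.intros(1)]) (rule sev_sval[OF 5(2)])
  finally show ?case using 5(6) by (rule rtranclp_trans)
next
  case (6 t k1 k2 v1 v2)
  have "sstep\<^sup>*\<^sup>* (SFst t) (SFst (SPair v1 v2))"
    by (rule ssteps_map[OF 6(2) sstep_cong(3)])
  also have "sstep \<dots> v1"
    using sev_sval[OF 6(1)] by (auto intro!: sred_sstep sred.intros)
  finally show ?case .
next
  case (7 t k1 k2 v1 v2)
  have "sstep\<^sup>*\<^sup>* (SSnd t) (SSnd (SPair v1 v2))"
    by (rule ssteps_map[OF 7(2) sstep_cong(4)])
  also have "sstep \<dots> v2"
    using sev_sval[OF 7(1)] by (auto intro!: sred_sstep sred.intros)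
  finally show ?case .
next
  case (8 t1 k1 k2 v1 t2 k3 v2)
  have "sstep\<^sup>*\<^sup>* (SPair t1 t2) (SPair v1 t2)"
    by (rule ssteps_map[OF 8(3) sstep_cong(5)])
  also have "sstep\<^sup>*\<^sup>* \<dots> (SPair v1 v2)"
    by (rule ssteps_map[OF 8(4) sstep_cong(6)]) (simp_all add: sev_sval[OF 8(1)])
  finally show ?case .
next
  case (9 t k1 k2 v)
  show ?case by (rule ssteps_map[OF 9(2) sstep_cong(7)])
next
  case (10 t k1 k2 v)
  show ?case by (rule ssteps_map[OF 10(2) sstep_cong(8)])
next
  case (11 t k1 k2 v t1 k3 r t2)
  have "sstep\<^sup>*\<^sup>* (SCase t t1 t2) (SCase (SInl v) t1 t2)"
    by (rule ssteps_map[OF 11(3) sstep_cong(9)])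
  also have "sstep \<dots> (ssubst 0 v t1)"
    using sev_sval[OF 11(1)] by (auto intro!: sred_sstep sred.intros)
  finally show ?case using 11(4) by (rule rtranclp_trans)
next
  case (12 t k1 k2 v t2 k3 r t1)
  have "sstep\<^sup>*\<^sup>* (SCase t t1 t2) (SCase (SInr v) t1 t2)"
    by (rule ssteps_map[OF 12(3) sstep_cong(9)])
  also have "sstep \<dots> (ssubst 0 v t2)"
    using sev_sval[OF 12(1)] by (auto intro!: sred_sstep sred.intros)
  finally show ?case using 12(4) by (rule rtranclp_trans)
next
  case (13 t1 k1 k2 t2 k3 r)
  have "sstep\<^sup>*\<^sup>* (SSeq t1 t2) (SSeq SUnit t2)"
    by (rule ssteps_map[OF 13(3) sstep_cong(10)])
  also have "sstep \<dots> t2"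
    by (auto intro!: sred_sstep sred.intros)
  finally show ?case using 13(4) by (rule rtranclp_trans)
next
  case (14 t k1 k2 t1 k3 r t2)
  have "sstep\<^sup>*\<^sup>* (SIf t t1 t2) (SIf STrue t1 t2)"
    by (rule ssteps_map[OF 14(3) sstep_cong(11)])
  also have "sstep \<dots> t1"
    by (auto intro!: sred_sstep sred.intros)
  finally show ?case using 14(4) by (rule rtranclp_trans)
next
  case (15 t k1 k2 t2 k3 r t1)
  have "sstep\<^sup>*\<^sup>* (SIf t t1 t2) (SIf SFalse t1 t2)"
    by (rule ssteps_map[OF 15(3) sstep_cong(11)])
  also have "sstep \<dots> t2"
    by (auto intro!: sred_sstep sred.intros)
  finally show ?case using 15(4) by (rule rtranclp_trans)
next
  case (16 s k1 k2 \<tau>1 \<tau>2 t k3 r)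
  have "sstep\<^sup>*\<^sup>* (SFix \<tau>1 \<tau>2 s) (SFix \<tau>1 \<tau>2 (SLam (TFun \<tau>1 \<tau>2) t))"
    by (rule ssteps_map[OF 16(3) sstep_cong(12)])
  also note sred_sstep[OF sred.intros(9)]
  finally show ?case using 16(4) by (rule rtranclp_trans)
qed simp_all

lemmas sframes = sframe_id sframe_intros[THEN sframe_comp]

lemma sframe_splug: "sectx E \<Longrightarrow> sframe (\<lambda>x. splug E x)"
  by (induction rule: sectx.induct) (auto intro: sframes)

lemma sevals_sframe: "sframe K \<Longrightarrow> sevals (K t) r \<longleftrightarrow> (\<exists>v. sevals t v \<and> sevals (K v) r)"
proof (intro iffI)
  assume K: "sframe K" and "\<exists>v. sevals t v \<and> sevals (K v) r"
  then obtain v k1 k1' k2 k2' where "sev t k1 k1' v" "sev (K v) k2 k2' r"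
    unfolding sevals_def by blast
  \<comment> \<open>Each run is padded so that the first ends with exactly the amount
    \<open>k1' + k2\<close> with which the second begins.\<close>
  from this(1)[THEN sev_shift, of k2] this(2)[THEN sev_shift, of k1']
  have "sev t (k1 + k2) (k1' + k2) v" "sev (K v) (k1' + k2) (k2' + k1') r"
    by (simp_all add: add.commute)
  with K show "sevals (K t) r"
    unfolding sevals_def sframe_def by blast
next
  assume "sframe K" "sevals (K t) r"
  then show "\<exists>v. sevals t v \<and> sevals (K v) r"
    unfolding sevals_def sframe_def by blast
qed

text \<open>Exactly one unit is spent; this exact count is what later pays for lowering the step
  index.\<close>

definition shead :: "strm \<Rightarrow> strm \<Rightarrow> bool" where
  "shead t t' \<longleftrightarrow> (\<forall>k k' r. sev t k k' r \<longleftrightarrow> (\<exists>j. k = Suc j \<and> sev t' j k' r))"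

lemma sred_shead: "sred t t' \<Longrightarrow> shead t t'"
  by (induction rule: sred.induct) (auto simp: shead_def)

lemma sevals_sred: "sred t t' \<Longrightarrow> sevals t' v \<Longrightarrow> sevals t v"
  using sred_shead unfolding sevals_def shead_def by blast

lemma sevals_sstep: "sstep t t' \<Longrightarrow> sevals t' v \<Longrightarrow> sevals t v"
  by (elim sstep.cases) (metis sevals_sframe sframe_splug sevals_sred)

text \<open>From reduction to evaluation, the argument runs backwards from the final value, which
  evaluates to itself; closure of \<open>sevals\<close> under expansion carries it to the
  start.\<close>

lemma sconverges_iff: "(t \<Down>\<^sub>s) \<longleftrightarrow> (\<exists>v. sevals t v)"
proof
  assume "t \<Down>\<^sub>s"
  then obtain v where "sstep\<^sup>*\<^sup>* t v" "sval v"
    unfolding sconverges_def by blast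
  then have "sevals t v"
    by (induction rule: converse_rtranclp_induct) (auto simp: sevals_def[of v] intro: sevals_sstep)
  then show "\<exists>v. sevals t v" ..
next
  assume "\<exists>v. sevals t v"
  then show "t \<Down>\<^sub>s"
    unfolding sconverges_def sevals_def using sev_ssteps sev_sval by blast
qed

section \<open>Agreement of fuel evaluation with target reduction\<close>

lemma ustep_cong:
  assumes "ustep t t'"
  shows
    "ustep (UApp t s) (UApp t' s)"
    "uval v \<Longrightarrow> ustep (UApp v t) (UApp v t')"
    "ustep (UFst t) (UFst t')"
    "ustep (USnd t) (USnd t')"
    "ustep (UPair t s) (UPair t' s)"
    "uval v \<Longrightarrow> ustep (UPair v t) (UPair v t')"
    "ustep (UInl t) (UInl t')"
    "ustep (UInr t) (UInr t')"
    "ustep (UCase t s s') (UCase t' s s')"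
    "ustep (USeq t s) (USeq t' s)"
    "ustep (UIf t s s') (UIf t' s s')"
proof -
  obtain E r r' where E: "uectx E" and r: "ured r r'" and t: "t = uplug E r" "t' = uplug E r'"
    using assms by cases
  show "ustep (UApp t s) (UApp t' s)"
    using ustep.intros[OF uectx.intros(2)[OF E] r] by (simp add: t)
  show "ustep (UApp v t) (UApp v t')" if "uval v"
    using ustep.intros[OF uectx.intros(3)[OF that E] r] by (simp add: t)
  show "ustep (UFst t) (UFst t')"
    using ustep.intros[OF uectx.intros(4)[OF E] r] by (simp add: t)
  show "ustep (USnd t) (USnd t')"
    using ustep.intros[OF uectx.intros(5)[OF E] r] by (simp add: t)
  show "ustep (UPair t s) (UPair t' s)"
    using ustep.intros[OF uectx.intros(6)[OF E] r] by (simp add: t)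
  show "ustep (UPair v t) (UPair v t')" if "uval v"
    using ustep.intros[OF uectx.intros(7)[OF that E] r] by (simp add: t)
  show "ustep (UInl t) (UInl t')"
    using ustep.intros[OF uectx.intros(8)[OF E] r] by (simp add: t)
  show "ustep (UInr t) (UInr t')"
    using ustep.intros[OF uectx.intros(9)[OF E] r] by (simp add: t)
  show "ustep (UCase t s s') (UCase t' s s')"
    using ustep.intros[OF uectx.intros(10)[OF E] r] by (simp add: t)
  show "ustep (USeq t s) (USeq t' s)"
    using ustep.intros[OF uectx.intros(11)[OF E] r] by (simp add: t)
  show "ustep (UIf t s s') (UIf t' s s')"
    using ustep.intros[OF uectx.intros(12)[OF E] r] by (simp add: t)
qed

lemma ured_ustep: "ured t t' \<Longrightarrow> ustep t t'"
  using ustep.intros[of UHole t t'] by (simp add: uectx.intros)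

lemma usteps_map:
  "ustep\<^sup>*\<^sup>* t t' \<Longrightarrow> (\<And>a b. ustep a b \<Longrightarrow> ustep (f a) (f b)) \<Longrightarrow> ustep\<^sup>*\<^sup>* (f t) (f t')"
  by (induction rule: rtranclp_induct) (auto intro: rtranclp.rtrancl_into_rtrancl)

lemma uev_usteps: "uev t k k' v \<Longrightarrow> ustep\<^sup>*\<^sup>* t v"
proof (induction rule: uev.induct)
  case (5 t1 k1 k2 t t2 k3 v k4 r)
  have "ustep\<^sup>*\<^sup>* (UApp t1 t2) (UApp (ULam t) t2)"
    by (rule usteps_map[OF 5(4) ustep_cong(1)])
  also have "ustep\<^sup>*\<^sup>* \<dots> (UApp (ULam t) v)"
    by (rule usteps_map[OF 5(5) ustep_cong(2)]) auto
  also have "ustep \<dots> (usubst 0 v t)"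
    by (rule ured_ustep[OF ured.intros(1)]) (rule uev_uval[OF 5(2)])
  finally show ?case using 5(6) by (rule rtranclp_trans)
next
  case (6 t k1 k2 v1 v2)
  have "ustep\<^sup>*\<^sup>* (UFst t) (UFst (UPair v1 v2))"
    by (rule usteps_map[OF 6(2) ustep_cong(3)])
  also have "ustep \<dots> v1"
    using uev_uval[OF 6(1)] by (auto intro!: ured_ustep ured.intros)
  finally show ?case .
next
  case (7 t k1 k2 v1 v2)
  have "ustep\<^sup>*\<^sup>* (USnd t) (USnd (UPair v1 v2))"
    by (rule usteps_map[OF 7(2) ustep_cong(4)])
  also have "ustep \<dots> v2"
    using uev_uval[OF 7(1)] by (auto intro!: ured_ustep ured.intros)
  finally show ?case .
next
  case (8 t1 k1 k2 v1 t2 k3 v2)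
  have "ustep\<^sup>*\<^sup>* (UPair t1 t2) (UPair v1 t2)"
    by (rule usteps_map[OF 8(3) ustep_cong(5)])
  also have "ustep\<^sup>*\<^sup>* \<dots> (UPair v1 v2)"
    by (rule usteps_map[OF 8(4) ustep_cong(6)]) (simp_all add: uev_uval[OF 8(1)])
  finally show ?case .
next
  case (9 t k1 k2 v)
  show ?case by (rule usteps_map[OF 9(2) ustep_cong(7)])
next
  case (10 t k1 k2 v)
  show ?case by (rule usteps_map[OF 10(2) ustep_cong(8)])
next
  case (11 t k1 k2 v t1 k3 r t2)
  have "ustep\<^sup>*\<^sup>* (UCase t t1 t2) (UCase (UInl v) t1 t2)"
    by (rule usteps_map[OF 11(3) ustep_cong(9)])
  also have "ustep \<dots> (usubst 0 v t1)"
    using uev_uval[OF 11(1)] by (auto intro!: ured_ustep ured.intros)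
  finally show ?case using 11(4) by (rule rtranclp_trans)
next
  case (12 t k1 k2 v t2 k3 r t1)
  have "ustep\<^sup>*\<^sup>* (UCase t t1 t2) (UCase (UInr v) t1 t2)"
    by (rule usteps_map[OF 12(3) ustep_cong(9)])
  also have "ustep \<dots> (usubst 0 v t2)"
    using uev_uval[OF 12(1)] by (auto intro!: ured_ustep ured.intros)
  finally show ?case using 12(4) by (rule rtranclp_trans)
next
  case (13 t1 k1 k2 t2 k3 r)
  have "ustep\<^sup>*\<^sup>* (USeq t1 t2) (USeq UUnit t2)"
    by (rule usteps_map[OF 13(3) ustep_cong(10)])
  also have "ustep \<dots> t2"
    by (auto intro!: ured_ustep ured.intros)
  finally show ?case using 13(4) by (rule rtranclp_trans)
next
  case (14 t k1 k2 t1 k3 r t2)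
  have "ustep\<^sup>*\<^sup>* (UIf t t1 t2) (UIf UTrue t1 t2)"
    by (rule usteps_map[OF 14(3) ustep_cong(11)])
  also have "ustep \<dots> t1"
    by (auto intro!: ured_ustep ured.intros)
  finally show ?case using 14(4) by (rule rtranclp_trans)
next
  case (15 t k1 k2 t2 k3 r t1)
  have "ustep\<^sup>*\<^sup>* (UIf t t1 t2) (UIf UFalse t1 t2)"
    by (rule usteps_map[OF 15(3) ustep_cong(11)])
  also have "ustep \<dots> t2"
    by (auto intro!: ured_ustep ured.intros)
  finally show ?case using 15(4) by (rule rtranclp_trans)
qed simp_all

lemmas uframes = uframe_id uframe_intros[THEN uframe_comp]

lemma uframe_uplug: "uectx E \<Longrightarrow> uframe (\<lambda>x. uplug E x)"
  by (induction rule: uectx.induct) (auto intro: uframes)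

lemma uevals_uframe: "uframe K \<Longrightarrow> uevals (K t) r \<longleftrightarrow> (\<exists>v. uevals t v \<and> uevals (K v) r)"
proof (intro iffI)
  assume K: "uframe K" and "\<exists>v. uevals t v \<and> uevals (K v) r"
  then obtain v k1 k1' k2 k2' where "uev t k1 k1' v" "uev (K v) k2 k2' r"
    unfolding uevals_def by blast
  from this(1)[THEN uev_shift, of k2] this(2)[THEN uev_shift, of k1']
  have "uev t (k1 + k2) (k1' + k2) v" "uev (K v) (k1' + k2) (k2' + k1') r"
    by (simp_all add: add.commute)
  with K show "uevals (K t) r"
    unfolding uevals_def uframe_def by blast
next
  assume "uframe K" "uevals (K t) r"
  then show "\<exists>v. uevals t v \<and> uevals (K v) r"
    unfolding uevals_def uframe_def by blast
qed

definition uhead :: "utrm \<Rightarrow> utrm \<Rightarrow> bool" where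
  "uhead t t' \<longleftrightarrow> (\<forall>k k' r. uev t k k' r \<longleftrightarrow> (\<exists>j. k = Suc j \<and> uev t' j k' r))"

lemma ured_uhead: "ured t t' \<Longrightarrow> t' \<noteq> UWrong \<Longrightarrow> uhead t t'"
  by (induction rule: ured.induct) (auto simp: uhead_def)

text \<open>A step into \<open>UWrong\<close> satisfies the claim vacuously, since
  \<open>UWrong\<close> evaluates to nothing; every other step spends one unit in the sense of
  \<open>uhead\<close>.\<close>

lemma uevals_ured: "ured t t' \<Longrightarrow> uevals t' v \<Longrightarrow> uevals t v"
  using ured_uhead unfolding uevals_def uhead_def by (cases "t' = UWrong") auto

lemma uevals_ustep: "ustep t t' \<Longrightarrow> uevals t' v \<Longrightarrow> uevals t v"
  by (elim ustep.cases) (metis uevals_uframe uframe_uplug uevals_ured)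

lemma uconverges_iff: "(t \<Down>\<^sub>u) \<longleftrightarrow> (\<exists>v. uevals t v)"
proof
  assume "t \<Down>\<^sub>u"
  then obtain v where "ustep\<^sup>*\<^sup>* t v" "uval v"
    unfolding uconverges_def by blast
  then have "uevals t v"
    by (induction rule: converse_rtranclp_induct) (auto simp: uevals_def[of v] intro: uevals_ustep)
  then show "\<exists>v. uevals t v" ..
next
  assume "\<exists>v. uevals t v"
  then show "t \<Down>\<^sub>u"
    unfolding uconverges_def uevals_def using uev_usteps uev_uval by blast
qed

section \<open>Head steps, and reductions of one side alone\<close>

lemma shead_intros:
  shows "sval v \<Longrightarrow> shead (SApp (SLam \<tau> t) v) (ssubst 0 v t)"
    and "sval v1 \<Longrightarrow> sval v2 \<Longrightarrow> shead (SFst (SPair v1 v2)) v1"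
    and "sval v1 \<Longrightarrow> sval v2 \<Longrightarrow> shead (SSnd (SPair v1 v2)) v2"
    and "sval v \<Longrightarrow> shead (SCase (SInl v) t1 t2) (ssubst 0 v t1)"
    and "sval v \<Longrightarrow> shead (SCase (SInr v) t1 t2) (ssubst 0 v t2)"
    and "shead (SSeq SUnit t) t"
    and "shead (SIf STrue t1 t2) t1"
    and "shead (SIf SFalse t1 t2) t2"
  by (auto intro: sred_shead sred.intros)

lemma uhead_intros:
  shows "uval u \<Longrightarrow> uhead (UApp (ULam t) u) (usubst 0 u t)"
    and "uval u1 \<Longrightarrow> uval u2 \<Longrightarrow> uhead (UFst (UPair u1 u2)) u1"
    and "uval u1 \<Longrightarrow> uval u2 \<Longrightarrow> uhead (USnd (UPair u1 u2)) u2"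
    and "uval u \<Longrightarrow> uhead (UCase (UInl u) t1 t2) (usubst 0 u t1)"
    and "uval u \<Longrightarrow> uhead (UCase (UInr u) t1 t2) (usubst 0 u t2)"
    and "uhead (USeq UUnit t) t"
    and "uhead (UIf UTrue t1 t2) t1"
    and "uhead (UIf UFalse t1 t2) t2"
  by (auto simp: uhead_def)

lemma sev_le: "sev t k k' v \<Longrightarrow> k' \<le> k"
  by (induction rule: sev.induct) auto

lemma uev_le: "uev t k k' v \<Longrightarrow> k' \<le> k"
  by (induction rule: uev.induct) auto

text \<open>Reductions taken by one of the two sides alone may only save fuel.\<close>

definition sreduces :: "strm \<Rightarrow> strm \<Rightarrow> bool" where
  "sreduces t t' \<longleftrightarrow>
     (\<forall>k k' r. sev t k k' r \<longrightarrow> (\<exists>j\<ge>k'. sev t' k j r)) \<and> (\<forall>r. sevals t' r \<longrightarrow> sevals t r)"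

definition ureduces :: "utrm \<Rightarrow> utrm \<Rightarrow> bool" where
  "ureduces t t' \<longleftrightarrow>
     (\<forall>k k' r. uev t k k' r \<longrightarrow> (\<exists>j\<ge>k'. uev t' k j r)) \<and> (\<forall>r. uevals t' r \<longrightarrow> uevals t r)"

lemma sreduces_refl: "sreduces t t"
  unfolding sreduces_def by auto

lemma sreduces_trans: "sreduces t t' \<Longrightarrow> sreduces t' t'' \<Longrightarrow> sreduces t t''"
  unfolding sreduces_def by (meson order_trans)

lemma ureduces_trans: "ureduces t t' \<Longrightarrow> ureduces t' t'' \<Longrightarrow> ureduces t t''"
  unfolding ureduces_def by (meson order_trans)

lemma shead_sreduces: "shead t t' \<Longrightarrow> sreduces t t'"
  unfolding sreduces_def shead_def sevals_def using sev_shift[where n = 1]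
  by (metis Suc_eq_plus1 le_add1)

lemma uhead_ureduces: "uhead t t' \<Longrightarrow> ureduces t t'"
  unfolding ureduces_def uhead_def uevals_def using uev_shift[where n = 1]
  by (metis Suc_eq_plus1 le_add1)

lemma sreduces_sframe:
  assumes "sframe K" "sreduces t t'"
  shows "sreduces (K t) (K t')"
  unfolding sreduces_def
proof (intro conjI allI impI)
  fix k k' r
  assume "sev (K t) k k' r"
  then obtain k1 v where "sev t k k1 v" and v: "sev (K v) k1 k' r"
    using assms(1) unfolding sframe_def by blast
  then obtain n where "sev t' k (k1 + n) v"
    using assms(2) unfolding sreduces_def by (metis le_add_diff_inverse)
  moreover have "sev (K v) (k1 + n) (k' + n) r"
    using v by (rule sev_shift)
  ultimately show "\<exists>j\<ge>k'. sev (K t') k j r"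
    using assms(1) unfolding sframe_def by (meson le_add1)
next
  fix r
  assume "sevals (K t') r"
  then show "sevals (K t) r"
    using assms sevals_sframe[of K] unfolding sreduces_def by blast
qed

lemma ureduces_uframe:
  assumes "uframe K" "ureduces t t'"
  shows "ureduces (K t) (K t')"
  unfolding ureduces_def
proof (intro conjI allI impI)
  fix k k' r
  assume "uev (K t) k k' r"
  then obtain k1 v where "uev t k k1 v" and v: "uev (K v) k1 k' r"
    using assms(1) unfolding uframe_def by blast
  then obtain n where "uev t' k (k1 + n) v"
    using assms(2) unfolding ureduces_def by (metis le_add_diff_inverse)
  moreover have "uev (K v) (k1 + n) (k' + n) r"
    using v by (rule uev_shift)
  ultimately show "\<exists>j\<ge>k'. uev (K t') k j r"
    using assms(1) unfolding uframe_def by (meson le_add1)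
next
  fix r
  assume "uevals (K t') r"
  then show "uevals (K t) r"
    using assms uevals_uframe[of K] unfolding ureduces_def by blast
qed


section \<open>Step-indexed relations between source and target\<close>

text \<open>\<open>Fwd\<close> asks the target to follow the source, \<open>Bwd\<close> asks the source to follow the target; the step
  index \<open>w\<close> bounds the fuel of the side that is followed.\<close>

datatype direction = Fwd | Bwd

type_synonym world_rel = "nat \<Rightarrow> strm \<Rightarrow> utrm \<Rightarrow> bool"

primrec erel :: "direction \<Rightarrow> world_rel \<Rightarrow> world_rel" where
  "erel Fwd R w s t \<longleftrightarrow> (\<forall>w' v. sev s w w' v \<longrightarrow> (\<exists>u. uevals t u \<and> R w' v u))"
| "erel Bwd R w s t \<longleftrightarrow> (\<forall>w' u. uev t w w' u \<longrightarrow> (\<exists>v. sevals s v \<and> R w' v u))"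

text \<open>Downward closure lets surplus fuel be forgotten; closedness makes the substitution
  lemmas for closing environments applicable to related values.\<close>

definition value_rel :: "world_rel \<Rightarrow> bool" where
  "value_rel R \<longleftrightarrow>
     (\<forall>w v u. R w v u \<longrightarrow> sval v \<and> uval u \<and> sscoped 0 v \<and> (0 \<turnstile>\<^sub>u u)) \<and>
     (\<forall>w w' v u. R w v u \<longrightarrow> w' \<le> w \<longrightarrow> R w' v u)"

lemma value_relD:
  assumes "value_rel R" "R w v u"
  shows "sval v" "uval u" "sscoped 0 v" "0 \<turnstile>\<^sub>u u" "w' \<le> w \<Longrightarrow> R w' v u"
  using assms unfolding value_rel_def by blast+

lemma sevals_value [simp]: "sval v \<Longrightarrow> sevals v r \<longleftrightarrow> r = v"
  by (auto simp: sevals_def)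

lemma uevals_value [simp]: "uval v \<Longrightarrow> uevals v r \<longleftrightarrow> r = v"
  by (auto simp: uevals_def)

lemma sevals_sval: "sevals t v \<Longrightarrow> sval v"
  unfolding sevals_def using sev_sval by blast

lemma uevals_uval: "uevals t u \<Longrightarrow> uval u"
  unfolding uevals_def using uev_uval by blast

lemma erel_value: "sval v \<Longrightarrow> uval u \<Longrightarrow> R w v u \<Longrightarrow> erel d R w v u"
  by (cases d) auto

text \<open>A run on the smaller budget is padded to one on the larger; its result is then related
  at the padded leftover and comes down by closure of \<open>R\<close>.\<close>

lemma erel_mono:
  assumes "value_rel R" "erel d R w s t" "w' \<le> w"
  shows "erel d R w' s t"
proof -
  obtain n where w: "w = w' + n"
    using assms(3) le_Suc_ex by blast
  show ?thesis
    using assms(1,2) sev_shift[of s w' _ _ n] uev_shift[of t w' _ _ n] unfolding w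
    by (cases d) (simp; meson value_relD(5) le_add1)+
qed

lemma erel_weaken: "erel d R w s t \<Longrightarrow> (\<And>w' v u. w' \<le> w \<Longrightarrow> R w' v u \<Longrightarrow> R' w' v u) \<Longrightarrow> erel d R' w s t"
  by (cases d) (simp; meson sev_le uev_le)+

text \<open>The run of the followed side factors through its frame. The values reached in between
  are related at precisely the fuel left there, so the frames need only be compared from that index
  on.\<close>

lemma erel_bind:
  assumes K: "sframe K" and L: "uframe L" and st: "erel d R w s t"
    and vu: "\<And>w' v u. w' \<le> w \<Longrightarrow> sval v \<Longrightarrow> uval u \<Longrightarrow> R w' v u \<Longrightarrow> erel d R' w' (K v) (L u)"
  shows "erel d R' w (K s) (L t)"
proof (cases d)
  case Fwd
  show ?thesis
    unfolding Fwd erel.simps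
  proof (intro allI impI)
    fix w' r
    assume "sev (K s) w w' r"
    then obtain w1 v where v: "sev s w w1 v" "sev (K v) w1 w' r"
      using K unfolding sframe_def by blast
    then obtain u where u: "uevals t u" "R w1 v u"
      using st Fwd by auto
    have "erel d R' w1 (K v) (L u)"
      by (rule vu[OF sev_le[OF v(1)] sev_sval[OF v(1)] uevals_uval[OF u(1)] u(2)])
    then obtain u' where "uevals (L u) u'" "R' w' r u'"
      using v(2) unfolding Fwd by auto
    then show "\<exists>u. uevals (L t) u \<and> R' w' r u"
      using u(1) uevals_uframe[OF L] by blast
  qed
next
  case Bwd
  show ?thesis
    unfolding Bwd erel.simps
  proof (intro allI impI)
    fix w' r
    assume "uev (L t) w w' r"
    then obtain w1 u where u: "uev t w w1 u" "uev (L u) w1 w' r"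
      using L unfolding uframe_def by blast
    then obtain v where v: "sevals s v" "R w1 v u"
      using st Bwd by auto
    have "erel d R' w1 (K v) (L u)"
      by (rule vu[OF uev_le[OF u(1)] sevals_sval[OF v(1)] uev_uval[OF u(1)] v(2)])
    then obtain v' where "sevals (K v) v'" "R' w' v' r"
      using u(2) unfolding Bwd by auto
    then show "\<exists>v. sevals (K s) v \<and> R' w' v r"
      using v(1) sevals_sframe[OF K] by blast
  qed
qed

lemma sevals_shead: "shead s s' \<Longrightarrow> sevals s r \<longleftrightarrow> sevals s' r"
  unfolding shead_def sevals_def by blast

lemma uevals_uhead: "uhead t t' \<Longrightarrow> uevals t r \<longleftrightarrow> uevals t' r"
  unfolding uhead_def uevals_def by blast

text \<open>A simultaneous step spends one unit on the followed side, hence the reducts are compared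
  at the predecessor of the index, and at index \<open>0\<close> nothing remains to be
  shown.\<close>

lemma erel_step:
  assumes "shead s s'" "uhead t t'" "\<And>w'. w = Suc w' \<Longrightarrow> erel d R w' s' t'"
  shows "erel d R w s t"
  using assms by (cases d) (auto simp: sevals_shead uevals_uhead, auto simp: shead_def uhead_def)

text \<open>A step of one side alone keeps the index even when that side is the followed one: the
  reduct ends with at least as much fuel, and downward closure discards the surplus.\<close>

lemma erel_sreduces:
  assumes "value_rel R" "sreduces s s'" "erel d R w s' t"
  shows "erel d R w s t"
  using assms by (cases d) (simp add: sreduces_def; meson value_relD(5))+

lemma erel_ureduces:
  assumes "value_rel R" "ureduces t t'" "erel d R w s t'"
  shows "erel d R w s t"
  using assms by (cases d) (simp add: ureduces_def; meson value_relD(5))+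

text \<open>Backwards, the components of a universal value, which live one level below it, are only known one
  step less precisely than the value itself; projecting them costs the target the missing step.\<close>

definition later :: "direction \<Rightarrow> world_rel \<Rightarrow> world_rel" where
  "later d R w = R (case d of Fwd \<Rightarrow> w | Bwd \<Rightarrow> w - 1)"

definition prel :: "world_rel \<Rightarrow> world_rel \<Rightarrow> world_rel" where
  "prel A B w v u \<longleftrightarrow>
     (\<exists>v1 v2 u1 u2. v = SPair v1 v2 \<and> u = UPair u1 u2 \<and> A w v1 u1 \<and> B w v2 u2)"

definition srel :: "world_rel \<Rightarrow> world_rel \<Rightarrow> world_rel" where
  "srel A B w v u \<longleftrightarrow>
     (\<exists>v' u'. v = SInl v' \<and> u = UInl u' \<and> A w v' u') \<or> (\<exists>v' u'. v = SInr v' \<and> u = UInr u' \<and> B w v' u')"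

text \<open>The strict bound \<open>w' < w\<close> reflects the step spent by a beta reduction and
  makes fixed points accessible to induction on the index. The annotation \<open>\<tau>\<close> is
  fixed because \<open>SFix\<close> reduces only on an abstraction annotated with its own
  type.\<close>

definition frel :: "direction \<Rightarrow> ty \<Rightarrow> world_rel \<Rightarrow> world_rel \<Rightarrow> world_rel" where
  "frel d \<tau> A B w v u \<longleftrightarrow>
     (\<exists>s t. v = SLam \<tau> s \<and> u = ULam t \<and> sscoped 1 s \<and> (1 \<turnstile>\<^sub>u t) \<and>
       (\<forall>w'<w. \<forall>v' u'. A w' v' u' \<longrightarrow> erel d B w' (ssubst 0 v' s) (usubst 0 u' t)))"

definition unitrel :: world_rel where
  "unitrel w v u \<longleftrightarrow> v = SUnit \<and> u = UUnit"

definition boolrel :: world_rel where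
  "boolrel w v u \<longleftrightarrow> v = STrue \<and> u = UTrue \<or> v = SFalse \<and> u = UFalse"

lemma value_rel_later [intro]: "value_rel R \<Longrightarrow> value_rel (later d R)"
  unfolding value_rel_def later_def by (cases d; simp; meson diff_le_mono)

lemma value_rel_prel [intro]: "value_rel A \<Longrightarrow> value_rel B \<Longrightarrow> value_rel (prel A B)"
  unfolding value_rel_def prel_def by fastforce

lemma value_rel_srel [intro]: "value_rel A \<Longrightarrow> value_rel B \<Longrightarrow> value_rel (srel A B)"
  unfolding value_rel_def srel_def by fastforce

lemma value_rel_frel [intro]: "value_rel (frel d \<tau> A B)"
  unfolding value_rel_def frel_def by fastforce

lemma value_rel_unitrel [intro]: "value_rel unitrel"
  unfolding value_rel_def unitrel_def by auto

lemma value_rel_boolrel [intro]: "value_rel boolrel"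
  unfolding value_rel_def boolrel_def by auto

text \<open>The step that opens a value drops the index from \<open>Suc w\<close> to
  \<open>w\<close>, and \<open>w\<close> is an index at which the component is known: backwards by
  definition, forwards by downward closure.\<close>

lemma later_Suc: "value_rel R \<Longrightarrow> later d R (Suc w) v u \<Longrightarrow> R w v u"
  unfolding later_def by (cases d) (auto intro: value_relD(5)[of R "Suc w"])

lemma laterI: "value_rel R \<Longrightarrow> R w v u \<Longrightarrow> later d R w v u"
  unfolding later_def by (cases d) (auto intro: value_relD(5)[of R w])

lemma erel_later:
  assumes "erel d R (case d of Fwd \<Rightarrow> w | Bwd \<Rightarrow> w - 1) s u" "uval u"
  shows "erel d (later d R) w s u"
  using assms by (cases d) (auto simp: later_def)

section \<open>Compatibility with the term constructors\<close>

lemma erel_pair: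
  assumes "value_rel B" "value_rel A" "erel d A w s1 t1" "erel d B w s2 t2"
  shows "erel d (prel A B) w (SPair s1 s2) (UPair t1 t2)"
proof (rule erel_bind[OF sframe_intros(5) uframe_intros(5) assms(3)])
  fix w1 v1 u1
  assume 1: "w1 \<le> w" "sval v1" "uval u1" "A w1 v1 u1"
  show "erel d (prel A B) w1 (SPair v1 s2) (UPair u1 t2)"
  proof (rule erel_bind[OF sframe_intros(6) uframe_intros(6) erel_mono[OF assms(1,4) 1(1)]])
    fix w2 v2 u2
    assume "w2 \<le> w1" "sval v2" "uval u2" "B w2 v2 u2"
    then show "erel d (prel A B) w2 (SPair v1 v2) (UPair u1 u2)"
      using 1 assms(2) by (intro erel_value) (auto simp: prel_def intro: value_relD(5)[OF assms(2)])
  qed (use 1 in auto)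
qed

lemma erel_inl: "erel d A w s t \<Longrightarrow> erel d (srel A B) w (SInl s) (UInl t)"
  by (erule erel_bind[OF sframe_intros(7) uframe_intros(7)]) (auto intro!: erel_value simp: srel_def)

lemma erel_inr: "erel d B w s t \<Longrightarrow> erel d (srel A B) w (SInr s) (UInr t)"
  by (erule erel_bind[OF sframe_intros(8) uframe_intros(8)]) (auto intro!: erel_value simp: srel_def)

lemma erel_app:
  assumes "value_rel A" "erel d (frel d \<tau> A B) w s1 t1" "erel d A w s2 t2"
  shows "erel d B w (SApp s1 s2) (UApp t1 t2)"
proof (rule erel_bind[OF sframe_intros(1) uframe_intros(1) assms(2)])
  fix w1 v1 u1
  assume 1: "w1 \<le> w" "sval v1" "uval u1" "frel d \<tau> A B w1 v1 u1"
  then obtain s t where st: "v1 = SLam \<tau> s" "u1 = ULam t"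
    "\<And>w' v' u'. w' < w1 \<Longrightarrow> A w' v' u' \<Longrightarrow> erel d B w' (ssubst 0 v' s) (usubst 0 u' t)"
    unfolding frel_def by blast
  show "erel d B w1 (SApp v1 s2) (UApp u1 t2)"
  proof (rule erel_bind[OF sframe_intros(2) uframe_intros(2) erel_mono[OF assms(1,3) 1(1)]])
    fix w2 v2 u2
    assume 2: "w2 \<le> w1" "sval v2" "uval u2" "A w2 v2 u2"
    show "erel d B w2 (SApp v1 v2) (UApp u1 u2)"
      unfolding st(1,2)
    proof (rule erel_step[OF shead_intros(1) uhead_intros(1)])
      fix w3
      assume "w2 = Suc w3"
      then show "erel d B w3 (ssubst 0 v2 s) (usubst 0 u2 t)"
        using 2 by (intro st(3)) (auto intro: value_relD(5)[OF assms(1)])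
    qed (use 2 in auto)
  qed (use 1 in auto)
qed

text \<open>Projecting is itself a step, so it makes up for a component known only
  \<open>later\<close>. With this weak premise the lemma serves source types and universal values
  alike.\<close>

lemma erel_fst:
  assumes "value_rel A" "erel d (prel (later d A) B) w s t"
  shows "erel d A w (SFst s) (UFst t)"
proof (rule erel_bind[OF sframe_intros(3) uframe_intros(3) assms(2)])
  fix w1 v u
  assume "sval v" "uval u" "prel (later d A) B w1 v u"
  then show "erel d A w1 (SFst v) (UFst u)"
    using assms(1)
    by (auto simp: prel_def intro!: erel_step[OF shead_intros(2) uhead_intros(2)] intro: erel_value
        dest: later_Suc value_relD(1,2)[of A])
qed

lemma erel_snd:
  assumes "value_rel B" "erel d (prel A (later d B)) w s t"
  shows "erel d B w (SSnd s) (USnd t)"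
proof (rule erel_bind[OF sframe_intros(4) uframe_intros(4) assms(2)])
  fix w1 v u
  assume "sval v" "uval u" "prel A (later d B) w1 v u"
  then show "erel d B w1 (SSnd v) (USnd u)"
    using assms(1)
    by (auto simp: prel_def intro!: erel_step[OF shead_intros(3) uhead_intros(3)] intro: erel_value
        dest: later_Suc value_relD(1,2)[of B])
qed

lemma erel_case:
  assumes "value_rel A" "value_rel B" "erel d (srel (later d A) (later d B)) w s t"
    and 1: "\<And>w' v u. w' < w \<Longrightarrow> A w' v u \<Longrightarrow> erel d C w' (ssubst 0 v s1) (usubst 0 u t1)"
    and 2: "\<And>w' v u. w' < w \<Longrightarrow> B w' v u \<Longrightarrow> erel d C w' (ssubst 0 v s2) (usubst 0 u t2)"
  shows "erel d C w (SCase s s1 s2) (UCase t t1 t2)"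
proof (rule erel_bind[OF sframe_intros(9) uframe_intros(9) assms(3)])
  fix w1 v u
  assume w1: "w1 \<le> w" and vu: "sval v" "uval u" and "srel (later d A) (later d B) w1 v u"
  from this(4) consider v' u' where "v = SInl v'" "u = UInl u'" "later d A w1 v' u'"
    | v' u' where "v = SInr v'" "u = UInr u'" "later d B w1 v' u'"
    unfolding srel_def by blast
  then show "erel d C w1 (SCase v s1 s2) (UCase u t1 t2)"
  proof cases
    case (1 v' u')
    show ?thesis
      unfolding 1(1,2)
    proof (rule erel_step[OF shead_intros(4) uhead_intros(4)])
      fix w2
      assume "w1 = Suc w2"
      then show "erel d C w2 (ssubst 0 v' s1) (usubst 0 u' t1)"
        using w1 1(3) later_Suc[OF assms(1)] by (intro assms(4)) auto
    qed (use vu 1 in auto)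
  next
    case (2 v' u')
    show ?thesis
      unfolding 2(1,2)
    proof (rule erel_step[OF shead_intros(5) uhead_intros(5)])
      fix w2
      assume "w1 = Suc w2"
      then show "erel d C w2 (ssubst 0 v' s2) (usubst 0 u' t2)"
        using w1 2(3) later_Suc[OF assms(2)] by (intro assms(5)) auto
    qed (use vu 2 in auto)
  qed
qed

lemma erel_seq:
  assumes "value_rel R" "erel d unitrel w s t" "erel d R w s2 t2"
  shows "erel d R w (SSeq s s2) (USeq t t2)"
proof (rule erel_bind[OF sframe_intros(10) uframe_intros(10) assms(2)])
  fix w1 v u
  assume "w1 \<le> w" "unitrel w1 v u"
  then show "erel d R w1 (SSeq v s2) (USeq u t2)"
    by (auto simp: unitrel_def intro!: erel_step[OF shead_intros(6) uhead_intros(6)]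
        erel_mono[OF assms(1,3)])
qed

lemma erel_if:
  assumes "value_rel R" "erel d boolrel w s t" "erel d R w s1 t1" "erel d R w s2 t2"
  shows "erel d R w (SIf s s1 s2) (UIf t t1 t2)"
proof (rule erel_bind[OF sframe_intros(11) uframe_intros(11) assms(2)])
  fix w1 v u
  assume "w1 \<le> w" "boolrel w1 v u"
  then show "erel d R w1 (SIf v s1 s2) (UIf u t1 t2)"
    by (auto simp: boolrel_def intro!: erel_step[OF shead_intros(7) uhead_intros(7)]
        erel_step[OF shead_intros(8) uhead_intros(8)] erel_mono[OF assms(1,3)] erel_mono[OF assms(1,4)])
qed

lemma erel_prel_later:
  assumes "value_rel A" "value_rel B" "erel d (prel A B) w s t"
  shows "erel d (prel (later d A) B) w s t" "erel d (prel A (later d B)) w s t"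
  by (rule erel_weaken[OF assms(3)], fastforce simp: prel_def intro: laterI assms)+

lemma erel_srel_later:
  assumes "value_rel A" "value_rel B" "erel d (srel A B) w s t"
  shows "erel d (srel (later d A) (later d B)) w s t"
  by (rule erel_weaken[OF assms(3)])
    (auto simp: srel_def intro: laterI[OF assms(1)] laterI[OF assms(2)])

text \<open>Bind against a source value: wrappers make the target evaluate an argument that the
  source has simply substituted. Forwards the index stays \<open>w\<close>, since the value
  \<open>v\<close> consumes no source fuel; backwards it drops with the run of
  \<open>t\<close>.\<close>

lemma erel_bind_target:
  assumes L: "uframe L" and vt: "erel d R w v t" and v: "sval v"
    and u: "\<And>w' u. w' \<le> w \<Longrightarrow> uval u \<Longrightarrow> R w' v u \<Longrightarrow> erel d R' w' s (L u)"
  shows "erel d R' w s (L t)"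
proof (cases d)
  case Fwd
  then obtain u0 where "uevals t u0" "R w v u0"
    using vt v by auto
  then have "erel Fwd R' w s (L u0)" and "\<And>r. uevals (L u0) r \<Longrightarrow> uevals (L t) r"
    using u[OF order_refl uevals_uval] uevals_uframe[OF L] Fwd by blast+
  then show ?thesis
    unfolding Fwd erel.simps by meson
next
  case Bwd
  show ?thesis
    unfolding Bwd erel.simps
  proof (intro allI impI)
    fix w' r
    assume "uev (L t) w w' r"
    then obtain w1 u0 where *: "uev t w w1 u0" "uev (L u0) w1 w' r"
      using L unfolding uframe_def by blast
    then have "R w1 v u0"
      using vt v unfolding Bwd by auto
    from u[OF uev_le[OF *(1)] uev_uval[OF *(1)] this] *(2)
    show "\<exists>v. sevals s v \<and> R' w' v r"
      unfolding Bwd by auto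
  qed
qed

subsection \<open>Fixed points\<close>

text \<open>One unfolding of \<open>SFix\<close> is matched with two steps of the call-by-value
  combinator. The recursive references substituted on the two sides are related by induction on the
  index, since calling them happens only at smaller indices.\<close>

lemma erel_fix:
  assumes A: "value_rel A"
    and st: "erel d (frel d (TFun \<tau>1 \<tau>2) (frel d \<tau>1 A B) (frel d \<tau>1 A B)) w s t"
  shows "erel d (frel d \<tau>1 A B) w (SFix \<tau>1 \<tau>2 s) (UApp ufix t)"
proof (rule erel_bind[OF sframe_intros(12) uframe_intros(2) st])
  let ?R = "frel d \<tau>1 A B"
  fix w1 v u
  assume "frel d (TFun \<tau>1 \<tau>2) ?R ?R w1 v u"
  then obtain b c where v: "v = SLam (TFun \<tau>1 \<tau>2) b" and u: "u = ULam c"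
    and b: "sscoped 1 b" and c: "1 \<turnstile>\<^sub>u c"
    and bc: "\<And>w' v' u'. w' < w1 \<Longrightarrow> ?R w' v' u' \<Longrightarrow> erel d ?R w' (ssubst 0 v' b) (usubst 0 u' c)"
    unfolding frel_def[of d "TFun \<tau>1 \<tau>2"] by blast
  \<comment> \<open>\<open>g\<close> is the function that an unfolding of \<open>SFix\<close>
    substitutes. \<open>X\<close> is the half \<open>\<lambda>x. f (\<lambda>y. x x y)\<close> of
    \<open>ufix\<close> with \<open>u\<close> for \<open>f\<close>, and \<open>G\<close> is the
    eta-expanded self-application that it passes to \<open>u\<close>.\<close>
  define g where "g = SLam \<tau>1 (SApp (SFix \<tau>1 \<tau>2 v) (SVar 0))"
  define X where "X = ULam (UApp u (ULam (UApp (UApp (UVar 1) (UVar 1)) (UVar 0))))"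
  define G where "G = ULam (UApp (UApp X X) (UVar 0))"
  have "sscoped 0 v" "0 \<turnstile>\<^sub>u u"
    using b c by (simp_all add: v u)
  moreover from this have "0 \<turnstile>\<^sub>u X"
    by (simp add: X_def)
  ultimately have closed: "sscoped 0 v" "0 \<turnstile>\<^sub>u u" "0 \<turnstile>\<^sub>u X" .
  have "shead (SFix \<tau>1 \<tau>2 v) (ssubst 0 (SLam \<tau>1 (SApp (slift 0 (SFix \<tau>1 \<tau>2 v)) (SVar 0))) b)"
    unfolding v by (rule sred_shead[OF sred.intros(9)])
  then have fix_v: "shead (SFix \<tau>1 \<tau>2 v) (ssubst 0 g b)"
    using closed(1) by (simp add: g_def)
  have "usubst 0 X (UApp u (ULam (UApp (UApp (UVar 1) (UVar 1)) (UVar 0)))) = UApp u G"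
    using closed by (simp add: G_def)
  then have XX: "uhead (UApp X X) (UApp u G)"
    using uhead_intros(1)[of X "UApp u (ULam (UApp (UApp (UVar 1) (UVar 1)) (UVar 0)))"]
    by (simp add: X_def)
  have uG: "uhead (UApp u G) (usubst 0 G c)"
    unfolding u by (rule uhead_intros(1)) (simp add: G_def)
  \<comment> \<open>\<open>X X\<close> first becomes \<open>u G\<close>, a step of the target alone;
    the second target step is taken together with the unfolding in the source, so the bodies are
    compared strictly below \<open>w'\<close>.\<close>
  have unroll: "erel d ?R w' (SFix \<tau>1 \<tau>2 v) (UApp X X)"
    if "w' \<le> w1" "\<And>w''. w'' < w' \<Longrightarrow> ?R w'' g G" for w'
    by (rule erel_ureduces[OF value_rel_frel uhead_ureduces[OF XX]])
      (rule erel_step[OF fix_v uG], use that in \<open>auto intro: bc\<close>)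
  have gG: "?R w' g G" if "w' \<le> w1" for w'
    using that
  proof (induction w' rule: less_induct)
    case (less w')
    \<comment> \<open>A call at \<open>w'' < w'\<close> unrolls again and so refers to
      \<open>g\<close> and \<open>G\<close> only below \<open>w''\<close>, where the induction
      hypothesis applies.\<close>
    have "erel d B w'' (SApp (SFix \<tau>1 \<tau>2 v) a) (UApp (UApp X X) e)"
      if "w'' < w'" "A w'' a e" for w'' a e
      using that less value_relD[OF A that(2)]
      by (intro erel_app[OF A unroll] erel_value) auto
    then show ?case
      using closed value_relD[OF A] unfolding frel_def g_def G_def by simp
  qed
  define Y where "Y = ULam (UApp (UVar 1) (ULam (UApp (UApp (UVar 1) (UVar 1)) (UVar 0))))"
  have "uhead (UApp ufix u) (usubst 0 u (UApp Y Y))"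
    unfolding ufix_def Y_def by (rule uhead_intros(1)) (simp add: u)
  moreover have "usubst 0 u (UApp Y Y) = UApp X X"
    using closed(2) by (simp add: X_def Y_def)
  ultimately have "uhead (UApp ufix u) (UApp X X)"
    by simp
  then show "erel d ?R w1 (SFix \<tau>1 \<tau>2 v) (UApp ufix u)"
    by (rule erel_ureduces[OF value_rel_frel uhead_ureduces]) (rule unroll[OF order_refl], simp add: gG)
qed (simp add: ufix_def)


section \<open>The relation at source types\<close>

primrec vrel :: "ty \<Rightarrow> direction \<Rightarrow> world_rel" where
  "vrel TUnit d = unitrel"
| "vrel TBool d = boolrel"
| "vrel (TFun \<tau>1 \<tau>2) d = frel d \<tau>1 (vrel \<tau>1 d) (vrel \<tau>2 d)"
| "vrel (TProd \<tau>1 \<tau>2) d = prel (vrel \<tau>1 d) (vrel \<tau>2 d)"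
| "vrel (TSum \<tau>1 \<tau>2) d = srel (vrel \<tau>1 d) (vrel \<tau>2 d)"

lemma value_rel_vrel [intro, simp]: "value_rel (vrel \<tau> d)"
  by (induction \<tau>) auto

text \<open>The closedness of all \<open>\<sigma> i\<close> and \<open>\<rho> i\<close>, also of those beyond \<open>Rs\<close>, makes the substitution lemmas
  for \<open>sclose\<close> and \<open>uclose\<close> unconditional.\<close>

definition envrel :: "world_rel list \<Rightarrow> nat \<Rightarrow> (nat \<Rightarrow> strm) \<Rightarrow> (nat \<Rightarrow> utrm) \<Rightarrow> bool" where
  "envrel Rs w \<sigma> \<rho> \<longleftrightarrow>
     (\<forall>i. sscoped 0 (\<sigma> i) \<and> (0 \<turnstile>\<^sub>u \<rho> i)) \<and> (\<forall>i<length Rs. (Rs ! i) w (\<sigma> i) (\<rho> i))"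

lemma envrel_extend:
  assumes "\<And>R. R \<in> set (A # Rs) \<Longrightarrow> value_rel R" "envrel Rs w \<sigma> \<rho>" "w' \<le> w" "A w' v u"
  shows "envrel (A # Rs) w' (case_nat v \<sigma>) (case_nat u \<rho>)"
  unfolding envrel_def
proof (intro conjI allI impI)
  fix i
  show "sscoped 0 (case_nat v \<sigma> i)" "0 \<turnstile>\<^sub>u case_nat u \<rho> i"
    using assms value_relD[of A w' v u] by (auto simp: envrel_def split: nat.split)
  assume "i < length (A # Rs)"
  then show "((A # Rs) ! i) w' (case_nat v \<sigma> i) (case_nat u \<rho> i)"
    using assms by (cases i) (auto simp: envrel_def intro: value_relD(5)[OF _ _ assms(3)])
qed

text \<open>Common step for all binders: once the bound index is substituted, the body is closed by
  an extended environment, so the last premise has the shape of an induction hypothesis for that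
  body.\<close>

lemma envrel_bodies:
  assumes "envrel Rs w \<sigma> \<rho>" "\<And>R. R \<in> set (A # Rs) \<Longrightarrow> value_rel R" "w' \<le> w" "A w' v u"
    and "\<And>\<sigma> \<rho>. envrel (A # Rs) w' \<sigma> \<rho> \<Longrightarrow> erel d R w' (sclose 0 \<sigma> s) (uclose 0 \<rho> t)"
  shows "erel d R w' (ssubst 0 v (sclose (Suc 0) \<sigma> s)) (usubst 0 u (uclose (Suc 0) \<rho> t))"
proof -
  have "sscoped 0 v" "0 \<turnstile>\<^sub>u u"
    using assms(2)[of A] value_relD[of A w' v u] assms(4) by auto
  then show ?thesis
    using assms(1) assms(5)[OF envrel_extend[of A Rs w \<sigma> \<rho> w' v u]] assms(2-4)
    by (simp add: ssubst_sclose usubst_uclose envrel_def)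
qed

lemma uscoped_erase: "sscoped n t \<Longrightarrow> n \<turnstile>\<^sub>u erase t"
  by (induction t arbitrary: n) (auto simp: ufix_def)

text \<open>Fundamental property at source types, by compatibility of each construct. The direction
  is a parameter, so one induction yields both implications between convergences.\<close>

theorem erel_erase:
  "\<Gamma> \<turnstile>\<^sub>s t \<Colon> \<tau> \<Longrightarrow> envrel (map (\<lambda>\<tau>. vrel \<tau> d) \<Gamma>) w \<sigma> \<rho> \<Longrightarrow>
    erel d (vrel \<tau> d) w (sclose 0 \<sigma> t) (uclose 0 \<rho> (erase t))"
proof (induction arbitrary: w \<sigma> \<rho> rule: styping.induct)
  case (4 \<tau>1 \<Gamma> t \<tau>2)
  have "frel d \<tau>1 (vrel \<tau>1 d) (vrel \<tau>2 d) w
      (SLam \<tau>1 (sclose (Suc 0) \<sigma> t)) (ULam (uclose (Suc 0) \<rho> (erase t)))"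
    unfolding frel_def using 4
    by (auto simp: envrel_def[of _ w] intro!: envrel_bodies[OF 4(3), where A = "vrel \<tau>1 d"])
  then show ?case by (simp add: erel_value)
next
  case (5 i \<Gamma> \<tau>)
  then have "vrel \<tau> d w (\<sigma> i) (\<rho> i)"
    by (auto simp: envrel_def)
  then show ?case
    by (auto intro: erel_value value_relD[OF value_rel_vrel])
next
  case (12 \<Gamma> t \<tau>1 \<tau>2 t1 \<tau> t2)
  show ?case
    unfolding sclose.simps uclose.simps erase.simps
  proof (rule erel_case[OF value_rel_vrel value_rel_vrel erel_srel_later])
    show "erel d (srel (vrel \<tau>1 d) (vrel \<tau>2 d)) w (sclose 0 \<sigma> t) (uclose 0 \<rho> (erase t))"
      using 12 by simp
    show "erel d (vrel \<tau> d) w' (ssubst 0 v (sclose (Suc 0) \<sigma> t1))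
        (usubst 0 u (uclose (Suc 0) \<rho> (erase t1)))"
      if "w' < w" "vrel \<tau>1 d w' v u" for w' v u
      using 12 that by (intro envrel_bodies[OF 12(7), where A = "vrel \<tau>1 d"]) auto
    show "erel d (vrel \<tau> d) w' (ssubst 0 v (sclose (Suc 0) \<sigma> t2))
        (usubst 0 u (uclose (Suc 0) \<rho> (erase t2)))"
      if "w' < w" "vrel \<tau>2 d w' v u" for w' v u
      using 12 that by (intro envrel_bodies[OF 12(7), where A = "vrel \<tau>2 d"]) auto
  qed auto
next
  case (6 \<Gamma> t1 \<tau>1 \<tau>2 t2)
  then show ?case
    using erel_app[OF value_rel_vrel[of \<tau>1 d], of d \<tau>1 "vrel \<tau>2 d"] by simp
next
  case (7 \<Gamma> t \<tau>1 \<tau>2)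
  then show ?case
    using erel_fst[OF value_rel_vrel erel_prel_later(1)[of "vrel \<tau>1 d" "vrel \<tau>2 d"]] by simp
next
  case (8 \<Gamma> t \<tau>1 \<tau>2)
  then show ?case
    using erel_snd[OF value_rel_vrel erel_prel_later(2)[of "vrel \<tau>1 d" "vrel \<tau>2 d"]] by simp
next
  case (13 \<Gamma> t1 t2 \<tau>)
  then show ?case
    by (simp add: erel_seq)
next
  case (14 \<Gamma> t t1 \<tau> t2)
  then show ?case
    by (simp add: erel_if)
next
  case (15 \<Gamma> t \<tau>1 \<tau>2)
  have "uclose 0 \<rho> ufix = ufix"
    by (simp add: ufix_def)
  then show ?case
    using 15 by (simp add: erel_fix)
qed (simp_all add: unitrel_def boolrel_def erel_value erel_pair erel_inl erel_inr)

lemma erel_erase_closed: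
  assumes "[] \<turnstile>\<^sub>s t \<Colon> \<tau>"
  shows "erel d (vrel \<tau> d) w t (erase t)"
proof -
  have "sscoped 0 t"
    using styping_sscoped[OF assms] by simp
  then show ?thesis
    using erel_erase[OF assms, of d w "\<lambda>_. SUnit" "\<lambda>_. UUnit"] uscoped_erase by (simp add: envrel_def)
qed

lemma erel_erase_body:
  assumes "[\<tau>'] \<turnstile>\<^sub>s t \<Colon> \<tau>" "vrel \<tau>' d w v u"
  shows "erel d (vrel \<tau> d) w (ssubst 0 v t) (usubst 0 u (erase t))"
proof -
  have "sscoped (Suc 0) t"
    using styping_sscoped[OF assms(1)] by simp
  \<comment> \<open>Index \<open>0\<close> is the only free one, so closing from index
    \<open>1\<close> on changes nothing and the dummy units disappear again.\<close>
  moreover have "erel d (vrel \<tau> d) w (ssubst 0 v (sclose (Suc 0) (\<lambda>_. SUnit) t))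
      (usubst 0 u (uclose (Suc 0) (\<lambda>_. UUnit) (erase t)))"
    by (rule envrel_bodies[where Rs = "[]" and A = "vrel \<tau>' d", OF _ _ order_refl])
      (use assms(2) erel_erase[OF assms(1)] in \<open>auto simp: envrel_def\<close>)
  ultimately show ?thesis
    by (simp add: sclose_sscoped uclose_uscoped uscoped_erase)
qed


section \<open>Protecting and confining\<close>

lemma uscoped_protect_confine: "0 \<turnstile>\<^sub>u protect \<tau>" "0 \<turnstile>\<^sub>u confine \<tau>"
  by (induction \<tau>) auto

lemma protect_closed [simp]:
  "n \<turnstile>\<^sub>u protect \<tau>" "usubst k s (protect \<tau>) = protect \<tau>" "ulift k (protect \<tau>) = protect \<tau>"
  using uscoped_protect_confine by auto

lemma confine_closed [simp]:
  "n \<turnstile>\<^sub>u confine \<tau>" "usubst k s (confine \<tau>) = confine \<tau>" "ulift k (confine \<tau>) = confine \<tau>"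
  using uscoped_protect_confine by auto

lemma uval_protect_confine [simp]: "uval (protect \<tau>)" "uval (confine \<tau>)"
  by (cases \<tau>; simp)+

lemmas ureduces_beta = uhead_intros(1)[THEN uhead_ureduces]

text \<open>The component wrappers are arbitrary, so that \<open>protect\<close> and
  \<open>confine\<close> are both instances. The administrative reductions happen in the target
  alone and leave the index as it is.\<close>

lemma prel_wrap:
  assumes "uval p1" "0 \<turnstile>\<^sub>u p1" "uval p2" "0 \<turnstile>\<^sub>u p2" "value_rel A" "value_rel B"
    and p1: "\<And>v u. A w v u \<Longrightarrow> erel d A w v (UApp p1 u)"
    and p2: "\<And>v u. B w v u \<Longrightarrow> erel d B w v (UApp p2 u)"
    and vu: "prel A B w v u"
  shows "erel d (prel A B) w v
    (UApp (ULam (UPair (UApp p1 (UFst (UVar 0))) (UApp p2 (USnd (UVar 0))))) u)"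
proof -
  obtain v1 v2 u1 u2 where *: "v = SPair v1 v2" "u = UPair u1 u2" "A w v1 u1" "B w v2 u2"
    using vu unfolding prel_def by blast
  have vals: "uval u1" "uval u2" "0 \<turnstile>\<^sub>u u1" "0 \<turnstile>\<^sub>u u2"
    using value_relD[OF assms(5) *(3)] value_relD[OF assms(6) *(4)] by auto
  have 1: "erel d A w v1 (UApp p1 (UFst u))"
    unfolding *(2)
    by (rule erel_ureduces[OF assms(5) ureduces_uframe[OF uframe_intros(2)
        uhead_ureduces[OF uhead_intros(2)]]])
      (use assms vals p1 * in auto)
  have 2: "erel d B w v2 (UApp p2 (USnd u))"
    unfolding *(2)
    by (rule erel_ureduces[OF assms(6) ureduces_uframe[OF uframe_intros(2)
        uhead_ureduces[OF uhead_intros(3)]]])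
      (use assms vals p2 * in auto)
  show ?thesis
    by (rule erel_ureduces[OF _ ureduces_beta])
      (use assms vals * erel_pair[OF assms(6,5) 1 2] in auto)
qed

lemma srel_wrap:
  assumes "uval p1" "0 \<turnstile>\<^sub>u p1" "uval p2" "0 \<turnstile>\<^sub>u p2" "value_rel A" "value_rel B"
    and p1: "\<And>v u. A w v u \<Longrightarrow> erel d A w v (UApp p1 u)"
    and p2: "\<And>v u. B w v u \<Longrightarrow> erel d B w v (UApp p2 u)"
    and vu: "srel A B w v u"
  shows "erel d (srel A B) w v
    (UApp (ULam (UCase (UVar 0) (UInl (UApp p1 (UVar 0))) (UInr (UApp p2 (UVar 0))))) u)"
proof -
  let ?c = "\<lambda>u. UCase u (UInl (UApp p1 (UVar 0))) (UInr (UApp p2 (UVar 0)))"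
  have R: "value_rel (srel A B)"
    using assms by blast
  have "uval u"
    by (rule value_relD(2)[OF R vu])
  have "erel d (srel A B) w v (?c u)"
    using vu unfolding srel_def[of A B w]
  proof (elim disjE exE conjE)
    fix v' u'
    assume *: "v = SInl v'" "u = UInl u'" "A w v' u'"
    show ?thesis
      unfolding *(2)
      by (rule erel_ureduces[OF R uhead_ureduces[OF uhead_intros(4)]])
        (use assms * erel_inl[OF p1[OF *(3)]] value_relD(2)[OF assms(5) *(3)] in auto)
  next
    fix v' u'
    assume *: "v = SInr v'" "u = UInr u'" "B w v' u'"
    show ?thesis
      unfolding *(2)
      by (rule erel_ureduces[OF R uhead_ureduces[OF uhead_intros(5)]])
        (use assms * erel_inr[OF p2[OF *(3)]] value_relD(2)[OF assms(6) *(3)] in auto)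
  qed
  then show ?thesis
    by (intro erel_ureduces[OF R ureduces_beta]) (use assms \<open>uval u\<close> in auto)
qed

lemma frel_wrap:
  assumes "uval p1" "0 \<turnstile>\<^sub>u p1" "uval p2" "0 \<turnstile>\<^sub>u p2" "value_rel A" "value_rel B"
    and p1: "\<And>w v u. A w v u \<Longrightarrow> erel d A w v (UApp p1 u)"
    and p2: "\<And>w v u. B w v u \<Longrightarrow> erel d B w v (UApp p2 u)"
    and vu: "frel d \<tau> A B w v u"
  shows "erel d (frel d \<tau> A B) w v
    (UApp (ULam (ULam (UApp p2 (UApp (UVar 1) (UApp p1 (UVar 0)))))) u)"
proof -
  obtain s t where *: "v = SLam \<tau> s" "u = ULam t" "sscoped 1 s" "1 \<turnstile>\<^sub>u t"
    and st: "\<And>w' v' u'. w' < w \<Longrightarrow> A w' v' u' \<Longrightarrow> erel d B w' (ssubst 0 v' s) (usubst 0 u' t)"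
    using vu unfolding frel_def by blast
  have u: "uval u" "0 \<turnstile>\<^sub>u u"
    using * by simp_all
  have "erel d B w' (ssubst 0 v' s) (UApp p2 (UApp u (UApp p1 u')))"
    if w': "w' < w" and vu': "A w' v' u'" for w' v' u'
  \<comment> \<open>The source has already received \<open>v'\<close>, while the target must still
    run \<open>p1 u'\<close> before calling \<open>u\<close>.\<close>
  proof (rule erel_bind_target[where L = "\<lambda>x. UApp p2 (UApp u x)", OF _ p1[OF vu']])
    fix w2 u2
    assume 2: "w2 \<le> w'" "uval u2" "A w2 v' u2"
    have "erel d B w2 (ssubst 0 v' s) (UApp u u2)"
      unfolding *(2)
      by (rule erel_ureduces[OF assms(6) ureduces_beta]) (use 2 w' in \<open>auto intro: st\<close>)
    then show "erel d B w2 (ssubst 0 v' s) (UApp p2 (UApp u u2))"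
      by (rule erel_bind[OF sframe_id uframe_intros(2)[OF assms(3)]]) (rule p2)
  qed (use uframe_comp[OF uframe_intros(2)[OF assms(3)] uframe_intros(2)[OF u(1)]]
      value_relD[OF assms(5) vu'] in auto)
  then have "frel d \<tau> A B w v (ULam (UApp p2 (UApp u (UApp p1 (UVar 0)))))"
    using *(1,3) assms(2,4) u unfolding frel_def by simp
  then show ?thesis
    by (intro erel_ureduces[OF value_rel_frel ureduces_beta] erel_value) (use assms u *(1) in auto)
qed

text \<open>On values that behave according to their type every dynamic check succeeds, so the
  wrappers act as identities. One induction proves both claims because the domain of a function type
  exchanges \<open>protect\<close> and \<open>confine\<close>.\<close>

lemma vrel_protect_confine:
  "vrel \<tau> d w v u \<Longrightarrow> erel d (vrel \<tau> d) w v (UApp (protect \<tau>) u)"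
  "vrel \<tau> d w v u \<Longrightarrow> erel d (vrel \<tau> d) w v (UApp (confine \<tau>) u)"
proof (induction \<tau> arbitrary: w v u)
  case TUnit
  have "ureduces (UApp (protect TUnit) UUnit) UUnit"
    using ureduces_beta[of UUnit "UVar 0"] by simp
  moreover have "ureduces (UApp (confine TUnit) UUnit) UUnit"
    using ureduces_trans[OF ureduces_beta[of UUnit "USeq (UVar 0) UUnit"], of UUnit]
      uhead_ureduces[OF uhead_intros(6)[of UUnit]] by simp
  ultimately have *: "erel d (vrel TUnit d) w v (UApp (protect TUnit) u) \<and>
      erel d (vrel TUnit d) w v (UApp (confine TUnit) u)" if "vrel TUnit d w v u" for w v u
    using that erel_ureduces[OF value_rel_vrel _ erel_value[of v u "vrel TUnit d" w d]]
      value_relD(1,2)[OF value_rel_vrel that] unfolding vrel.simps(1) unitrel_def by blast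
  {
    case 1
    with * show ?case by blast
  next
    case 2
    with * show ?case by blast
  }
next
  case TBool
  have "ureduces (UApp (protect TBool) u) u" if "uval u" for u
    using ureduces_beta[OF that, of "UVar 0"] by simp
  moreover have "ureduces (UApp (confine TBool) UTrue) UTrue"
    using ureduces_trans[OF ureduces_beta[of UTrue "UIf (UVar 0) UTrue UFalse"], of UTrue]
      uhead_ureduces[OF uhead_intros(7)[of UTrue UFalse]] by simp
  moreover have "ureduces (UApp (confine TBool) UFalse) UFalse"
    using ureduces_trans[OF ureduces_beta[of UFalse "UIf (UVar 0) UTrue UFalse"], of UFalse]
      uhead_ureduces[OF uhead_intros(8)[of UTrue UFalse]] by simp
  ultimately have red: "ureduces (UApp (protect TBool) u) u" "ureduces (UApp (confine TBool) u) u"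
    if "vrel TBool d w v u" for w v u
    using that by (auto simp: boolrel_def)
  have *: "erel d (vrel TBool d) w v (UApp (protect TBool) u) \<and>
      erel d (vrel TBool d) w v (UApp (confine TBool) u)" if "vrel TBool d w v u" for w v u
    using red[OF that] erel_ureduces[OF value_rel_vrel] value_relD(1,2)[OF value_rel_vrel that]
      erel_value[of v u "vrel TBool d" w d] that by blast
  {
    case 1
    with * show ?case by blast
  next
    case 2
    with * show ?case by blast
  }
next
  case (TFun \<tau>1 \<tau>2)
  {
    case 1
    then show ?case
      using frel_wrap[of "confine \<tau>1" "protect \<tau>2" "vrel \<tau>1 d" "vrel \<tau>2 d" d] TFun by simp
  next
    case 2
    then show ?case
      using frel_wrap[of "protect \<tau>1" "confine \<tau>2" "vrel \<tau>1 d" "vrel \<tau>2 d" d] TFun by simp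
  }
next
  case (TProd \<tau>1 \<tau>2)
  {
    case 1
    then show ?case
      using prel_wrap[of "protect \<tau>1" "protect \<tau>2" "vrel \<tau>1 d" "vrel \<tau>2 d" w d] TProd by simp
  next
    case 2
    then show ?case
      using prel_wrap[of "confine \<tau>1" "confine \<tau>2" "vrel \<tau>1 d" "vrel \<tau>2 d" w d] TProd by simp
  }
next
  case (TSum \<tau>1 \<tau>2)
  {
    case 1
    then show ?case
      using srel_wrap[of "protect \<tau>1" "protect \<tau>2" "vrel \<tau>1 d" "vrel \<tau>2 d" w d] TSum by simp
  next
    case 2
    then show ?case
      using srel_wrap[of "confine \<tau>1" "confine \<tau>2" "vrel \<tau>1 d" "vrel \<tau>2 d" w d] TSum by simp
  }
qed

lemma erel_compile:
  assumes "[] \<turnstile>\<^sub>s t \<Colon> \<tau>"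
  shows "erel d (vrel \<tau> d) w t (compile \<tau> t)"
  unfolding compile_def
  by (rule erel_bind[OF sframe_id uframe_intros(2) erel_erase_closed[OF assms]])
    (auto intro: vrel_protect_confine)


section \<open>Reflection of equivalence\<close>

lemma vrel_app:
  "erel d (vrel (TFun \<tau>1 \<tau>2) d) w s1 t1 \<Longrightarrow> erel d (vrel \<tau>1 d) w s2 t2 \<Longrightarrow>
    erel d (vrel \<tau>2 d) w (SApp s1 s2) (UApp t1 t2)"
  by (auto intro: erel_app[OF value_rel_vrel[of \<tau>1 d]])

lemma vrel_fst: "erel d (vrel (TProd \<tau>1 \<tau>2) d) w s t \<Longrightarrow> erel d (vrel \<tau>1 d) w (SFst s) (UFst t)"
  by (auto intro: erel_fst erel_prel_later(1)[of "vrel \<tau>1 d" "vrel \<tau>2 d"])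

lemma vrel_snd: "erel d (vrel (TProd \<tau>1 \<tau>2) d) w s t \<Longrightarrow> erel d (vrel \<tau>2 d) w (SSnd s) (USnd t)"
  by (auto intro: erel_snd erel_prel_later(2)[of "vrel \<tau>1 d" "vrel \<tau>2 d"])

lemma vrel_pair:
  "erel d (vrel \<tau>1 d) w s1 t1 \<Longrightarrow> erel d (vrel \<tau>2 d) w s2 t2 \<Longrightarrow>
    erel d (vrel (TProd \<tau>1 \<tau>2) d) w (SPair s1 s2) (UPair t1 t2)"
  by (simp add: erel_pair)

lemma vrel_inl: "erel d (vrel \<tau>1 d) w s t \<Longrightarrow> erel d (vrel (TSum \<tau>1 \<tau>2) d) w (SInl s) (UInl t)"
  by (simp add: erel_inl)

lemma vrel_inr: "erel d (vrel \<tau>2 d) w s t \<Longrightarrow> erel d (vrel (TSum \<tau>1 \<tau>2) d) w (SInr s) (UInr t)"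
  by (simp add: erel_inr)

lemma vrel_case:
  assumes "erel d (vrel (TSum \<tau>1 \<tau>2) d) w s t"
    and "\<And>w' v u. vrel \<tau>1 d w' v u \<Longrightarrow> erel d (vrel \<tau> d) w' (ssubst 0 v s1) (usubst 0 u t1)"
    and "\<And>w' v u. vrel \<tau>2 d w' v u \<Longrightarrow> erel d (vrel \<tau> d) w' (ssubst 0 v s2) (usubst 0 u t2)"
  shows "erel d (vrel \<tau> d) w (SCase s s1 s2) (UCase t t1 t2)"
  using assms by (auto intro!: erel_case[of "vrel \<tau>1 d" "vrel \<tau>2 d"] erel_srel_later)

lemma vrel_seq:
  "erel d (vrel TUnit d) w s t \<Longrightarrow> erel d (vrel \<tau> d) w s2 t2 \<Longrightarrow>
    erel d (vrel \<tau> d) w (SSeq s s2) (USeq t t2)"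
  by (simp add: erel_seq)

lemma vrel_if:
  "erel d (vrel TBool d) w s t \<Longrightarrow> erel d (vrel \<tau> d) w s1 t1 \<Longrightarrow> erel d (vrel \<tau> d) w s2 t2 \<Longrightarrow>
    erel d (vrel \<tau> d) w (SIf s s1 s2) (UIf t t1 t2)"
  by (simp add: erel_if)

lemma vrel_fix:
  "erel d (vrel (TFun (TFun \<tau>1 \<tau>2) (TFun \<tau>1 \<tau>2)) d) w s t \<Longrightarrow>
    erel d (vrel (TFun \<tau>1 \<tau>2) d) w (SFix \<tau>1 \<tau>2 s) (UApp ufix t)"
  by (simp add: erel_fix)

lemma sctx_typing_length: "(\<turnstile>\<^sub>s C : \<Gamma>', \<tau>' \<rightarrow> \<Gamma>, \<tau>) \<Longrightarrow> length \<Gamma> \<le> length \<Gamma>'"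
  by (induction rule: sctx_typing.induct) auto

text \<open>A context with a closed hole and a closed result never has its hole below a binder, hence the
  relation on closed terms suffices.\<close>

lemma uscoped_ufix: "0 \<turnstile>\<^sub>u ufix"
  by (simp add: ufix_def)

text \<open>\<open>U\<close> is the erasure of \<open>C\<close>, built along the typing derivation.
  It is chosen before direction, index and terms, so a single target context observes both terms in
  both directions.\<close>

lemma erase_context:
  assumes "\<turnstile>\<^sub>s C : [], \<tau>' \<rightarrow> [], \<tau>"
  obtains U where "\<turnstile>\<^sub>u U : 0 \<rightarrow> 0"
    and "\<And>d w s t. erel d (vrel \<tau>' d) w s t \<Longrightarrow> erel d (vrel \<tau> d) w (splug C s) (uplug U t)"
proof -
  have "\<exists>U. (\<turnstile>\<^sub>u U : 0 \<rightarrow> 0) \<and>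
      (\<forall>d w s t. erel d (vrel \<tau>' d) w s t \<longrightarrow> erel d (vrel \<tau> d) w (splug C s) (uplug U t))"
    if "\<turnstile>\<^sub>s C : \<Gamma>', \<tau>' \<rightarrow> \<Gamma>, \<tau>" "\<Gamma>' = []" "\<Gamma> = []" for \<Gamma>' \<Gamma>
    using that
  proof (induction rule: sctx_typing.induct)
    case (1 \<Gamma>' \<tau>')
    then show ?case
      by (intro exI[of _ UHole]) (simp add: uctx_scoped.intros)
  next
    case (2 C \<Gamma>' \<tau>' \<tau>1 \<Gamma> \<tau>2)
    \<comment> \<open>The environment under the binder is nonempty, but no environment within the
      context is longer than that of its hole, which is empty.\<close>
    then show ?case
      using sctx_typing_length by fastforce
  next
    case (3 C \<Gamma>' \<tau>' \<Gamma> \<tau>1 \<tau>2 t2)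
    then obtain U where U: "\<turnstile>\<^sub>u U : 0 \<rightarrow> 0"
      "\<And>d w s t. erel d (vrel \<tau>' d) w s t \<Longrightarrow> erel d (vrel (TFun \<tau>1 \<tau>2) d) w (splug C s) (uplug U t)"
      by (auto simp del: vrel.simps)
    then show ?case
      using 3 uscoped_erase[OF styping_sscoped[OF 3(2)]]
      by (intro exI[of _ "UCApp1 U (erase t2)"])
        (auto intro!: uctx_scoped.intros vrel_app[OF U(2)] erel_erase_closed simp del: vrel.simps)
  next
    case (4 \<Gamma> t1 \<tau>1 \<tau>2 C \<Gamma>' \<tau>')
    then obtain U where U: "\<turnstile>\<^sub>u U : 0 \<rightarrow> 0"
      "\<And>d w s t. erel d (vrel \<tau>' d) w s t \<Longrightarrow> erel d (vrel \<tau>1 d) w (splug C s) (uplug U t)"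
      by (auto simp del: vrel.simps)
    then show ?case
      using 4 uscoped_erase[OF styping_sscoped[OF 4(1)]]
      by (intro exI[of _ "UCApp2 (erase t1) U"])
        (auto intro!: uctx_scoped.intros vrel_app[OF erel_erase_closed U(2)] erel_erase_closed
            simp del: vrel.simps)
  next
    case (5 C \<Gamma>' \<tau>' \<Gamma> \<tau>1 \<tau>2)
    then obtain U where U: "\<turnstile>\<^sub>u U : 0 \<rightarrow> 0"
      "\<And>d w s t. erel d (vrel \<tau>' d) w s t \<Longrightarrow> erel d (vrel (TProd \<tau>1 \<tau>2) d) w (splug C s) (uplug U t)"
      by (auto simp del: vrel.simps)
    then show ?case
      by (intro exI[of _ "UCFst U"])
        (auto intro!: uctx_scoped.intros vrel_fst[OF U(2)] simp del: vrel.simps)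
  next
    case (6 C \<Gamma>' \<tau>' \<Gamma> \<tau>1 \<tau>2)
    then obtain U where U: "\<turnstile>\<^sub>u U : 0 \<rightarrow> 0"
      "\<And>d w s t. erel d (vrel \<tau>' d) w s t \<Longrightarrow> erel d (vrel (TProd \<tau>1 \<tau>2) d) w (splug C s) (uplug U t)"
      by (auto simp del: vrel.simps)
    then show ?case
      by (intro exI[of _ "UCSnd U"])
        (auto intro!: uctx_scoped.intros vrel_snd[OF U(2)] simp del: vrel.simps)
  next
    case (7 C \<Gamma>' \<tau>' \<Gamma> \<tau>1 t2 \<tau>2)
    then obtain U where U: "\<turnstile>\<^sub>u U : 0 \<rightarrow> 0"
      "\<And>d w s t. erel d (vrel \<tau>' d) w s t \<Longrightarrow> erel d (vrel \<tau>1 d) w (splug C s) (uplug U t)"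
      by (auto simp del: vrel.simps)
    then show ?case
      using 7 uscoped_erase[OF styping_sscoped[OF 7(2)]]
      by (intro exI[of _ "UCPair1 U (erase t2)"])
        (auto intro!: uctx_scoped.intros vrel_pair[OF U(2)] erel_erase_closed simp del: vrel.simps)
  next
    case (8 \<Gamma> t1 \<tau>1 C \<Gamma>' \<tau>' \<tau>2)
    then obtain U where U: "\<turnstile>\<^sub>u U : 0 \<rightarrow> 0"
      "\<And>d w s t. erel d (vrel \<tau>' d) w s t \<Longrightarrow> erel d (vrel \<tau>2 d) w (splug C s) (uplug U t)"
      by (auto simp del: vrel.simps)
    then show ?case
      using 8 uscoped_erase[OF styping_sscoped[OF 8(1)]]
      by (intro exI[of _ "UCPair2 (erase t1) U"])
        (auto intro!: uctx_scoped.intros vrel_pair[OF _ U(2)] erel_erase_closed simp del: vrel.simps)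
  next
    case (9 C \<Gamma>' \<tau>' \<Gamma> \<tau>1 \<tau>2)
    then obtain U where U: "\<turnstile>\<^sub>u U : 0 \<rightarrow> 0"
      "\<And>d w s t. erel d (vrel \<tau>' d) w s t \<Longrightarrow> erel d (vrel \<tau>1 d) w (splug C s) (uplug U t)"
      by (auto simp del: vrel.simps)
    then show ?case
      by (intro exI[of _ "UCInl U"])
        (auto intro!: uctx_scoped.intros vrel_inl[OF U(2)] simp del: vrel.simps)
  next
    case (10 C \<Gamma>' \<tau>' \<Gamma> \<tau>2 \<tau>1)
    then obtain U where U: "\<turnstile>\<^sub>u U : 0 \<rightarrow> 0"
      "\<And>d w s t. erel d (vrel \<tau>' d) w s t \<Longrightarrow> erel d (vrel \<tau>2 d) w (splug C s) (uplug U t)"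
      by (auto simp del: vrel.simps)
    then show ?case
      by (intro exI[of _ "UCInr U"])
        (auto intro!: uctx_scoped.intros vrel_inr[OF U(2)] simp del: vrel.simps)
  next
    case (11 C \<Gamma>' \<tau>' \<Gamma> \<tau>1 \<tau>2 t2 \<tau> t3)
    then obtain U where U: "\<turnstile>\<^sub>u U : 0 \<rightarrow> 0"
      "\<And>d w s t. erel d (vrel \<tau>' d) w s t \<Longrightarrow> erel d (vrel (TSum \<tau>1 \<tau>2) d) w (splug C s) (uplug U t)"
      by (auto simp del: vrel.simps)
    then show ?case
      using 11 uscoped_erase[OF styping_sscoped[OF 11(2)]] uscoped_erase[OF styping_sscoped[OF 11(3)]]
      by (intro exI[of _ "UCCase1 U (erase t2) (erase t3)"])
        (auto intro!: uctx_scoped.intros vrel_case[OF U(2)] erel_erase_body simp del: vrel.simps)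
  next
    case (12 \<Gamma> t1 \<tau>1 \<tau>2 C \<Gamma>' \<tau>' \<tau> t3)
    then show ?case
      using sctx_typing_length by fastforce
  next
    case (13 \<Gamma> t1 \<tau>1 \<tau>2 t2 \<tau> C \<Gamma>' \<tau>')
    then show ?case
      using sctx_typing_length by fastforce
  next
    case (14 C \<Gamma>' \<tau>' \<Gamma> t2 \<tau>)
    then obtain U where U: "\<turnstile>\<^sub>u U : 0 \<rightarrow> 0"
      "\<And>d w s t. erel d (vrel \<tau>' d) w s t \<Longrightarrow> erel d (vrel TUnit d) w (splug C s) (uplug U t)"
      by (auto simp del: vrel.simps)
    then show ?case
      using 14 uscoped_erase[OF styping_sscoped[OF 14(2)]]
      by (intro exI[of _ "UCSeq1 U (erase t2)"])
        (auto intro!: uctx_scoped.intros vrel_seq[OF U(2)] erel_erase_closed simp del: vrel.simps)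
  next
    case (15 \<Gamma> t1 C \<Gamma>' \<tau>' \<tau>)
    then obtain U where U: "\<turnstile>\<^sub>u U : 0 \<rightarrow> 0"
      "\<And>d w s t. erel d (vrel \<tau>' d) w s t \<Longrightarrow> erel d (vrel \<tau> d) w (splug C s) (uplug U t)"
      by (auto simp del: vrel.simps)
    then show ?case
      using 15 uscoped_erase[OF styping_sscoped[OF 15(1)]]
      by (intro exI[of _ "UCSeq2 (erase t1) U"])
        (auto intro!: uctx_scoped.intros vrel_seq[OF _ U(2)] erel_erase_closed simp del: vrel.simps)
  next
    case (16 C \<Gamma>' \<tau>' \<Gamma> t2 \<tau> t3)
    then obtain U where U: "\<turnstile>\<^sub>u U : 0 \<rightarrow> 0"
      "\<And>d w s t. erel d (vrel \<tau>' d) w s t \<Longrightarrow> erel d (vrel TBool d) w (splug C s) (uplug U t)"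
      by (auto simp del: vrel.simps)
    then show ?case
      using 16 uscoped_erase[OF styping_sscoped[OF 16(2)]]
        uscoped_erase[OF styping_sscoped[OF 16(3)]]
      by (intro exI[of _ "UCIf1 U (erase t2) (erase t3)"])
        (auto intro!: uctx_scoped.intros vrel_if[OF U(2)] erel_erase_closed simp del: vrel.simps)
  next
    case (17 \<Gamma> t1 C \<Gamma>' \<tau>' \<tau> t3)
    then obtain U where U: "\<turnstile>\<^sub>u U : 0 \<rightarrow> 0"
      "\<And>d w s t. erel d (vrel \<tau>' d) w s t \<Longrightarrow> erel d (vrel \<tau> d) w (splug C s) (uplug U t)"
      by (auto simp del: vrel.simps)
    then show ?case
      using 17 uscoped_erase[OF styping_sscoped[OF 17(1)]]
        uscoped_erase[OF styping_sscoped[OF 17(3)]]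
      by (intro exI[of _ "UCIf2 (erase t1) U (erase t3)"])
        (auto intro!: uctx_scoped.intros vrel_if[OF _ U(2)] erel_erase_closed simp del: vrel.simps)
  next
    case (18 \<Gamma> t1 t2 \<tau> C \<Gamma>' \<tau>')
    then obtain U where U: "\<turnstile>\<^sub>u U : 0 \<rightarrow> 0"
      "\<And>d w s t. erel d (vrel \<tau>' d) w s t \<Longrightarrow> erel d (vrel \<tau> d) w (splug C s) (uplug U t)"
      by (auto simp del: vrel.simps)
    then show ?case
      using 18 uscoped_erase[OF styping_sscoped[OF 18(1)]]
        uscoped_erase[OF styping_sscoped[OF 18(2)]]
      by (intro exI[of _ "UCIf3 (erase t1) (erase t2) U"])
        (auto intro!: uctx_scoped.intros vrel_if[OF _ _ U(2)] erel_erase_closed simp del: vrel.simps)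
  next
    case (19 C \<Gamma>' \<tau>' \<Gamma> \<tau>1 \<tau>2)
    then obtain U where U: "\<turnstile>\<^sub>u U : 0 \<rightarrow> 0"
      "\<And>d w s t. erel d (vrel \<tau>' d) w s t \<Longrightarrow>
        erel d (vrel (TFun (TFun \<tau>1 \<tau>2) (TFun \<tau>1 \<tau>2)) d) w (splug C s) (uplug U t)"
      by (auto simp del: vrel.simps)
    then show ?case
      by (intro exI[of _ "UCApp2 ufix U"])
        (auto intro!: uctx_scoped.intros vrel_fix[OF U(2)]
          simp: uscoped_ufix simp del: vrel.simps)
  qed
  from this[OF assms] show thesis
    using that by blast
qed

text \<open>The fuel that the given run of \<open>s\<close> consumes is not known in advance, which
  is why relatedness is assumed at every index.\<close>

lemma erel_Fwd_converges:
  assumes "\<And>w. erel Fwd R w s t" "s \<Down>\<^sub>s"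
  shows "t \<Down>\<^sub>u"
  using assms by (fastforce simp: sconverges_iff uconverges_iff sevals_def)

lemma erel_Bwd_converges:
  assumes "\<And>w. erel Bwd R w s t" "t \<Down>\<^sub>u"
  shows "s \<Down>\<^sub>s"
  using assms by (fastforce simp: sconverges_iff uconverges_iff uevals_def)

theorem compile_reflects:
  assumes t: "[] \<turnstile>\<^sub>s t1 \<Colon> \<tau>" "[] \<turnstile>\<^sub>s t2 \<Colon> \<tau>"
    and equiv: "0 \<turnstile>\<^sub>u compile \<tau> t1 \<simeq>\<^sub>c\<^sub>t\<^sub>x compile \<tau> t2"
  shows "[] \<turnstile>\<^sub>s t1 \<simeq>\<^sub>c\<^sub>t\<^sub>x t2 \<Colon> \<tau>"
  unfolding sctx_equiv_def
proof (intro allI impI)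
  fix \<tau>' C
  assume "\<turnstile>\<^sub>s C : [], \<tau> \<rightarrow> [], \<tau>'"
  then obtain U where U: "\<turnstile>\<^sub>u U : 0 \<rightarrow> 0"
    and rel: "\<And>d w s t. erel d (vrel \<tau> d) w s t \<Longrightarrow> erel d (vrel \<tau>' d) w (splug C s) (uplug U t)"
    by (rule erase_context) blast
  have "(splug C t \<Down>\<^sub>s) \<longleftrightarrow> (uplug U (compile \<tau> t) \<Down>\<^sub>u)" if "[] \<turnstile>\<^sub>s t \<Colon> \<tau>" for t
    using rel[OF erel_compile[OF that]] erel_Fwd_converges erel_Bwd_converges by blast
  moreover have "(uplug U (compile \<tau> t1) \<Down>\<^sub>u) \<longleftrightarrow> (uplug U (compile \<tau> t2) \<Down>\<^sub>u)"
    using equiv U unfolding uctx_equiv_def by blast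
  ultimately show "(splug C t1 \<Down>\<^sub>s) \<longleftrightarrow> (splug C t2 \<Down>\<^sub>s)"
    using t by simp
qed


section \<open>Approximations of the universal type\<close>

lemma sreduces_step: "shead s s' \<Longrightarrow> sreduces s' s'' \<Longrightarrow> sreduces s s''"
  by (rule sreduces_trans[OF shead_sreduces])

text \<open>The fixed point of the identity at a function type, applied to unit: a divergent
  inhabitant of every type. In back-translations it takes the part of target failure.\<close>

definition omega :: "ty \<Rightarrow> strm" where
  "omega \<tau> = SApp (SFix TUnit \<tau> (SLam (TFun TUnit \<tau>) (SVar 0))) SUnit"

text \<open>Unfolding the fixed point and applying it leads back to \<open>omega\<close> with two
  units of fuel fewer, so no finite budget suffices.\<close>

lemma not_sev_omega [simp]: "\<not> sev (omega \<tau>) k k' r"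
proof (induction k arbitrary: k' rule: less_induct)
  case (less k)
  define F where "F = SFix TUnit \<tau> (SLam (TFun TUnit \<tau>) (SVar 0))"
  define G where "G = SLam TUnit (SApp F (SVar 0))"
  have F: "shead F G"
    using sred_shead[OF sred.intros(9)[of TUnit \<tau> "SVar 0"]] by (simp add: F_def G_def)
  have G: "shead (SApp G SUnit) (omega \<tau>)"
    using shead_intros(1)[of SUnit TUnit "SApp F (SVar 0)"] by (simp add: F_def G_def omega_def)
  show ?case
  proof
    assume "sev (omega \<tau>) k k' r"
    then obtain k1 v where "sev F k k1 v" and v: "sev (SApp v SUnit) k1 k' r"
      using sframe_intros(1)[of SUnit] unfolding omega_def F_def sframe_def by blast
    then have "k = Suc k1" "v = G"
      using F unfolding shead_def by (auto simp: G_def)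
    then obtain j where "k1 = Suc j" "sev (omega \<tau>) j k' r"
      using G v unfolding shead_def by blast
    with \<open>k = Suc k1\<close> show False
      using less[of j] by simp
  qed
qed

lemma omega_closed [simp]:
  "sscoped 0 (omega \<tau>)" "slift k (omega \<tau>) = omega \<tau>" "ssubst k s (omega \<tau>) = omega \<tau>"
  by (simp_all add: omega_def)

lemma styping_omega: "\<Gamma> \<turnstile>\<^sub>s omega \<tau> \<Colon> \<tau>"
  unfolding omega_def by (rule styping.intros | simp)+

text \<open>The left summand collects the cases without components: unknown, unit and boolean. It is
  the same at all positive levels, so conversions copy it whole. Level \<open>0\<close> consists of
  the unknown value alone.\<close>

primrec uvalty :: "nat \<Rightarrow> ty" where
  "uvalty 0 = TUnit"
| "uvalty (Suc n) =
     TSum (TSum TUnit (TSum TUnit TBool))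
       (TSum (TProd (uvalty n) (uvalty n))
         (TSum (TSum (uvalty n) (uvalty n)) (TFun (uvalty n) (uvalty n))))"

abbreviation (input) in_unk :: strm where "in_unk \<equiv> SInl (SInl SUnit)"
abbreviation (input) in_unit :: "strm \<Rightarrow> strm" where "in_unit t \<equiv> SInl (SInr (SInl t))"
abbreviation (input) in_bool :: "strm \<Rightarrow> strm" where "in_bool t \<equiv> SInl (SInr (SInr t))"
abbreviation (input) in_prod :: "strm \<Rightarrow> strm" where "in_prod t \<equiv> SInr (SInl t)"
abbreviation (input) in_sum :: "strm \<Rightarrow> strm" where "in_sum t \<equiv> SInr (SInr (SInl t))"
abbreviation (input) in_fun :: "strm \<Rightarrow> strm" where "in_fun t \<equiv> SInr (SInr (SInr t))"

text \<open>\<open>in_unk\<close> stands for a value about which all precision is lost. Forwards it may represent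
  anything, as inspecting it diverges; backwards it may only do so when no fuel is left.\<close>

primrec drel :: "nat \<Rightarrow> direction \<Rightarrow> world_rel" where
  "drel 0 d = (\<lambda>w v u. v = SUnit \<and> uval u \<and> (0 \<turnstile>\<^sub>u u) \<and> (d = Fwd \<or> w = 0))"
| "drel (Suc n) d = (\<lambda>w v u.
     v = in_unk \<and> uval u \<and> (0 \<turnstile>\<^sub>u u) \<and> (d = Fwd \<or> w = 0) \<or>
     (\<exists>v'. v = in_unit v' \<and> unitrel w v' u) \<or>
     (\<exists>v'. v = in_bool v' \<and> boolrel w v' u) \<or>
     (\<exists>v'. v = in_prod v' \<and> prel (later d (drel n d)) (later d (drel n d)) w v' u) \<or>
     (\<exists>v'. v = in_sum v' \<and> srel (later d (drel n d)) (later d (drel n d)) w v' u) \<or>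
     (\<exists>v'. v = in_fun v' \<and> frel d (uvalty n) (drel n d) (drel n d) w v' u))"

lemma drel_cases [consumes 1, case_names unk unit bool prod sum func]:
  assumes "drel (Suc n) d w v u"
  obtains "v = in_unk" "d = Fwd \<or> w = 0"
    | v' where "v = in_unit v'" "unitrel w v' u"
    | v' where "v = in_bool v'" "boolrel w v' u"
    | v' where "v = in_prod v'" "prel (later d (drel n d)) (later d (drel n d)) w v' u"
    | v' where "v = in_sum v'" "srel (later d (drel n d)) (later d (drel n d)) w v' u"
    | v' where "v = in_fun v'" "frel d (uvalty n) (drel n d) (drel n d) w v' u"
  using assms unfolding drel.simps(2) by (elim disjE exE conjE) auto

lemma value_rel_ex:
  "value_rel R \<Longrightarrow> (\<And>v. sval v \<Longrightarrow> sval (i v)) \<Longrightarrow> (\<And>v. sscoped 0 v \<Longrightarrow> sscoped 0 (i v)) \<Longrightarrow>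
    value_rel (\<lambda>w v u. \<exists>v'. v = i v' \<and> R w v' u)"
  unfolding value_rel_def by blast

lemma value_rel_disj: "value_rel R \<Longrightarrow> value_rel S \<Longrightarrow> value_rel (\<lambda>w v u. R w v u \<or> S w v u)"
  unfolding value_rel_def by blast

lemma value_rel_drel [intro, simp]: "value_rel (drel n d)"
proof (induction n)
  case 0
  then show ?case
    unfolding value_rel_def by auto
next
  case (Suc n)
  show ?case
    unfolding drel.simps
    by (intro value_rel_disj value_rel_ex value_rel_unitrel value_rel_boolrel value_rel_prel
        value_rel_srel value_rel_frel value_rel_later Suc) (auto simp: value_rel_def)
qed

subsection \<open>Conversions between levels\<close>

text \<open>The functorial action of the universal type on the embedding \<open>e\<close> and the projection \<open>p\<close>
  (or the other way round) between its components.\<close>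

definition conv :: "nat \<Rightarrow> nat \<Rightarrow> strm \<Rightarrow> strm \<Rightarrow> strm" where
  "conv n m e p = SLam (uvalty (Suc n))
     (SCase (SVar 0) (SInl (SVar 0))
       (SCase (SVar 0) (in_prod (SPair (SApp e (SFst (SVar 0))) (SApp e (SSnd (SVar 0)))))
         (SCase (SVar 0)
           (in_sum (SCase (SVar 0) (SInl (SApp e (SVar 0))) (SInr (SApp e (SVar 0)))))
           (in_fun (SLam (uvalty m) (SApp e (SApp (SVar 1) (SApp p (SVar 0)))))))))"

text \<open>At level \<open>0\<close> both conversions can only answer with the unknown value. In
  the recursion, contravariance of function arguments makes each conversion call the other.\<close>

fun upgrade downgrade :: "nat \<Rightarrow> strm" where
  "upgrade 0 = SLam (uvalty 0) in_unk"
| "upgrade (Suc n) = conv n (Suc n) (upgrade n) (downgrade n)"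
| "downgrade 0 = SLam (uvalty (Suc 0)) SUnit"
| "downgrade (Suc n) = conv (Suc n) n (downgrade n) (upgrade n)"

lemma styping_conv:
  assumes "\<And>\<Gamma>. \<Gamma> \<turnstile>\<^sub>s e \<Colon> TFun (uvalty n) (uvalty m)" "\<And>\<Gamma>. \<Gamma> \<turnstile>\<^sub>s p \<Colon> TFun (uvalty m) (uvalty n)"
  shows "\<Gamma> \<turnstile>\<^sub>s conv n m e p \<Colon> TFun (uvalty (Suc n)) (uvalty (Suc m))"
  unfolding conv_def uvalty.simps
  by (rule styping.intros assms | simp)+

lemma styping_upgrade_downgrade:
  "\<Gamma> \<turnstile>\<^sub>s upgrade n \<Colon> TFun (uvalty n) (uvalty (Suc n))"
  "\<Gamma> \<turnstile>\<^sub>s downgrade n \<Colon> TFun (uvalty (Suc n)) (uvalty n)"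
proof (induction n arbitrary: \<Gamma>)
  case 0
  {
    case 1
    show ?case by (simp, (rule styping.intros | simp)+)
  next
    case 2
    show ?case by (simp, (rule styping.intros | simp)+)
  }
next
  case (Suc n)
  {
    case 1
    show ?case using styping_conv[OF Suc] by (simp only: upgrade.simps)
  next
    case 2
    show ?case using styping_conv[OF Suc(2,1)] by (simp only: downgrade.simps)
  }
qed

lemma sscoped_upgrade_downgrade: "sscoped 0 (upgrade n)" "sscoped 0 (downgrade n)"
  using styping_upgrade_downgrade[of "[]" n] styping_sscoped by fastforce+

lemma upgrade_closed [simp]:
  "sscoped k (upgrade n)" "slift k (upgrade n) = upgrade n" "ssubst k s (upgrade n) = upgrade n"
  "sclose k \<sigma> (upgrade n) = upgrade n"
  using sscoped_upgrade_downgrade by auto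

lemma downgrade_closed [simp]:
  "sscoped k (downgrade n)" "slift k (downgrade n) = downgrade n"
  "ssubst k s (downgrade n) = downgrade n" "sclose k \<sigma> (downgrade n) = downgrade n"
  using sscoped_upgrade_downgrade by auto

lemma sval_upgrade_downgrade [simp]: "sval (upgrade n)" "sval (downgrade n)"
  by (cases n; simp add: conv_def)+

text \<open>Backwards an approximation of level \<open>n\<close> is trustworthy for \<open>n\<close>
  steps only; forwards lost information shows as source divergence, which is harmless at any
  index.\<close>

definition precise :: "direction \<Rightarrow> nat \<Rightarrow> nat \<Rightarrow> bool" where
  "precise d w n \<longleftrightarrow> d = Fwd \<or> w \<le> n"

lemma precise_mono: "precise d w n \<Longrightarrow> w' \<le> w \<Longrightarrow> precise d w' n"
  unfolding precise_def by auto

text \<open>Mirror image of \<open>erel_bind_target\<close>: conversions are run by the source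
  alone, against a target that is already a value.\<close>

lemma erel_bind_source:
  assumes K: "sframe K" and su: "erel d R w s u" and u: "uval u"
    and v: "\<And>w' v. w' \<le> w \<Longrightarrow> sval v \<Longrightarrow> R w' v u \<Longrightarrow> erel d R' w' (K v) t"
  shows "erel d R' w (K s) t"
proof (cases d)
  case Fwd
  show ?thesis
    unfolding Fwd erel.simps
  proof (intro allI impI)
    fix w' r
    assume "sev (K s) w w' r"
    then obtain w1 v0 where *: "sev s w w1 v0" "sev (K v0) w1 w' r"
      using K unfolding sframe_def by blast
    then have "R w1 v0 u"
      using su u unfolding Fwd by auto
    from v[OF sev_le[OF *(1)] sev_sval[OF *(1)] this] *(2)
    show "\<exists>u. uevals t u \<and> R' w' r u"
      unfolding Fwd by auto
  qed
next
  case Bwd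
  then obtain v0 where "sevals s v0" "R w v0 u"
    using su u by auto
  then have "erel Bwd R' w (K v0) t" and "\<And>r. sevals (K v0) r \<Longrightarrow> sevals (K s) r"
    using v[OF order_refl sevals_sval] sevals_sframe[OF K] Bwd by blast+
  then show ?thesis
    unfolding Bwd erel.simps by meson
qed

lemma erel_wrap:
  "sframe i \<Longrightarrow> erel d R w s t \<Longrightarrow>
    (\<And>w v u. sval v \<Longrightarrow> R w v u \<Longrightarrow> sval (i v) \<and> R' w (i v) u) \<Longrightarrow> erel d R' w (i s) t"
  by (rule erel_bind[OF _ uframe_id, of i d R w s t R']) (auto intro: erel_value)

lemma sframe_injections:
  shows "sframe (\<lambda>x. in_prod x)" and "sframe (\<lambda>x. in_sum x)" and "sframe (\<lambda>x. in_fun x)"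
    and "sframe (\<lambda>x. in_unit x)" and "sframe (\<lambda>x. in_bool x)"
  by (rule sframe_comp[OF sframe_intros(8) sframe_intros(7)]
      sframe_comp[OF sframe_intros(8) sframe_comp[OF sframe_intros(8) sframe_intros(7)]]
      sframe_comp[OF sframe_intros(8) sframe_comp[OF sframe_intros(8) sframe_intros(8)]]
      sframe_comp[OF sframe_intros(7) sframe_comp[OF sframe_intros(8) sframe_intros(7)]]
      sframe_comp[OF sframe_intros(7) sframe_comp[OF sframe_intros(8) sframe_intros(8)]])+

lemma erel_in_prod:
  "erel d (prel (later d (drel n d)) (later d (drel n d))) w s t \<Longrightarrow>
    erel d (drel (Suc n) d) w (in_prod s) t"
  by (erule erel_wrap[OF sframe_injections(1)]) auto

lemma erel_in_sum:
  "erel d (srel (later d (drel n d)) (later d (drel n d))) w s t \<Longrightarrow>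
    erel d (drel (Suc n) d) w (in_sum s) t"
  by (erule erel_wrap[OF sframe_injections(2)]) auto

lemma erel_in_fun:
  "erel d (frel d (uvalty n) (drel n d) (drel n d)) w s t \<Longrightarrow>
    erel d (drel (Suc n) d) w (in_fun s) t"
  by (erule erel_wrap[OF sframe_injections(3)]) auto

lemma erel_in_unit: "erel d unitrel w s t \<Longrightarrow> erel d (drel (Suc n) d) w (in_unit s) t"
  by (erule erel_wrap[OF sframe_injections(4)]) auto

lemma erel_in_bool: "erel d boolrel w s t \<Longrightarrow> erel d (drel (Suc n) d) w (in_bool s) t"
  by (erule erel_wrap[OF sframe_injections(5)]) auto

lemma sreduces_conv:
  assumes "sval v" "sscoped 0 v" "sscoped 0 e" "sscoped 0 p"
  shows "sreduces (SApp (conv n m e p) (SInl v)) (SInl v)"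
    and "sreduces (SApp (conv n m e p) (in_prod v))
      (in_prod (SPair (SApp e (SFst v)) (SApp e (SSnd v))))"
    and "sreduces (SApp (conv n m e p) (in_sum v))
      (in_sum (SCase v (SInl (SApp e (SVar 0))) (SInr (SApp e (SVar 0)))))"
    and "sreduces (SApp (conv n m e p) (in_fun v))
      (in_fun (SLam (uvalty m) (SApp e (SApp v (SApp p (SVar 0))))))"
proof -
  note step = sreduces_step[OF shead_intros(1)] sreduces_step[OF shead_intros(4)]
    sreduces_step[OF shead_intros(5)]
  show "sreduces (SApp (conv n m e p) (SInl v)) (SInl v)"
    "sreduces (SApp (conv n m e p) (in_prod v))
      (in_prod (SPair (SApp e (SFst v)) (SApp e (SSnd v))))"
    "sreduces (SApp (conv n m e p) (in_sum v))
      (in_sum (SCase v (SInl (SApp e (SVar 0))) (SInr (SApp e (SVar 0)))))"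
    "sreduces (SApp (conv n m e p) (in_fun v))
      (in_fun (SLam (uvalty m) (SApp e (SApp v (SApp p (SVar 0))))))"
    unfolding conv_def by (rule step, simp add: assms, simp add: assms sreduces_refl)+
qed

text \<open>A conversion changes only the source representation. Components are converted at
  precision \<open>k\<close> although the value itself comes with \<open>Suc k\<close>: backwards,
  \<open>later\<close> supplies the missing step for pairs and sums, and the strict bound in
  \<open>frel\<close> supplies it for functions.\<close>

lemma erel_conv:
  assumes ep: "sval e" "sscoped 0 e" "sval p" "sscoped 0 p"
    and e: "\<And>w v u. precise d w k \<Longrightarrow> drel n d w v u \<Longrightarrow> erel d (drel m d) w (SApp e v) u"
    and p: "\<And>w v u. precise d w k \<Longrightarrow> drel m d w v u \<Longrightarrow> erel d (drel n d) w (SApp p v) u"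
    and w: "precise d w (Suc k)" and vu: "drel (Suc n) d w v u"
  shows "erel d (drel (Suc m) d) w (SApp (conv n m e p) v) u"
proof -
  have clo: "sval v" "sscoped 0 v" "uval u" "0 \<turnstile>\<^sub>u u"
    using value_relD[OF value_rel_drel vu] by auto
  \<comment> \<open>Backwards \<open>w \<le> Suc k\<close> gives \<open>w - 1 \<le> k\<close>, the
    precision at which the components have to be converted.\<close>
  have earlier: "precise d (case d of Fwd \<Rightarrow> w | Bwd \<Rightarrow> w - 1) k"
    using w by (cases d) (auto simp: precise_def)
  have e_later: "erel d (later d (drel m d)) w (SApp e v') u'" if "later d (drel n d) w v' u'" for v' u'
  proof (rule erel_later)
    show "erel d (drel m d) (case d of Fwd \<Rightarrow> w | Bwd \<Rightarrow> w - 1) (SApp e v') u'"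
      by (rule e[OF earlier]) (use that in \<open>simp add: later_def\<close>)
    show "uval u'"
      using that value_relD(2)[OF value_rel_drel] by (auto simp: later_def)
  qed
  have vl: "sval v'" "uval u'" if "later d (drel n d) w v' u'" for v' u'
    using that value_relD(1,2)[OF value_rel_drel] by (auto simp: later_def)
  have base: ?thesis if "v = SInl b" "drel (Suc m) d w v u" for b
    using clo that ep
    by (auto intro!: erel_sreduces[OF value_rel_drel sreduces_conv(1)] intro: erel_value
        simp del: drel.simps)
  show ?thesis
    using vu
  proof (cases rule: drel_cases)
    case unk
    then show ?thesis
      using base clo by simp
  next
    case (unit v')
    then show ?thesis
      using base by simp
  next
    case (bool v')
    then show ?thesis
      using base by simp
  next
    case (prod v')
    then obtain v1 v2 u1 u2 where prod: "v = in_prod (SPair v1 v2)" "u = UPair u1 u2"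
      "later d (drel n d) w v1 u1" "later d (drel n d) w v2 u2"
      unfolding prel_def by blast
    have "erel d (later d (drel m d)) w (SApp e (SFst (SPair v1 v2))) u1"
      by (rule erel_sreduces[OF value_rel_later
          sreduces_sframe[OF sframe_intros(2) shead_sreduces[OF shead_intros(2)]]])
        (use prod vl ep e_later in auto)
    moreover have "erel d (later d (drel m d)) w (SApp e (SSnd (SPair v1 v2))) u2"
      by (rule erel_sreduces[OF value_rel_later
          sreduces_sframe[OF sframe_intros(2) shead_sreduces[OF shead_intros(3)]]])
        (use prod vl ep e_later in auto)
    ultimately show ?thesis
      unfolding prod(1,2)
      by (intro erel_sreduces[OF value_rel_drel sreduces_conv(2)] erel_in_prod erel_pair)
        (use clo prod(1) ep in auto)
  next
    case (sum c)
    let ?R = "srel (later d (drel m d)) (later d (drel m d))"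
    have "erel d ?R w (SCase c (SInl (SApp e (SVar 0))) (SInr (SApp e (SVar 0)))) u"
      using sum(2) unfolding srel_def[of "later d (drel n d)"]
    proof (elim disjE exE conjE)
      fix v' u'
      assume *: "c = SInl v'" "u = UInl u'" "later d (drel n d) w v' u'"
      have "shead (SCase c (SInl (SApp e (SVar 0))) (SInr (SApp e (SVar 0)))) (SInl (SApp e v'))"
        using shead_intros(4)[of v' "SInl (SApp e (SVar 0))"] vl(1)[OF *(3)] ep *(1) by simp
      then show ?thesis
        unfolding *(2)
        by (rule erel_sreduces[rotated, OF shead_sreduces]) (use * e_later in \<open>auto intro: erel_inl\<close>)
    next
      fix v' u'
      assume *: "c = SInr v'" "u = UInr u'" "later d (drel n d) w v' u'"
      have "shead (SCase c (SInl (SApp e (SVar 0))) (SInr (SApp e (SVar 0)))) (SInr (SApp e v'))"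
        using shead_intros(5)[of v' _ "SInr (SApp e (SVar 0))"] vl(1)[OF *(3)] ep *(1) by simp
      then show ?thesis
        unfolding *(2)
        by (rule erel_sreduces[rotated, OF shead_sreduces]) (use * e_later in \<open>auto intro: erel_inr\<close>)
    qed
    then show ?thesis
      unfolding sum(1)
      by (intro erel_sreduces[OF value_rel_drel sreduces_conv(3)] erel_in_sum)
        (use clo sum(1) ep in auto)
  next
    case (func f)
    then obtain s t where st: "f = SLam (uvalty n) s" "u = ULam t" "sscoped 1 s" "1 \<turnstile>\<^sub>u t"
      "\<And>w' v' u'. w' < w \<Longrightarrow> drel n d w' v' u' \<Longrightarrow> erel d (drel n d) w' (ssubst 0 v' s) (usubst 0 u' t)"
      unfolding frel_def by blast
    have f: "sval f" "sscoped 0 f"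
      using st by auto
    have "erel d (drel m d) w' (SApp e (SApp f (SApp p a))) (usubst 0 a' t)"
      if w': "w' < w" and a: "drel m d w' a a'" for w' a a'
    \<comment> \<open>The converted function first sends its argument back through \<open>p\<close>,
      a detour that has no counterpart in the target.\<close>
    proof (rule erel_bind_source[where K = "\<lambda>x. SApp e (SApp f x)"])
      have k: "precise d w' k"
        using w w' by (auto simp: precise_def)
      show "sframe (\<lambda>x. SApp e (SApp f x))"
        by (rule sframe_comp[OF sframe_intros(2)[OF ep(1)] sframe_intros(2)[OF f(1)]])
      show "erel d (drel n d) w' (SApp p a) a'"
        by (rule p[OF k a])
      show "uval a'"
        by (rule value_relD(2)[OF value_rel_drel a])
      fix w2 b
      assume b: "w2 \<le> w'" "sval b" "drel n d w2 b a'"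
      have "erel d (drel n d) w2 (SApp f b) (usubst 0 a' t)"
        unfolding st(1)
        by (rule erel_sreduces[OF value_rel_drel shead_sreduces[OF shead_intros(1)]])
          (use b w' in \<open>auto intro: st(5)\<close>)
      then show "erel d (drel m d) w2 (SApp e (SApp f b)) (usubst 0 a' t)"
        by (rule erel_bind[OF sframe_intros(2)[OF ep(1)] uframe_id])
          (use precise_mono[OF k] b(1) in \<open>auto intro: e\<close>)
    qed
    then have "frel d (uvalty m) (drel m d) (drel m d) w
        (SLam (uvalty m) (SApp e (SApp f (SApp p (SVar 0))))) u"
      using f st(2,4) ep unfolding frel_def by simp
    then show ?thesis
      unfolding func(1)
      by (intro erel_sreduces[OF value_rel_drel sreduces_conv(4)] erel_in_fun erel_value)
        (use f ep st(2) in auto)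
  qed
qed

lemma erel_upgrade_downgrade_value:
  "precise d w n \<Longrightarrow> drel n d w v u \<Longrightarrow> erel d (drel (Suc n) d) w (SApp (upgrade n) v) u"
  "precise d w n \<Longrightarrow> drel (Suc n) d w v u \<Longrightarrow> erel d (drel n d) w (SApp (downgrade n) v) u"
proof (induction n arbitrary: w v u)
  case 0
  {
    case 1
    then have "drel (Suc 0) d w in_unk u"
      by auto
    with 1 show ?case
      unfolding upgrade.simps
      by (intro erel_sreduces[OF value_rel_drel shead_sreduces[OF shead_intros(1)]])
        (auto intro!: erel_value)
  next
    case 2
    \<comment> \<open>Precision at level \<open>0\<close> means forwards, or no fuel left: exactly
      the condition under which the unknown value may stand for any closed value.\<close>
    then have "drel 0 d w SUnit u"
      using value_relD[OF value_rel_drel 2(2)] by (auto simp: precise_def)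
    then show ?case
      using value_relD[OF value_rel_drel 2(2)] unfolding downgrade.simps
      by (intro erel_sreduces[OF value_rel_drel shead_sreduces[OF shead_intros(1)]])
        (auto intro!: erel_value)
  }
next
  case (Suc n)
  {
    case 1
    then show ?case
      unfolding upgrade.simps by (intro erel_conv[where k = n]) (auto intro: Suc simp del: drel.simps)
  next
    case 2
    then show ?case
      unfolding downgrade.simps by (intro erel_conv[where k = n]) (auto intro: Suc simp del: drel.simps)
  }
qed

lemma erel_upgrade:
  assumes "precise d w n" "erel d (drel n d) w s t"
  shows "erel d (drel (Suc n) d) w (SApp (upgrade n) s) t"
  by (rule erel_bind[OF sframe_intros(2) uframe_id assms(2)])
    (auto intro: erel_upgrade_downgrade_value(1) precise_mono[OF assms(1)] simp del: drel.simps)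

lemma erel_downgrade:
  assumes "precise d w n" "erel d (drel (Suc n) d) w s t"
  shows "erel d (drel n d) w (SApp (downgrade n) s) t"
  by (rule erel_bind[OF sframe_intros(2) uframe_id assms(2)])
    (auto intro: erel_upgrade_downgrade_value(2) precise_mono[OF assms(1)] simp del: drel.simps)

subsection \<open>Inspecting universal values\<close>

text \<open>The extractors diverge on the unknown value and on every summand but their own. As a
  target elimination at the wrong shape fails, neither side then converges.\<close>

definition get_unit :: "nat \<Rightarrow> strm" where
  "get_unit n = SLam (uvalty (Suc n))
     (SCase (SVar 0) (SCase (SVar 0) (omega TUnit) (SCase (SVar 0) (SVar 0) (omega TUnit)))
         (omega TUnit))"

definition get_bool :: "nat \<Rightarrow> strm" where
  "get_bool n = SLam (uvalty (Suc n))
     (SCase (SVar 0) (SCase (SVar 0) (omega TBool) (SCase (SVar 0) (omega TBool) (SVar 0)))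
         (omega TBool))"

definition get_prod :: "nat \<Rightarrow> strm" where
  "get_prod n = (let \<tau> = TProd (uvalty n) (uvalty n) in SLam (uvalty (Suc n))
     (SCase (SVar 0) (omega \<tau>) (SCase (SVar 0) (SVar 0) (omega \<tau>))))"

definition get_sum :: "nat \<Rightarrow> strm" where
  "get_sum n = (let \<tau> = TSum (uvalty n) (uvalty n) in SLam (uvalty (Suc n))
     (SCase (SVar 0) (omega \<tau>) (SCase (SVar 0) (omega \<tau>) (SCase (SVar 0) (SVar 0) (omega \<tau>)))))"

definition get_fun :: "nat \<Rightarrow> strm" where
  "get_fun n = (let \<tau> = TFun (uvalty n) (uvalty n) in SLam (uvalty (Suc n))
     (SCase (SVar 0) (omega \<tau>) (SCase (SVar 0) (omega \<tau>) (SCase (SVar 0) (omega \<tau>) (SVar 0)))))"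

lemmas get_defs = get_unit_def get_bool_def get_prod_def get_sum_def get_fun_def Let_def

lemma styping_get:
  shows "\<Gamma> \<turnstile>\<^sub>s get_unit n \<Colon> TFun (uvalty (Suc n)) TUnit"
    and "\<Gamma> \<turnstile>\<^sub>s get_bool n \<Colon> TFun (uvalty (Suc n)) TBool"
    and "\<Gamma> \<turnstile>\<^sub>s get_prod n \<Colon> TFun (uvalty (Suc n)) (TProd (uvalty n) (uvalty n))"
    and "\<Gamma> \<turnstile>\<^sub>s get_sum n \<Colon> TFun (uvalty (Suc n)) (TSum (uvalty n) (uvalty n))"
    and "\<Gamma> \<turnstile>\<^sub>s get_fun n \<Colon> TFun (uvalty (Suc n)) (TFun (uvalty n) (uvalty n))"
  unfolding get_defs uvalty.simps by (rule styping_omega styping.intros | simp)+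

lemma get_closed [simp]:
  "sscoped 0 (get_unit n)" "sscoped 0 (get_bool n)" "sscoped 0 (get_prod n)"
  "sscoped 0 (get_sum n)" "sscoped 0 (get_fun n)"
  by (simp_all add: get_defs)

lemma sval_get [simp]:
  "sval (get_unit n)" "sval (get_bool n)" "sval (get_prod n)" "sval (get_sum n)" "sval (get_fun n)"
  by (simp_all add: get_defs)

lemma sreduces_get:
  assumes "sval v"
  shows "sreduces (SApp (get_unit n) (in_unit v)) v"
    and "sreduces (SApp (get_bool n) (in_bool v)) v"
    and "sreduces (SApp (get_prod n) (in_prod v)) v"
    and "sreduces (SApp (get_sum n) (in_sum v)) v"
    and "sreduces (SApp (get_fun n) (in_fun v)) v"
proof -
  note step = sreduces_step[OF shead_intros(1)] sreduces_step[OF shead_intros(4)]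
    sreduces_step[OF shead_intros(5)]
  show "sreduces (SApp (get_unit n) (in_unit v)) v" "sreduces (SApp (get_bool n) (in_bool v)) v"
    "sreduces (SApp (get_prod n) (in_prod v)) v" "sreduces (SApp (get_sum n) (in_sum v)) v"
    "sreduces (SApp (get_fun n) (in_fun v)) v"
    unfolding get_defs by (rule step, simp add: assms, simp add: assms sreduces_refl)+
qed

lemma erel_value_rel: "value_rel R \<Longrightarrow> R w v u \<Longrightarrow> erel d R w v u"
  by (auto intro: erel_value value_relD(1,2)[of R])

lemma erel_stuck:
  "(\<And>k k' r. \<not> sev s k k' r) \<Longrightarrow> (\<And>k' r. d = Bwd \<Longrightarrow> \<not> uev t w k' r) \<Longrightarrow> erel d R w s t"
  by (cases d) auto

text \<open>Scheme for all eliminations. Either the upgraded value carries the expected summand and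
  the frames are compared on its content, or the extractor diverges. Divergence settles the forward
  direction; backwards the target must not converge either, because its value has the wrong shape
  or, for the unknown value, because no fuel remains for the elimination.\<close>

lemma erel_get:
  assumes K: "sframe K" and L: "uframe L" and "sval g" and "value_rel R" "value_rel P"
    and w: "precise d w n" and st: "erel d (drel n d) w s t"
    and red: "\<And>v. sval v \<Longrightarrow> sreduces (SApp g (i v)) v"
    and cases: "\<And>w v u. drel (Suc n) d w v u \<Longrightarrow> sval v \<Longrightarrow> uval u \<Longrightarrow> (\<exists>v'. v = i v' \<and> P w v' u) \<or>
        (\<forall>k k' r. \<not> sev (SApp g v) k k' r) \<and> (d = Bwd \<longrightarrow> (\<forall>k' r. \<not> uev (L u) w k' r))"
    and good: "\<And>w' v u. w' \<le> w \<Longrightarrow> P w' v u \<Longrightarrow> erel d R w' (K v) (L u)"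
  shows "erel d R w (K (SApp g (SApp (upgrade n) s))) (L t)"
proof (rule erel_bind[OF sframe_comp[OF K sframe_intros(2)] L erel_upgrade[OF w st]])
  fix w' v u
  assume w': "w' \<le> w" and vu: "sval v" "uval u" "drel (Suc n) d w' v u"
  from cases[OF vu(3,1,2)] show "erel d R w' (K (SApp g v)) (L u)"
  proof (elim disjE exE conjE)
    fix v'
    assume v: "v = i v'" and P: "P w' v' u"
    have "sreduces (K (SApp g v)) (K v')"
      unfolding v by (rule sreduces_sframe[OF K red[OF value_relD(1)[OF \<open>value_rel P\<close> P]]])
    then show ?thesis
      by (rule erel_sreduces[OF \<open>value_rel R\<close> _ good[OF w' P]])
  next
    assume g: "\<forall>k k' r. \<not> sev (SApp g v) k k' r" and "d = Bwd \<longrightarrow> (\<forall>k' r. \<not> uev (L u) w' k' r)"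
    moreover have "\<not> sev (K (SApp g v)) k k' r" for k k' r
      using K g unfolding sframe_def by blast
    ultimately show ?thesis
      by (intro erel_stuck) simp_all
  qed
qed (fact \<open>sval g\<close>)

abbreviation (input) drel_prod :: "nat \<Rightarrow> direction \<Rightarrow> world_rel" where
  "drel_prod n d \<equiv> prel (later d (drel n d)) (later d (drel n d))"

abbreviation (input) drel_sum :: "nat \<Rightarrow> direction \<Rightarrow> world_rel" where
  "drel_sum n d \<equiv> srel (later d (drel n d)) (later d (drel n d))"

abbreviation (input) drel_fun :: "nat \<Rightarrow> direction \<Rightarrow> world_rel" where
  "drel_fun n d \<equiv> frel d (uvalty n) (drel n d) (drel n d)"

text \<open>Backwards the unknown value occurs only at index \<open>0\<close>, where evaluating the
  argument of a call cannot leave the unit that the beta step needs.\<close>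

lemma not_uev_fuel: "\<not> uev t 0 (Suc k) v"
  using uev_le by fastforce

lemma drel_fst:
  assumes "precise d w n" "erel d (drel n d) w s t"
  shows "erel d (drel n d) w (SFst (SApp (get_prod n) (SApp (upgrade n) s))) (UFst t)"
proof (rule erel_get[where P = "drel_prod n d", OF sframe_intros(3) uframe_intros(3) _ _ _ assms
    sreduces_get(3)])
  fix w v u
  assume "drel (Suc n) d w v u" "sval v" "uval u"
  then show "(\<exists>v'. v = in_prod v' \<and> drel_prod n d w v' u) \<or>
      (\<forall>k k' r. \<not> sev (SApp (get_prod n) v) k k' r) \<and> (d = Bwd \<longrightarrow> (\<forall>k' r. \<not> uev (UFst u) w k' r))"
    by (cases rule: drel_cases) (auto simp: get_defs unitrel_def boolrel_def srel_def frel_def)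
next
  fix w' v u
  assume "drel_prod n d w' v u"
  then show "erel d (drel n d) w' (SFst v) (UFst u)"
    by (intro erel_fst[OF value_rel_drel erel_value_rel]) auto
qed auto

lemma drel_snd:
  assumes "precise d w n" "erel d (drel n d) w s t"
  shows "erel d (drel n d) w (SSnd (SApp (get_prod n) (SApp (upgrade n) s))) (USnd t)"
proof (rule erel_get[where P = "drel_prod n d", OF sframe_intros(4) uframe_intros(4) _ _ _ assms
    sreduces_get(3)])
  fix w v u
  assume "drel (Suc n) d w v u" "sval v" "uval u"
  then show "(\<exists>v'. v = in_prod v' \<and> drel_prod n d w v' u) \<or>
      (\<forall>k k' r. \<not> sev (SApp (get_prod n) v) k k' r) \<and> (d = Bwd \<longrightarrow> (\<forall>k' r. \<not> uev (USnd u) w k' r))"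
    by (cases rule: drel_cases) (auto simp: get_defs unitrel_def boolrel_def srel_def frel_def)
next
  fix w' v u
  assume "drel_prod n d w' v u"
  then show "erel d (drel n d) w' (SSnd v) (USnd u)"
    by (intro erel_snd[OF value_rel_drel erel_value_rel]) auto
qed auto

lemma drel_app:
  assumes "precise d w n" "erel d (drel n d) w s t" and st2: "erel d (drel n d) w s2 t2"
  shows "erel d (drel n d) w (SApp (SApp (get_fun n) (SApp (upgrade n) s)) s2) (UApp t t2)"
proof (rule erel_get[where P = "drel_fun n d" and K = "\<lambda>x. SApp x s2" and L = "\<lambda>x. UApp x t2",
      OF sframe_intros(1) uframe_intros(1) _ _ _ assms(1,2) sreduces_get(5)])
  fix w v u
  assume "drel (Suc n) d w v u" "sval v" "uval u"
  then show "(\<exists>v'. v = in_fun v' \<and> drel_fun n d w v' u) \<or>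
      (\<forall>k k' r. \<not> sev (SApp (get_fun n) v) k k' r) \<and> (d = Bwd \<longrightarrow> (\<forall>k' r. \<not> uev (UApp u t2) w k' r))"
    by (cases rule: drel_cases)
      (auto simp: get_defs unitrel_def boolrel_def prel_def srel_def not_uev_fuel)
next
  fix w' v u
  assume "w' \<le> w" "drel_fun n d w' v u"
  then show "erel d (drel n d) w' (SApp v s2) (UApp u t2)"
    by (intro erel_app[OF value_rel_drel[of n d] erel_value_rel[OF value_rel_frel]]
        erel_mono[OF value_rel_drel st2])
qed auto

lemma drel_case:
  assumes "precise d w n" "erel d (drel n d) w s t" "value_rel R"
    and 1: "\<And>w' v u. w' < w \<Longrightarrow> drel n d w' v u \<Longrightarrow> erel d R w' (ssubst 0 v s1) (usubst 0 u t1)"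
    and 2: "\<And>w' v u. w' < w \<Longrightarrow> drel n d w' v u \<Longrightarrow> erel d R w' (ssubst 0 v s2) (usubst 0 u t2)"
  shows "erel d R w (SCase (SApp (get_sum n) (SApp (upgrade n) s)) s1 s2) (UCase t t1 t2)"
proof (rule erel_get[where P = "drel_sum n d" and K = "\<lambda>x. SCase x s1 s2" and L = "\<lambda>x. UCase x t1 t2",
      OF sframe_intros(9) uframe_intros(9) _ assms(3) _ assms(1,2) sreduces_get(4)])
  fix w v u
  assume "drel (Suc n) d w v u" "sval v" "uval u"
  then show "(\<exists>v'. v = in_sum v' \<and> drel_sum n d w v' u) \<or>
      (\<forall>k k' r. \<not> sev (SApp (get_sum n) v) k k' r) \<and> (d = Bwd \<longrightarrow> (\<forall>k' r. \<not> uev (UCase u t1 t2) w k' r))"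
    by (cases rule: drel_cases) (auto simp: get_defs unitrel_def boolrel_def prel_def frel_def)
next
  fix w' v u
  assume w': "w' \<le> w" and "drel_sum n d w' v u"
  then have "erel d (drel_sum n d) w' v u"
    by (intro erel_value_rel) auto
  then show "erel d R w' (SCase v s1 s2) (UCase u t1 t2)"
    by (rule erel_case[OF value_rel_drel value_rel_drel]) (use w' 1 2 in auto)
qed auto

lemma drel_seq:
  assumes "precise d w n" "erel d (drel n d) w s t" "value_rel R" and st2: "erel d R w s2 t2"
  shows "erel d R w (SSeq (SApp (get_unit n) (SApp (upgrade n) s)) s2) (USeq t t2)"
proof (rule erel_get[where P = unitrel and K = "\<lambda>x. SSeq x s2" and L = "\<lambda>x. USeq x t2",
      OF sframe_intros(10) uframe_intros(10) _ assms(3) _ assms(1,2) sreduces_get(1)])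
  fix w v u
  assume "drel (Suc n) d w v u" "sval v" "uval u"
  then show "(\<exists>v'. v = in_unit v' \<and> unitrel w v' u) \<or>
      (\<forall>k k' r. \<not> sev (SApp (get_unit n) v) k k' r) \<and> (d = Bwd \<longrightarrow> (\<forall>k' r. \<not> uev (USeq u t2) w k' r))"
    by (cases rule: drel_cases) (auto simp: get_defs boolrel_def prel_def srel_def frel_def)
next
  fix w' v u
  assume "w' \<le> w" "unitrel w' v u"
  then show "erel d R w' (SSeq v s2) (USeq u t2)"
    by (intro erel_seq[OF assms(3) erel_value] erel_mono[OF assms(3) st2]) (auto simp: unitrel_def)
qed auto

lemma drel_if:
  assumes "precise d w n" "erel d (drel n d) w s t" "value_rel R"
    and st1: "erel d R w s1 t1" and st2: "erel d R w s2 t2"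
  shows "erel d R w (SIf (SApp (get_bool n) (SApp (upgrade n) s)) s1 s2) (UIf t t1 t2)"
proof (rule erel_get[where P = boolrel and K = "\<lambda>x. SIf x s1 s2" and L = "\<lambda>x. UIf x t1 t2",
      OF sframe_intros(11) uframe_intros(11) _ assms(3) _ assms(1,2) sreduces_get(2)])
  fix w v u
  assume "drel (Suc n) d w v u" "sval v" "uval u"
  then show "(\<exists>v'. v = in_bool v' \<and> boolrel w v' u) \<or>
      (\<forall>k k' r. \<not> sev (SApp (get_bool n) v) k k' r) \<and> (d = Bwd \<longrightarrow> (\<forall>k' r. \<not> uev (UIf u t1 t2) w k' r))"
    by (cases rule: drel_cases) (auto simp: get_defs unitrel_def prel_def srel_def frel_def)
next
  fix w' v u
  assume "w' \<le> w" "boolrel w' v u"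
  then show "erel d R w' (SIf v s1 s2) (UIf u t1 t2)"
    by (intro erel_if[OF assms(3) erel_value] erel_mono[OF assms(3) st1] erel_mono[OF assms(3) st2])
      (auto simp: boolrel_def)
qed auto

section \<open>Introduction forms at the universal type\<close>

lemma drel_pair:
  assumes "precise d w n" "erel d (drel n d) w s1 t1" "erel d (drel n d) w s2 t2"
  shows "erel d (drel n d) w (SApp (downgrade n) (in_prod (SPair s1 s2))) (UPair t1 t2)"
  by (intro erel_downgrade erel_in_prod erel_pair value_rel_later value_rel_drel assms
      erel_weaken[OF assms(2)] erel_weaken[OF assms(3)] laterI)

lemma erel_drel_sum:
  assumes "precise d w n" "erel d (srel (drel n d) (drel n d)) w s t"
  shows "erel d (drel n d) w (SApp (downgrade n) (in_sum s)) t"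
  by (intro erel_downgrade erel_in_sum erel_srel_later value_rel_drel assms)

lemma erel_apply:
  assumes "sval p" "uval q" "erel d A w s t"
    and "\<And>w' v u. w' \<le> w \<Longrightarrow> A w' v u \<Longrightarrow> erel d B w' (SApp p v) (UApp q u)"
  shows "erel d B w (SApp p s) (UApp q t)"
  by (rule erel_bind[OF sframe_intros(2)[OF assms(1)] uframe_intros(2)[OF assms(2)] assms(3)])
    (use assms(4) in auto)

text \<open>The beta steps that enter two wrappers are taken independently of each other, so the
  bodies are compared at the unchanged index.\<close>

lemma erel_beta:
  assumes "value_rel R" "sval v" "uval u" "erel d R w (ssubst 0 v s) (usubst 0 u t)"
  shows "erel d R w (SApp (SLam \<tau> s) v) (UApp (ULam t) u)"
  by (rule erel_sreduces[OF assms(1) shead_sreduces[OF shead_intros(1)[OF assms(2)]]])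
    (rule erel_ureduces[OF assms(1) ureduces_beta[OF assms(3)] assms(4)])

lemma drel_lam:
  assumes "precise d w n" "sscoped 1 s" "1 \<turnstile>\<^sub>u t"
    and "\<And>w' v u. w' < w \<Longrightarrow> drel n d w' v u \<Longrightarrow> erel d (drel n d) w' (ssubst 0 v s) (usubst 0 u t)"
  shows "erel d (drel n d) w (SApp (downgrade n) (in_fun (SLam (uvalty n) s))) (ULam t)"
  using assms by (intro erel_downgrade erel_in_fun erel_value) (auto simp: frel_def)

lemma drel_unit:
  "precise d w n \<Longrightarrow> erel d unitrel w s t \<Longrightarrow>
    erel d (drel n d) w (SApp (downgrade n) (in_unit s)) t"
  by (intro erel_downgrade erel_in_unit)

lemma drel_bool:
  "precise d w n \<Longrightarrow> erel d boolrel w s t \<Longrightarrow>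
    erel d (drel n d) w (SApp (downgrade n) (in_bool s)) t"
  by (intro erel_downgrade erel_in_bool)

subsection \<open>Injections and projections\<close>

text \<open>The clauses imitate \<open>protect\<close> and \<open>confine\<close>, with tagging and
  extraction added, so that corresponding subterms can be related. For instance
  \<open>project n TUnit\<close> sequences with \<open>SUnit\<close> just as
  \<open>confine TUnit\<close> does with \<open>UUnit\<close>.\<close>

fun inject project :: "nat \<Rightarrow> ty \<Rightarrow> strm" where
  "inject n TUnit = SLam TUnit (SApp (downgrade n) (in_unit (SVar 0)))"
| "inject n TBool = SLam TBool (SApp (downgrade n) (in_bool (SVar 0)))"
| "inject n (TProd \<tau>1 \<tau>2) = SLam (TProd \<tau>1 \<tau>2) (SApp (downgrade n)
     (in_prod (SPair (SApp (inject n \<tau>1) (SFst (SVar 0))) (SApp (inject n \<tau>2) (SSnd (SVar 0))))))"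
| "inject n (TSum \<tau>1 \<tau>2) = SLam (TSum \<tau>1 \<tau>2) (SApp (downgrade n)
     (in_sum (SCase (SVar 0) (SInl (SApp (inject n \<tau>1) (SVar 0)))
         (SInr (SApp (inject n \<tau>2) (SVar 0))))))"
| "inject n (TFun \<tau>1 \<tau>2) = SLam (TFun \<tau>1 \<tau>2) (SApp (downgrade n)
     (in_fun (SLam (uvalty n) (SApp (inject n \<tau>2) (SApp (SVar 1) (SApp (project n \<tau>1) (SVar 0)))))))"
| "project n TUnit = SLam (uvalty n) (SSeq (SApp (get_unit n) (SApp (upgrade n) (SVar 0))) SUnit)"
| "project n TBool = SLam (uvalty n) (SIf (SApp (get_bool n) (SApp (upgrade n) (SVar 0))) STrue SFalse)"
| "project n (TProd \<tau>1 \<tau>2) = SLam (uvalty n)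
     (SPair (SApp (project n \<tau>1) (SFst (SApp (get_prod n) (SApp (upgrade n) (SVar 0)))))
       (SApp (project n \<tau>2) (SSnd (SApp (get_prod n) (SApp (upgrade n) (SVar 0))))))"
| "project n (TSum \<tau>1 \<tau>2) = SLam (uvalty n)
     (SCase (SApp (get_sum n) (SApp (upgrade n) (SVar 0)))
       (SInl (SApp (project n \<tau>1) (SVar 0))) (SInr (SApp (project n \<tau>2) (SVar 0))))"
| "project n (TFun \<tau>1 \<tau>2) = SLam (uvalty n) (SLam \<tau>1 (SApp (project n \<tau>2)
     (SApp (SApp (get_fun n) (SApp (upgrade n) (SVar 1))) (SApp (inject n \<tau>1) (SVar 0)))))"

lemma styping_var: "\<tau> # \<Gamma> \<turnstile>\<^sub>s SVar 0 \<Colon> \<tau>" "\<tau>' # \<tau> # \<Gamma> \<turnstile>\<^sub>s SVar 1 \<Colon> \<tau>"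
  by (auto intro: styping.intros)

lemma styping_inject_unit: "\<Gamma> \<turnstile>\<^sub>s t \<Colon> TUnit \<Longrightarrow> \<Gamma> \<turnstile>\<^sub>s in_unit t \<Colon> uvalty (Suc n)"
  and styping_inject_bool: "\<Gamma> \<turnstile>\<^sub>s t \<Colon> TBool \<Longrightarrow> \<Gamma> \<turnstile>\<^sub>s in_bool t \<Colon> uvalty (Suc n)"
  and styping_inject_prod: "\<Gamma> \<turnstile>\<^sub>s t \<Colon> TProd (uvalty n) (uvalty n) \<Longrightarrow> \<Gamma> \<turnstile>\<^sub>s in_prod t \<Colon> uvalty (Suc n)"
  and styping_inject_sum: "\<Gamma> \<turnstile>\<^sub>s t \<Colon> TSum (uvalty n) (uvalty n) \<Longrightarrow> \<Gamma> \<turnstile>\<^sub>s in_sum t \<Colon> uvalty (Suc n)"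
  and styping_inject_fun: "\<Gamma> \<turnstile>\<^sub>s t \<Colon> TFun (uvalty n) (uvalty n) \<Longrightarrow> \<Gamma> \<turnstile>\<^sub>s in_fun t \<Colon> uvalty (Suc n)"
  unfolding uvalty.simps by (intro styping.intros; assumption)+

lemmas styping_universal = styping_inject_unit styping_inject_bool styping_inject_prod
  styping_inject_sum styping_inject_fun styping.intros(6)[OF styping_upgrade_downgrade(1)]
  styping.intros(6)[OF styping_upgrade_downgrade(2)] styping_get[THEN styping.intros(6)]

lemma styping_inject_project:
  "\<Gamma> \<turnstile>\<^sub>s inject n \<tau> \<Colon> TFun \<tau> (uvalty n)"
  "\<Gamma> \<turnstile>\<^sub>s project n \<tau> \<Colon> TFun (uvalty n) \<tau>"
proof (induction \<tau> arbitrary: \<Gamma>)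
  case TUnit
  {
    case 1
    show ?case
      unfolding inject.simps by (intro styping.intros(4) styping_universal styping_var)
  next
    case 2
    show ?case
      unfolding project.simps by (intro styping.intros(1,4,13) styping_universal styping_var)
  }
next
  case TBool
  {
    case 1
    show ?case
      unfolding inject.simps by (intro styping.intros(4) styping_universal styping_var)
  next
    case 2
    show ?case
      unfolding project.simps by (intro styping.intros(2-4,14) styping_universal styping_var)
  }
next
  case (TFun \<tau>1 \<tau>2)
  note ih = TFun[THEN styping.intros(6)]
  {
    case 1
    show ?case
      unfolding inject.simps
      by (intro styping.intros(4) styping_universal styping_var ih styping.intros(6)[where ?\<tau>1.0 = \<tau>1])
  next
    case 2
    show ?case
      unfolding project.simps
      by (intro styping.intros(4) styping_universal styping_var ih
          styping.intros(6)[where ?\<tau>1.0 = "uvalty n"])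
  }
next
  case (TProd \<tau>1 \<tau>2)
  note ih = TProd[THEN styping.intros(6)]
  {
    case 1
    show ?case
      unfolding inject.simps
      by (intro styping.intros(4,9) styping_universal styping_var ih
          styping.intros(7)[where ?\<tau>2.0 = \<tau>2] styping.intros(8)[where ?\<tau>1.0 = \<tau>1])
  next
    case 2
    show ?case
      unfolding project.simps
      by (intro styping.intros(4,9) styping_universal styping_var ih
          styping.intros(7)[where ?\<tau>2.0 = "uvalty n"] styping.intros(8)[where ?\<tau>1.0 = "uvalty n"])
  }
next
  case (TSum \<tau>1 \<tau>2)
  note ih = TSum[THEN styping.intros(6)]
  {
    case 1
    show ?case
      unfolding inject.simps
      by (intro styping.intros(4,10,11) styping_universal styping_var ih
          styping.intros(12)[where ?\<tau>1.0 = \<tau>1 and ?\<tau>2.0 = \<tau>2])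
  next
    case 2
    show ?case
      unfolding project.simps
      by (intro styping.intros(4,10,11) styping_universal styping_var ih
          styping.intros(12)[where ?\<tau>1.0 = "uvalty n" and ?\<tau>2.0 = "uvalty n"])
  }
qed

lemma sscoped_inject_project: "sscoped 0 (inject n \<tau>)" "sscoped 0 (project n \<tau>)"
  using styping_inject_project[of "[]" n \<tau>] styping_sscoped by fastforce+

lemma inject_closed [simp]:
  "sscoped k (inject n \<tau>)" "slift k (inject n \<tau>) = inject n \<tau>"
  "ssubst k s (inject n \<tau>) = inject n \<tau>"
  using sscoped_inject_project by auto

lemma project_closed [simp]:
  "sscoped k (project n \<tau>)" "slift k (project n \<tau>) = project n \<tau>"
  "ssubst k s (project n \<tau>) = project n \<tau>"
  using sscoped_inject_project by auto

lemma sval_inject_project [simp]: "sval (inject n \<tau>)" "sval (project n \<tau>)"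
  by (cases \<tau>; simp)+

text \<open>Source and target wrappers are compared in pairs because a bare target value would not
  do: backwards, a boolean met at type \<open>TUnit\<close> has converged in the target while its
  projection diverges, and only \<open>confine\<close> makes the target fail too. Function domains
  swap the two claims, hence the joint induction.\<close>

lemma erel_inject_project_value:
  "precise d w n \<Longrightarrow> vrel \<tau> d w v u \<Longrightarrow> erel d (drel n d) w (SApp (inject n \<tau>) v) (UApp (protect \<tau>) u)"
  "precise d w n \<Longrightarrow> drel n d w v u \<Longrightarrow> erel d (vrel \<tau> d) w (SApp (project n \<tau>) v) (UApp (confine \<tau>) u)"
proof (induction \<tau> arbitrary: w v u)
  case TUnit
  {
    case 1
    then show ?case
      using value_relD(1,2)[OF value_rel_vrel 1(2)] unfolding inject.simps protect.simps
      by (intro erel_beta[OF value_rel_drel]) (auto intro!: drel_unit intro: erel_value)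
  next
    case 2
    then show ?case
      using value_relD(1,2)[OF value_rel_drel 2(2)] unfolding project.simps confine.simps
      by (intro erel_beta[OF value_rel_vrel])
        (auto intro!: drel_seq erel_value[of SUnit] intro: erel_value_rel simp: unitrel_def[of w])
  }
next
  case TBool
  {
    case 1
    then show ?case
      using value_relD(1,2)[OF value_rel_vrel 1(2)] unfolding inject.simps protect.simps
      by (intro erel_beta[OF value_rel_drel]) (auto intro!: drel_bool intro: erel_value)
  next
    case 2
    then show ?case
      using value_relD(1,2)[OF value_rel_drel 2(2)] unfolding project.simps confine.simps
      by (intro erel_beta[OF value_rel_vrel])
        (auto intro!: drel_if erel_value[of STrue] erel_value[of SFalse] intro: erel_value_rel
            simp: boolrel_def[of w])
  }
next
  case (TFun \<tau>1 \<tau>2)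
  {
    case 1
    note vu = value_relD(1-4)[OF value_rel_vrel 1(2)]
    have "erel d (drel n d) w' (SApp (inject n \<tau>2) (SApp v (SApp (project n \<tau>1) a)))
        (UApp (protect \<tau>2) (UApp u (UApp (confine \<tau>1) b)))"
      if w': "w' < w" and ab: "drel n d w' a b" for w' a b
    proof (rule erel_apply)
      show "erel d (vrel \<tau>2 d) w' (SApp v (SApp (project n \<tau>1) a)) (UApp u (UApp (confine \<tau>1) b))"
      proof (rule vrel_app)
        show "erel d (vrel (TFun \<tau>1 \<tau>2) d) w' v u"
          using vu 1(2) w'
            by (intro erel_value_rel[OF value_rel_vrel] value_relD(5)[OF value_rel_vrel 1(2)]) auto
        show "erel d (vrel \<tau>1 d) w' (SApp (project n \<tau>1) a) (UApp (confine \<tau>1) b)"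
          using precise_mono[OF 1(1)] w' ab by (intro TFun(2)) auto
      qed
      show "erel d (drel n d) w2 (SApp (inject n \<tau>2) a') (UApp (protect \<tau>2) b')"
        if "w2 \<le> w'" "vrel \<tau>2 d w2 a' b'" for w2 a' b'
        using precise_mono[OF 1(1)] w' that by (intro TFun(3)) auto
    qed auto
    then show ?case
      using vu unfolding inject.simps protect.simps
      by (intro erel_beta[OF value_rel_drel]) (auto intro!: drel_lam 1(1))
  next
    case 2
    note vu = value_relD(1-4)[OF value_rel_drel 2(2)]
    have "erel d (vrel \<tau>2 d) w'
        (SApp (project n \<tau>2) (SApp (SApp (get_fun n) (SApp (upgrade n) v)) (SApp (inject n \<tau>1) a)))
        (UApp (confine \<tau>2) (UApp u (UApp (protect \<tau>1) b)))"
      if w': "w' < w" and ab: "vrel \<tau>1 d w' a b" for w' a b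
    proof (rule erel_apply)
      have k: "precise d w' n"
        using precise_mono[OF 2(1)] w' by simp
      show "erel d (drel n d) w' (SApp (SApp (get_fun n) (SApp (upgrade n) v)) (SApp (inject n \<tau>1) a))
          (UApp u (UApp (protect \<tau>1) b))"
      proof (rule drel_app[OF k])
        show "erel d (drel n d) w' v u"
          using w'
            by (intro erel_value_rel[OF value_rel_drel] value_relD(5)[OF value_rel_drel 2(2)]) auto
        show "erel d (drel n d) w' (SApp (inject n \<tau>1) a) (UApp (protect \<tau>1) b)"
          using k ab by (rule TFun(1))
      qed
      show "erel d (vrel \<tau>2 d) w2 (SApp (project n \<tau>2) a') (UApp (confine \<tau>2) b')"
        if "w2 \<le> w'" "drel n d w2 a' b'" for w2 a' b'
        using precise_mono[OF k] that by (intro TFun(4)) auto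
    qed auto
    then have "frel d \<tau>1 (vrel \<tau>1 d) (vrel \<tau>2 d) w
        (SLam \<tau>1 (SApp (project n \<tau>2) (SApp (SApp (get_fun n) (SApp (upgrade n) v))
            (SApp (inject n \<tau>1) (SVar 0)))))
        (ULam (UApp (confine \<tau>2) (UApp u (UApp (protect \<tau>1) (UVar 0)))))"
      using vu unfolding frel_def by simp
    then show ?case
      using vu unfolding project.simps confine.simps
      by (intro erel_beta[OF value_rel_vrel]) (auto intro!: erel_value)
  }
next
  case (TProd \<tau>1 \<tau>2)
  {
    case 1
    note vu = value_relD(1-4)[OF value_rel_vrel 1(2)]
    have v: "erel d (vrel (TProd \<tau>1 \<tau>2) d) w v u"
      using 1(2) by (intro erel_value_rel[OF value_rel_vrel])
    have "erel d (drel n d) w (SApp (inject n \<tau>1) (SFst v)) (UApp (protect \<tau>1) (UFst u))"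
      by (rule erel_apply[OF _ _ vrel_fst[OF v]]) (use TProd(1) precise_mono[OF 1(1)] in auto)
    moreover have "erel d (drel n d) w (SApp (inject n \<tau>2) (SSnd v)) (UApp (protect \<tau>2) (USnd u))"
      by (rule erel_apply[OF _ _ vrel_snd[OF v]]) (use TProd(3) precise_mono[OF 1(1)] in auto)
    ultimately show ?case
      using vu unfolding inject.simps protect.simps
      by (intro erel_beta[OF value_rel_drel]) (auto intro!: drel_pair 1(1))
  next
    case 2
    note vu = value_relD(1-4)[OF value_rel_drel 2(2)]
    have v: "erel d (drel n d) w v u"
      using 2(2) by (intro erel_value_rel[OF value_rel_drel])
    have "erel d (vrel \<tau>1 d) w (SApp (project n \<tau>1) (SFst (SApp (get_prod n) (SApp (upgrade n) v))))
        (UApp (confine \<tau>1) (UFst u))"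
      by (rule erel_apply[OF _ _ drel_fst[OF 2(1) v]]) (use TProd(2) precise_mono[OF 2(1)] in auto)
    moreover have "erel d (vrel \<tau>2 d) w (SApp (project n \<tau>2)
        (SSnd (SApp (get_prod n) (SApp (upgrade n) v))))
        (UApp (confine \<tau>2) (USnd u))"
      by (rule erel_apply[OF _ _ drel_snd[OF 2(1) v]]) (use TProd(4) precise_mono[OF 2(1)] in auto)
    ultimately show ?case
      using vu unfolding project.simps confine.simps
      by (intro erel_beta[OF value_rel_vrel]) (auto intro!: erel_pair)
  }
next
  case (TSum \<tau>1 \<tau>2)
  {
    case 1
    note vu = value_relD(1-4)[OF value_rel_vrel 1(2)]
    have "erel d (srel (drel n d) (drel n d)) w
        (SCase v (SInl (SApp (inject n \<tau>1) (SVar 0))) (SInr (SApp (inject n \<tau>2) (SVar 0))))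
        (UCase u (UInl (UApp (protect \<tau>1) (UVar 0))) (UInr (UApp (protect \<tau>2) (UVar 0))))"
    proof (rule erel_case[OF value_rel_vrel value_rel_vrel])
      show "erel d (srel (later d (vrel \<tau>1 d)) (later d (vrel \<tau>2 d))) w v u"
        using 1(2) by (intro erel_srel_later erel_value_rel) auto
    qed (auto intro!: erel_inl erel_inr TSum(1,3) intro: precise_mono[OF 1(1)])
    then show ?case
      using vu unfolding inject.simps protect.simps
      by (intro erel_beta[OF value_rel_drel]) (auto intro!: erel_drel_sum 1(1))
  next
    case 2
    note vu = value_relD(1-4)[OF value_rel_drel 2(2)]
    have "erel d (vrel (TSum \<tau>1 \<tau>2) d) w
        (SCase (SApp (get_sum n) (SApp (upgrade n) v))
          (SInl (SApp (project n \<tau>1) (SVar 0))) (SInr (SApp (project n \<tau>2) (SVar 0))))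
        (UCase u (UInl (UApp (confine \<tau>1) (UVar 0))) (UInr (UApp (confine \<tau>2) (UVar 0))))"
    proof (rule drel_case[OF 2(1) _ value_rel_vrel])
      show "erel d (drel n d) w v u"
        using 2(2) by (intro erel_value_rel[OF value_rel_drel])
    qed (auto intro!: erel_inl erel_inr TSum(2,4) intro: precise_mono[OF 2(1)])
    then show ?case
      using vu unfolding project.simps confine.simps
      by (intro erel_beta[OF value_rel_vrel]) auto
  }
qed

text \<open>Here \<open>protect\<close> in the compiler earns its place: it is the target
  counterpart of injecting the source term into the universal type.\<close>

lemma erel_inject_compile:
  assumes "[] \<turnstile>\<^sub>s t \<Colon> \<tau>" "precise d w n"
  shows "erel d (drel n d) w (SApp (inject n \<tau>) t) (compile \<tau> t)"
  unfolding compile_def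
  by (rule erel_apply[OF _ _ erel_erase_closed[OF assms(1)]])
    (auto intro: erel_inject_project_value(1) precise_mono[OF assms(2)])


section \<open>Back-translation\<close>

text \<open>All subterms have the one type \<open>uvalty n\<close>: constructors build one level up
  and downgrade the result, eliminations upgrade first. Hence the level does not depend on how
  deeply operations are nested.\<close>

primrec backtrans :: "nat \<Rightarrow> utrm \<Rightarrow> strm" where
  "backtrans n UUnit = SApp (downgrade n) (in_unit SUnit)"
| "backtrans n UTrue = SApp (downgrade n) (in_bool STrue)"
| "backtrans n UFalse = SApp (downgrade n) (in_bool SFalse)"
| "backtrans n (ULam t) = SApp (downgrade n) (in_fun (SLam (uvalty n) (backtrans n t)))"
| "backtrans n (UVar i) = SVar i"
| "backtrans n (UApp t1 t2) =
     SApp (SApp (get_fun n) (SApp (upgrade n) (backtrans n t1))) (backtrans n t2)"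
| "backtrans n (UFst t) = SFst (SApp (get_prod n) (SApp (upgrade n) (backtrans n t)))"
| "backtrans n (USnd t) = SSnd (SApp (get_prod n) (SApp (upgrade n) (backtrans n t)))"
| "backtrans n (UPair t1 t2) = SApp (downgrade n) (in_prod (SPair (backtrans n t1) (backtrans n t2)))"
| "backtrans n (UInl t) = SApp (downgrade n) (in_sum (SInl (backtrans n t)))"
| "backtrans n (UInr t) = SApp (downgrade n) (in_sum (SInr (backtrans n t)))"
| "backtrans n (UCase t t1 t2) =
     SCase (SApp (get_sum n) (SApp (upgrade n) (backtrans n t))) (backtrans n t1) (backtrans n t2)"
| "backtrans n (USeq t1 t2) =
     SSeq (SApp (get_unit n) (SApp (upgrade n) (backtrans n t1))) (backtrans n t2)"
| "backtrans n (UIf t t1 t2) =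
     SIf (SApp (get_bool n) (SApp (upgrade n) (backtrans n t))) (backtrans n t1) (backtrans n t2)"
| "backtrans n UWrong = omega (uvalty n)"

lemma styping_backtrans: "k \<turnstile>\<^sub>u t \<Longrightarrow> replicate k (uvalty n) \<turnstile>\<^sub>s backtrans n t \<Colon> uvalty n"
proof (induction t arbitrary: k)
  case (UVar i)
  then show ?case
    by (auto intro: styping.intros)
next
  case (UApp t1 t2)
  then show ?case
    unfolding backtrans.simps uscoped.simps
    by (intro styping.intros(6)[of _ _ "uvalty n"] styping_universal) auto
next
  case (UFst t)
  then show ?case
    unfolding backtrans.simps uscoped.simps
    by (intro styping.intros(7)[of _ _ _ "uvalty n"] styping_universal) auto
next
  case (USnd t)
  then show ?case
    unfolding backtrans.simps uscoped.simps
    by (intro styping.intros(8)[of _ _ "uvalty n"] styping_universal) auto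
next
  case (UCase t t1 t2)
  then show ?case
    using UCase.IH(2,3)[of "Suc k"] unfolding backtrans.simps uscoped.simps
    by (intro styping.intros(12)[of _ _ "uvalty n" "uvalty n"] styping_universal) auto
next
  case (ULam t)
  then show ?case
    using ULam.IH[of "Suc k"] unfolding backtrans.simps uscoped.simps
    by (intro styping.intros(4) styping_universal) auto
qed (auto intro!: styping.intros(1-3,9-11,13,14) styping_universal styping_omega)

text \<open>Fundamental property of the back-translation. Bodies of binders are compared at smaller
  indices and so inherit \<open>precise\<close>; a level chosen once for the whole budget serves
  throughout.\<close>

theorem erel_backtrans:
  "k \<turnstile>\<^sub>u t \<Longrightarrow> precise d w n \<Longrightarrow> envrel (replicate k (drel n d)) w \<sigma> \<rho> \<Longrightarrow>
    erel d (drel n d) w (sclose 0 \<sigma> (backtrans n t)) (uclose 0 \<rho> t)"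
proof (induction t arbitrary: k w \<sigma> \<rho>)
  case (UVar i)
  then have "drel n d w (\<sigma> i) (\<rho> i)"
    by (auto simp: envrel_def)
  then show ?case
    by (auto intro: erel_value_rel)
next
  case (ULam t)
  have "erel d (drel n d) w' (ssubst 0 v (sclose (Suc 0) \<sigma> (backtrans n t)))
      (usubst 0 u (uclose (Suc 0) \<rho> t))"
    if "w' < w" "drel n d w' v u" for w' v u
    using ULam.IH[of "Suc k" w'] ULam.prems that precise_mono[OF ULam.prems(2), of w']
    by (intro envrel_bodies[OF ULam.prems(3), where A = "drel n d"]) auto
  then show ?case
    using ULam.prems by (auto intro!: drel_lam simp: envrel_def)
next
  case (UCase t t1 t2)
  have 1: "erel d (drel n d) w' (ssubst 0 v (sclose (Suc 0) \<sigma> (backtrans n t1)))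
      (usubst 0 u (uclose (Suc 0) \<rho> t1))"
    if "w' < w" "drel n d w' v u" for w' v u
    using UCase.IH(2)[of "Suc k" w'] UCase.prems that precise_mono[OF UCase.prems(2), of w']
    by (intro envrel_bodies[OF UCase.prems(3), where A = "drel n d"]) auto
  have 2: "erel d (drel n d) w' (ssubst 0 v (sclose (Suc 0) \<sigma> (backtrans n t2)))
      (usubst 0 u (uclose (Suc 0) \<rho> t2))"
    if "w' < w" "drel n d w' v u" for w' v u
    using UCase.IH(3)[of "Suc k" w'] UCase.prems that precise_mono[OF UCase.prems(2), of w']
    by (intro envrel_bodies[OF UCase.prems(3), where A = "drel n d"]) auto
  show ?case
    using UCase.IH(1)[of k w] UCase.prems 1 2 by (auto intro!: drel_case)
next
  case (UInl t)
  then show ?case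
    by (auto intro!: erel_drel_sum erel_inl)
next
  case (UInr t)
  then show ?case
    by (auto intro!: erel_drel_sum erel_inr)
next
  case UUnit
  then show ?case
    by (auto intro!: drel_unit erel_value simp: unitrel_def)
next
  case UTrue
  then show ?case
    by (auto intro!: drel_bool erel_value simp: boolrel_def)
next
  case UFalse
  then show ?case
    by (auto intro!: drel_bool erel_value simp: boolrel_def)
next
  case UWrong
  then show ?case
    by (intro erel_stuck) auto
qed (auto intro!: drel_app drel_fst drel_snd drel_pair drel_seq drel_if)

lemma erel_backtrans_closed:
  assumes "0 \<turnstile>\<^sub>u t" "precise d w n"
  shows "erel d (drel n d) w (backtrans n t) t"
proof -
  have "sscoped 0 (backtrans n t)"
    using styping_sscoped[OF styping_backtrans[OF assms(1)]] by simp
  then show ?thesis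
    using erel_backtrans[OF assms, of "\<lambda>_. SUnit" "\<lambda>_. UUnit"] assms(1) by (simp add: envrel_def)
qed

lemma erel_backtrans_body:
  assumes "Suc 0 \<turnstile>\<^sub>u t" "precise d w n" "drel n d w v u"
  shows "erel d (drel n d) w (ssubst 0 v (backtrans n t)) (usubst 0 u t)"
proof -
  have "sscoped (Suc 0) (backtrans n t)"
    using styping_sscoped[OF styping_backtrans[OF assms(1)]] by simp
  moreover have "erel d (drel n d) w (ssubst 0 v (sclose (Suc 0) (\<lambda>_. SUnit) (backtrans n t)))
      (usubst 0 u (uclose (Suc 0) (\<lambda>_. UUnit) t))"
    by (rule envrel_bodies[where Rs = "[]" and A = "drel n d", OF _ _ order_refl])
      (use assms erel_backtrans[OF assms(1,2)] in \<open>auto simp: envrel_def\<close>)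
  ultimately show ?thesis
    using assms(1) by (simp add: sclose_sscoped uclose_uscoped)
qed

section \<open>Back-translation of target contexts\<close>

lemma uctx_scoped_le: "(\<turnstile>\<^sub>u C : n' \<rightarrow> n) \<Longrightarrow> n \<le> n'"
  by (induction rule: uctx_scoped.induct) auto

lemma styping_backtrans_closed:
  "0 \<turnstile>\<^sub>u t \<Longrightarrow> [] \<turnstile>\<^sub>s backtrans n t \<Colon> uvalty n"
  "Suc 0 \<turnstile>\<^sub>u t \<Longrightarrow> [uvalty n] \<turnstile>\<^sub>s backtrans n t \<Colon> uvalty n"
  using styping_backtrans[of 0] styping_backtrans[of "Suc 0"] by simp_all

lemma sctx_typing_downgrade:
  "\<turnstile>\<^sub>s C : \<Gamma>', \<tau>' \<rightarrow> \<Gamma>, uvalty (Suc n) \<Longrightarrow> \<turnstile>\<^sub>s SCApp2 (downgrade n) C : \<Gamma>', \<tau>' \<rightarrow> \<Gamma>, uvalty n"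
  by (rule sctx_typing.intros(4)[OF styping_upgrade_downgrade(2)])

lemma sctx_typing_injections:
  shows "\<turnstile>\<^sub>s C : \<Gamma>', \<tau>' \<rightarrow> \<Gamma>, TProd (uvalty n) (uvalty n) \<Longrightarrow> \<turnstile>\<^sub>s SCInr (SCInl C) : \<Gamma>', \<tau>' \<rightarrow> \<Gamma>,
      uvalty (Suc n)"
    and "\<turnstile>\<^sub>s C : \<Gamma>', \<tau>' \<rightarrow> \<Gamma>, TSum (uvalty n) (uvalty n) \<Longrightarrow>
      \<turnstile>\<^sub>s SCInr (SCInr (SCInl C)) : \<Gamma>', \<tau>' \<rightarrow> \<Gamma>, uvalty (Suc n)"
  unfolding uvalty.simps by (intro sctx_typing.intros; assumption)+

lemma sctx_typing_get:
  assumes "\<And>\<Gamma>. \<Gamma> \<turnstile>\<^sub>s g \<Colon> TFun (uvalty (Suc n)) \<tau>" "\<turnstile>\<^sub>s C : \<Gamma>', \<tau>' \<rightarrow> \<Gamma>, uvalty n"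
  shows "\<turnstile>\<^sub>s SCApp2 g (SCApp2 (upgrade n) C) : \<Gamma>', \<tau>' \<rightarrow> \<Gamma>, \<tau>"
  by (rule sctx_typing.intros(4)[OF assms(1) sctx_typing.intros(4)[OF styping_upgrade_downgrade(1)
      assms(2)]])

lemmas typing_context = styping_backtrans_closed sctx_typing_downgrade sctx_typing_injections
  sctx_typing_get[OF styping_get(1)] sctx_typing_get[OF styping_get(2)]
      sctx_typing_get[OF styping_get(3)]
  sctx_typing_get[OF styping_get(4)] sctx_typing_get[OF styping_get(5)] styping_universal

text \<open>\<open>S\<close> is fixed before direction, index and plugged terms, so the same source
  context can be used backwards with one term and forwards with the other.\<close>

lemma backtrans_context:
  assumes "\<turnstile>\<^sub>u C : 0 \<rightarrow> 0"
  obtains S where "\<turnstile>\<^sub>s S : [], \<tau> \<rightarrow> [], uvalty n"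
    and "\<And>d w s t. precise d w n \<Longrightarrow> erel d (drel n d) w (SApp (inject n \<tau>) s) t \<Longrightarrow>
      erel d (drel n d) w (splug S s) (uplug C t)"
proof -
  have "\<exists>S. (\<turnstile>\<^sub>s S : [], \<tau> \<rightarrow> [], uvalty n) \<and>
      (\<forall>d w s t. precise d w n \<longrightarrow> erel d (drel n d) w (SApp (inject n \<tau>) s) t \<longrightarrow>
        erel d (drel n d) w (splug S s) (uplug C t))"
    if "\<turnstile>\<^sub>u C : n' \<rightarrow> k" "n' = 0" "k = 0" for n' k
    using that
  proof (induction rule: uctx_scoped.induct)
    case (1 n')
    show ?case
      \<comment> \<open>The injection sits directly at the hole, so \<open>S\<close> accepts a
        source term of type \<open>\<tau>\<close> as it is.\<close>
      by (intro exI[of _ "SCApp2 (inject n \<tau>) SHole"])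
          (auto intro: sctx_typing.intros styping_inject_project)
  next
    case (2 C n' n)
    then show ?case
      using uctx_scoped_le by fastforce
  next
    case (3 C n' k t2)
    then obtain S where S: "\<turnstile>\<^sub>s S : [], \<tau> \<rightarrow> [], uvalty n"
      "\<And>d w s t. precise d w n \<Longrightarrow> erel d (drel n d) w (SApp (inject n \<tau>) s) t \<Longrightarrow>
        erel d (drel n d) w (splug S s) (uplug C t)"
      by auto
    with 3 show ?case
      by (intro exI[of _ "SCApp1 (SCApp2 (get_fun n) (SCApp2 (upgrade n) S)) (backtrans n t2)"])
        (auto intro!: drel_app[OF _ S(2)] sctx_typing.intros(3)[of _ _ _ _ "uvalty n"]
          typing_context erel_backtrans_closed)
  next
    case (4 k t1 C n')
    then obtain S where S: "\<turnstile>\<^sub>s S : [], \<tau> \<rightarrow> [], uvalty n"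
      "\<And>d w s t. precise d w n \<Longrightarrow> erel d (drel n d) w (SApp (inject n \<tau>) s) t \<Longrightarrow>
        erel d (drel n d) w (splug S s) (uplug C t)"
      by auto
    with 4 show ?case
      by (intro exI[of _ "SCApp2 (SApp (get_fun n) (SApp (upgrade n) (backtrans n t1))) S"])
        (auto intro!: drel_app[OF _ _ S(2)] sctx_typing.intros(4)[of _ _ "uvalty n"]
          typing_context erel_backtrans_closed)
  next
    case (5 C n' k)
    then obtain S where S: "\<turnstile>\<^sub>s S : [], \<tau> \<rightarrow> [], uvalty n"
      "\<And>d w s t. precise d w n \<Longrightarrow> erel d (drel n d) w (SApp (inject n \<tau>) s) t \<Longrightarrow>
        erel d (drel n d) w (splug S s) (uplug C t)"
      by auto
    with 5 show ?case
      by (intro exI[of _ "SCFst (SCApp2 (get_prod n) (SCApp2 (upgrade n) S))"])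
        (auto intro!: drel_fst[OF _ S(2)] sctx_typing.intros(5)[of _ _ _ _ _ "uvalty n"]
          typing_context erel_backtrans_closed)
  next
    case (6 C n' k)
    then obtain S where S: "\<turnstile>\<^sub>s S : [], \<tau> \<rightarrow> [], uvalty n"
      "\<And>d w s t. precise d w n \<Longrightarrow> erel d (drel n d) w (SApp (inject n \<tau>) s) t \<Longrightarrow>
        erel d (drel n d) w (splug S s) (uplug C t)"
      by auto
    with 6 show ?case
      by (intro exI[of _ "SCSnd (SCApp2 (get_prod n) (SCApp2 (upgrade n) S))"])
        (auto intro!: drel_snd[OF _ S(2)] sctx_typing.intros(6)[of _ _ _ _ "uvalty n"]
          typing_context erel_backtrans_closed)
  next
    case (7 C n' k t2)
    then obtain S where S: "\<turnstile>\<^sub>s S : [], \<tau> \<rightarrow> [], uvalty n"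
      "\<And>d w s t. precise d w n \<Longrightarrow> erel d (drel n d) w (SApp (inject n \<tau>) s) t \<Longrightarrow>
        erel d (drel n d) w (splug S s) (uplug C t)"
      by auto
    with 7 show ?case
      by (intro exI[of _ "SCApp2 (downgrade n) (SCInr (SCInl (SCPair1 S (backtrans n t2))))"])
        (auto intro!: drel_pair[OF _ S(2)] sctx_typing.intros(7)
          typing_context erel_backtrans_closed)
  next
    case (8 k t1 C n')
    then obtain S where S: "\<turnstile>\<^sub>s S : [], \<tau> \<rightarrow> [], uvalty n"
      "\<And>d w s t. precise d w n \<Longrightarrow> erel d (drel n d) w (SApp (inject n \<tau>) s) t \<Longrightarrow>
        erel d (drel n d) w (splug S s) (uplug C t)"
      by auto
    with 8 show ?case
      by (intro exI[of _ "SCApp2 (downgrade n) (SCInr (SCInl (SCPair2 (backtrans n t1) S)))"])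
        (auto intro!: drel_pair[OF _ _ S(2)] sctx_typing.intros(8)
          typing_context erel_backtrans_closed)
  next
    case (9 C n' k)
    then obtain S where S: "\<turnstile>\<^sub>s S : [], \<tau> \<rightarrow> [], uvalty n"
      "\<And>d w s t. precise d w n \<Longrightarrow> erel d (drel n d) w (SApp (inject n \<tau>) s) t \<Longrightarrow>
        erel d (drel n d) w (splug S s) (uplug C t)"
      by auto
    with 9 show ?case
      by (intro exI[of _ "SCApp2 (downgrade n) (SCInr (SCInr (SCInl (SCInl S))))"])
        (auto intro!: erel_drel_sum erel_inl S(2) sctx_typing.intros(9)
          typing_context erel_backtrans_closed)
  next
    case (10 C n' k)
    then obtain S where S: "\<turnstile>\<^sub>s S : [], \<tau> \<rightarrow> [], uvalty n"
      "\<And>d w s t. precise d w n \<Longrightarrow> erel d (drel n d) w (SApp (inject n \<tau>) s) t \<Longrightarrow>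
        erel d (drel n d) w (splug S s) (uplug C t)"
      by auto
    with 10 show ?case
      by (intro exI[of _ "SCApp2 (downgrade n) (SCInr (SCInr (SCInl (SCInr S))))"])
        (auto intro!: erel_drel_sum erel_inr S(2) sctx_typing.intros(10)
          typing_context erel_backtrans_closed)
  next
    case (11 C n' k t2 t3)
    then obtain S where S: "\<turnstile>\<^sub>s S : [], \<tau> \<rightarrow> [], uvalty n"
      "\<And>d w s t. precise d w n \<Longrightarrow> erel d (drel n d) w (SApp (inject n \<tau>) s) t \<Longrightarrow>
        erel d (drel n d) w (splug S s) (uplug C t)"
      by auto
    with 11 show ?case
      by (intro exI[of _ "SCCase1 (SCApp2 (get_sum n) (SCApp2 (upgrade n) S)) (backtrans n t2)
          (backtrans n t3)"])
        (auto intro!: drel_case[OF _ S(2)] erel_backtrans_body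
            sctx_typing.intros(11)[of _ _ _ _ "uvalty n" "uvalty n"]
          typing_context erel_backtrans_closed intro: precise_mono less_imp_le)
  next
    case (12 k t1 C n' t3)
    then show ?case
      using uctx_scoped_le by fastforce
  next
    case (13 k t1 t2 C n')
    then show ?case
      using uctx_scoped_le by fastforce
  next
    case (14 C n' k t2)
    then obtain S where S: "\<turnstile>\<^sub>s S : [], \<tau> \<rightarrow> [], uvalty n"
      "\<And>d w s t. precise d w n \<Longrightarrow> erel d (drel n d) w (SApp (inject n \<tau>) s) t \<Longrightarrow>
        erel d (drel n d) w (splug S s) (uplug C t)"
      by auto
    with 14 show ?case
      by (intro exI[of _ "SCSeq1 (SCApp2 (get_unit n) (SCApp2 (upgrade n) S)) (backtrans n t2)"])
        (auto intro!: drel_seq[OF _ S(2)] sctx_typing.intros(14)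
          typing_context erel_backtrans_closed)
  next
    case (15 k t1 C n')
    then obtain S where S: "\<turnstile>\<^sub>s S : [], \<tau> \<rightarrow> [], uvalty n"
      "\<And>d w s t. precise d w n \<Longrightarrow> erel d (drel n d) w (SApp (inject n \<tau>) s) t \<Longrightarrow>
        erel d (drel n d) w (splug S s) (uplug C t)"
      by auto
    with 15 show ?case
      by (intro exI[of _ "SCSeq2 (SApp (get_unit n) (SApp (upgrade n) (backtrans n t1))) S"])
        (auto intro!: drel_seq[OF _ _ _ S(2)] sctx_typing.intros(15)
          typing_context erel_backtrans_closed)
  next
    case (16 C n' k t2 t3)
    then obtain S where S: "\<turnstile>\<^sub>s S : [], \<tau> \<rightarrow> [], uvalty n"
      "\<And>d w s t. precise d w n \<Longrightarrow> erel d (drel n d) w (SApp (inject n \<tau>) s) t \<Longrightarrow>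
        erel d (drel n d) w (splug S s) (uplug C t)"
      by auto
    with 16 show ?case
      by (intro exI[of _ "SCIf1 (SCApp2 (get_bool n) (SCApp2 (upgrade n) S)) (backtrans n t2)
          (backtrans n t3)"])
        (auto intro!: drel_if[OF _ S(2)] sctx_typing.intros(16)
          typing_context erel_backtrans_closed)
  next
    case (17 k t1 C n' t3)
    then obtain S where S: "\<turnstile>\<^sub>s S : [], \<tau> \<rightarrow> [], uvalty n"
      "\<And>d w s t. precise d w n \<Longrightarrow> erel d (drel n d) w (SApp (inject n \<tau>) s) t \<Longrightarrow>
        erel d (drel n d) w (splug S s) (uplug C t)"
      by auto
    with 17 show ?case
      by (intro exI[of _ "SCIf2 (SApp (get_bool n) (SApp (upgrade n) (backtrans n t1))) S
          (backtrans n t3)"])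
        (auto intro!: drel_if[OF _ _ _ S(2)] sctx_typing.intros(17)
          typing_context erel_backtrans_closed)
  next
    case (18 k t1 t2 C n')
    then obtain S where S: "\<turnstile>\<^sub>s S : [], \<tau> \<rightarrow> [], uvalty n"
      "\<And>d w s t. precise d w n \<Longrightarrow> erel d (drel n d) w (SApp (inject n \<tau>) s) t \<Longrightarrow>
        erel d (drel n d) w (splug S s) (uplug C t)"
      by auto
    with 18 show ?case
      by (intro exI[of _ "SCIf3 (SApp (get_bool n) (SApp (upgrade n) (backtrans n t1)))
          (backtrans n t2) S"])
        (auto intro!: drel_if[OF _ _ _ _ S(2)] sctx_typing.intros(18)
          typing_context erel_backtrans_closed)
  qed
  from this[OF assms] show thesis
    using that by blast
qed

theorem compile_preserves:
  assumes t: "[] \<turnstile>\<^sub>s t1 \<Colon> \<tau>" "[] \<turnstile>\<^sub>s t2 \<Colon> \<tau>"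
    and equiv: "[] \<turnstile>\<^sub>s t1 \<simeq>\<^sub>c\<^sub>t\<^sub>x t2 \<Colon> \<tau>"
    and C: "\<turnstile>\<^sub>u C : 0 \<rightarrow> 0" and conv: "(uplug C (compile \<tau> t1)) \<Down>\<^sub>u"
  shows "(uplug C (compile \<tau> t2)) \<Down>\<^sub>u"
proof -
  \<comment> \<open>The fuel of the given run fixes the level of approximation: backwards, index
    \<open>n\<close> is precise for level \<open>n\<close>.\<close>
  obtain n k' u where run: "uev (uplug C (compile \<tau> t1)) n k' u"
    using conv unfolding uconverges_iff uevals_def by blast
  obtain S where S: "\<turnstile>\<^sub>s S : [], \<tau> \<rightarrow> [], uvalty n"
    and rel: "\<And>d w s t. precise d w n \<Longrightarrow> erel d (drel n d) w (SApp (inject n \<tau>) s) t \<Longrightarrow>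
      erel d (drel n d) w (splug S s) (uplug C t)"
    using backtrans_context[OF C] by blast
  have "erel Bwd (drel n Bwd) n (splug S t1) (uplug C (compile \<tau> t1))"
    by (intro rel erel_inject_compile t) (auto simp: precise_def)
  then have "(splug S t1) \<Down>\<^sub>s"
    using run unfolding sconverges_iff by auto
  then have "(splug S t2) \<Down>\<^sub>s"
    using equiv S unfolding sctx_equiv_def by blast
  \<comment> \<open>The run of \<open>splug S t2\<close> may take more than \<open>n\<close> steps,
    but forwards every index is precise.\<close>
  moreover have "erel Fwd (drel n Fwd) w (splug S t2) (uplug C (compile \<tau> t2))" for w
    by (intro rel erel_inject_compile t) (auto simp: precise_def)
  ultimately show ?thesis
    using erel_Fwd_converges by blast
qed

theorem theorem6p3:
  fixes t1 t2 :: strm and \<tau> :: ty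
  assumes "[] \<turnstile>\<^sub>s t1 \<Colon> \<tau>" and "[] \<turnstile>\<^sub>s t2 \<Colon> \<tau>"
  shows "([] \<turnstile>\<^sub>s t1 \<simeq>\<^sub>c\<^sub>t\<^sub>x t2 \<Colon> \<tau>) \<longleftrightarrow> (0 \<turnstile>\<^sub>u compile \<tau> t1 \<simeq>\<^sub>c\<^sub>t\<^sub>x compile \<tau> t2)"
proof
  assume equiv: "[] \<turnstile>\<^sub>s t1 \<simeq>\<^sub>c\<^sub>t\<^sub>x t2 \<Colon> \<tau>"
  \<comment> \<open>Preservation gives one implication of convergence; applied to the reversed
    equivalence it gives the other.\<close>
  then have "[] \<turnstile>\<^sub>s t2 \<simeq>\<^sub>c\<^sub>t\<^sub>x t1 \<Colon> \<tau>"
    unfolding sctx_equiv_def by blast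
  with equiv show "0 \<turnstile>\<^sub>u compile \<tau> t1 \<simeq>\<^sub>c\<^sub>t\<^sub>x compile \<tau> t2"
    unfolding uctx_equiv_def using compile_preserves assms by blast
next
  assume "0 \<turnstile>\<^sub>u compile \<tau> t1 \<simeq>\<^sub>c\<^sub>t\<^sub>x compile \<tau> t2"
  then show "[] \<turnstile>\<^sub>s t1 \<simeq>\<^sub>c\<^sub>t\<^sub>x t2 \<Colon> \<tau>"
    by (rule compile_reflects[OF assms])
qed

end
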